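(* Let $(M,d)$ be a complete pointed metric space with base point $0$. Let $\mu$ be a positive Radon measure on $\beta\widetilde{M}$ which is an optimal representation (i.e. $\|\mu\|=\|\Phi^*\mu\|$), which is $\preccurlyeq$-minimal, and which satisfies $\Phi^*\mu\in\mathcal{F}(M)$. Then $\mu$ is concentrated on $p^{-1}(M\times M)$.
   Context: $\mathrm{Lip}_0(M)$ is the Banach space of Lipschitz $f:M\to\mathbb{R}$ with $f(0)=0$, normed by the Lipschitz constant; $\mathcal{F}(M)\subset\mathrm{Lip}_0(M)^*$ is the closed linear span of the evaluation functionals $\delta(x)$, $x\in M$. $\widetilde{M}=\{(x,y)\in M\times M:x\neq y\}$, $\beta\widetilde{M}$ is its Stone–Čech compactification, and Radon measures on $\beta\widetilde{M}$ are identified with $C(\beta\widetilde{M})^*$. $\Phi:\mathrm{Lip}_0(M)\to C(\beta\widetilde{M})$ sends $f$ to the continuous extension of $(x,y)\mapsto (f(x)-f(y))/d(x,y)$, and $\Phi^*$ is its adjoint. $M^u$ is the uniform (Samuel) compactification of $M$; $p_1,p_2:\beta\widetilde{M}\to M^u$ are the continuous extensions of $(x,y)\mapsto x$, $(x,y)\mapsto y$, and $p=(p_1,p_2)$. Let $G$ be the set of $g\in C(\beta\widetilde{M})$ such that $d(x,y)g(x,y)\le d(x,u)g(x,u)+d(u,y)g(u,y)$ for all distinct $x,u,y\in M$. For positive Radon measures $\mu,\nu$ on $\beta\widetilde{M}$ write $\mu\preccurlyeq\nu$ if $\int g\,d\mu\le\int g\,d\nu$ for all $g\in G$; $\mu$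 is $\preccurlyeq$-minimal if every positive $\nu$ with $\nu\preccurlyeq\mu$ also satisfies $\mu\preccurlyeq\nu$. Throughout, $M$ is assumed to have at least three distinct points. *)

theory Defs
  imports "HOL-Analysis.Analysis" "HOL-Probability.Probability"
begin

text \<open>The pointed metric space M is the whole type 'a (a complete metric space),
  with base point z.  Lip_0(M) and F(M).\<close>

definition Lip0 :: "'a::metric_space \<Rightarrow> ('a \<Rightarrow> real) set" where
  "Lip0 z = {f. f z = 0 \<and> (\<exists>C. C-lipschitz_on UNIV f)}"

definition lip_const :: "('a::metric_space \<Rightarrow> real) \<Rightarrow> real" where
  "lip_const f = Inf {C. C-lipschitz_on UNIV f}"

text \<open>Functionals on Lip_0(M) are functions (('a => real) => real); only their values on Lip0 matter.\<close>

definition dual_norm :: "'a::metric_space \<Rightarrow> (('a \<Rightarrow> real) \<Rightarrow> real) \<Rightarrow> real" where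
  "dual_norm z \<phi> = Sup {\<bar>\<phi> f\<bar> | f. f \<in> Lip0 z \<and> lip_const f \<le> 1}"

definition delta :: "'a \<Rightarrow> ('a \<Rightarrow> real) \<Rightarrow> real" where
  "delta x = (\<lambda>f. f x)"

definition in_free_space :: "'a::metric_space \<Rightarrow> (('a \<Rightarrow> real) \<Rightarrow> real) \<Rightarrow> bool" where
  "in_free_space z \<phi> \<longleftrightarrow>
     (\<forall>\<epsilon>>0. \<exists>S a. finite S \<and>
        (\<forall>f. f \<in> Lip0 z \<and> lip_const f \<le> 1 \<longrightarrow>
             \<bar>\<phi> f - (\<Sum>x\<in>S. a x * delta x f)\<bar> \<le> \<epsilon>))"

text \<open>Stone--Cech compactification of M~ = {(x,y). x \<noteq> y}, realised as the closure of the
  evaluation embedding into the product of real lines indexed by the bounded continuous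
  functions on M~ (normalised to be 0 off M~).  A continuous g on M~ extends to the
  function zeta \<mapsto> zeta g.\<close>

definition Mtilde :: "('a::metric_space \<times> 'a) set" where
  "Mtilde = {(x, y). x \<noteq> y}"

definition Cb_tilde :: "(('a::metric_space \<times> 'a) \<Rightarrow> real) set" where
  "Cb_tilde = {g. continuous_on Mtilde g \<and> bounded (g ` Mtilde) \<and> (\<forall>q. q \<notin> Mtilde \<longrightarrow> g q = 0)}"

definition beta_emb :: "('a::metric_space \<times> 'a) \<Rightarrow> ((('a \<times> 'a) \<Rightarrow> real) \<Rightarrow> real)" where
  "beta_emb q = restrict (\<lambda>g. g q) Cb_tilde"

definition beta_top :: "((('a::metric_space \<times> 'a) \<Rightarrow> real) \<Rightarrow> real) topology" where
  "beta_top = subtopology (powertop_real Cb_tilde)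
                 ((powertop_real Cb_tilde) closure_of (beta_emb ` Mtilde))"

definition ext_beta :: "(('a::metric_space \<times> 'a) \<Rightarrow> real) \<Rightarrow> ((('a \<times> 'a) \<Rightarrow> real) \<Rightarrow> real) \<Rightarrow> real" where
  "ext_beta g \<zeta> = \<zeta> g"

definition Phi :: "('a::metric_space \<Rightarrow> real) \<Rightarrow> ('a \<times> 'a) \<Rightarrow> real" where
  "Phi f = (\<lambda>q. if q \<in> Mtilde then (f (fst q) - f (snd q)) / dist (fst q) (snd q) else 0)"

definition Phi_hat :: "('a::metric_space \<Rightarrow> real) \<Rightarrow> ((('a \<times> 'a) \<Rightarrow> real) \<Rightarrow> real) \<Rightarrow> real" where
  "Phi_hat f = ext_beta (Phi f)"

definition radon_on :: "'b topology \<Rightarrow> 'b measure \<Rightarrow> bool" where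
  "radon_on T \<mu> \<longleftrightarrow>
     space \<mu> = topspace T \<and>
     sets \<mu> = sigma_sets (topspace T) {U. openin T U} \<and>
     emeasure \<mu> (space \<mu>) < \<infinity> \<and>
     (\<forall>B\<in>sets \<mu>. emeasure \<mu> B = (SUP K\<in>{K. compactin T K \<and> K \<subseteq> B}. emeasure \<mu> K))"

definition Phi_star :: "((('a::metric_space \<times> 'a) \<Rightarrow> real) \<Rightarrow> real) measure \<Rightarrow> ('a \<Rightarrow> real) \<Rightarrow> real" where
  "Phi_star \<mu> = (\<lambda>f. integral\<^sup>L \<mu> (Phi_hat f))"

definition G_set :: "(((('a::metric_space \<times> 'a) \<Rightarrow> real) \<Rightarrow> real) \<Rightarrow> real) set" where
  "G_set = {g. continuous_map beta_top euclideanreal g \<and>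
      (\<forall>x u y. x \<noteq> u \<and> u \<noteq> y \<and> x \<noteq> y \<longrightarrow>
         dist x y * g (beta_emb (x, y)) \<le> dist x u * g (beta_emb (x, u)) + dist u y * g (beta_emb (u, y)))}"

definition preceq :: "((('a::metric_space \<times> 'a) \<Rightarrow> real) \<Rightarrow> real) measure \<Rightarrow> ((('a \<times> 'a) \<Rightarrow> real) \<Rightarrow> real) measure \<Rightarrow> bool" where
  "preceq \<mu> \<nu> \<longleftrightarrow> (\<forall>g\<in>G_set. integral\<^sup>L \<mu> g \<le> integral\<^sup>L \<nu> g)"

definition preceq_minimal :: "((('a::metric_space \<times> 'a) \<Rightarrow> real) \<Rightarrow> real) measure \<Rightarrow> bool" where
  "preceq_minimal \<mu> \<longleftrightarrow> (\<forall>\<nu>. radon_on beta_top \<nu> \<longrightarrow> preceq \<nu> \<mu> \<longrightarrow> preceq \<mu> \<nu>)"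

text \<open>Uniform (Samuel) compactification M^u: closure of the evaluation embedding into the
  product indexed by bounded uniformly continuous functions on M; and the maps p1, p2
  (continuous extensions of (x,y) \<mapsto> x and (x,y) \<mapsto> y).\<close>

definition Cu :: "('a::metric_space \<Rightarrow> real) set" where
  "Cu = {h. uniformly_continuous_on UNIV h \<and> bounded (range h)}"

definition samuel_emb :: "'a::metric_space \<Rightarrow> (('a \<Rightarrow> real) \<Rightarrow> real)" where
  "samuel_emb x = restrict (\<lambda>h. h x) Cu"

definition samuel_top :: "(('a::metric_space \<Rightarrow> real) \<Rightarrow> real) topology" where
  "samuel_top = subtopology (powertop_real Cu) ((powertop_real Cu) closure_of (range samuel_emb))"

definition p1 :: "((('a::metric_space \<times> 'a) \<Rightarrow> real) \<Rightarrow> real) \<Rightarrow> (('a \<Rightarrow> real) \<Rightarrow> real)" where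
  "p1 \<zeta> = restrict (\<lambda>h. \<zeta> (\<lambda>q. if q \<in> Mtilde then h (fst q) else 0)) Cu"

definition p2 :: "((('a::metric_space \<times> 'a) \<Rightarrow> real) \<Rightarrow> real) \<Rightarrow> (('a \<Rightarrow> real) \<Rightarrow> real)" where
  "p2 \<zeta> = restrict (\<lambda>h. \<zeta> (\<lambda>q. if q \<in> Mtilde then h (snd q) else 0)) Cu"

definition p_preimage_MM :: "((('a::metric_space \<times> 'a) \<Rightarrow> real) \<Rightarrow> real) set" where
  "p_preimage_MM = {\<zeta> \<in> topspace beta_top. p1 \<zeta> \<in> range samuel_emb \<and> p2 \<zeta> \<in> range samuel_emb}"

definition concentrated_on :: "'b measure \<Rightarrow> 'b set \<Rightarrow> bool" where
  "concentrated_on \<mu> A \<longleftrightarrow> (\<exists>B\<in>sets \<mu>. B \<subseteq> A \<and> emeasure \<mu> (space \<mu> - B) = 0)"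

end

theory Submission
  imports Defs
begin

text \<open>
  Minimality of \<open>\<mu>\<close> is dualised (Hahn-Banach and Riesz): for every \<open>g \<in> G\<close> some \<open>k \<in> G\<close> with
  \<open>k \<ge> - g\<close> has \<open>\<integral>(k + g) d\<mu>\<close> arbitrarily small.  Take \<open>d g = min(d, \<phi>(x) + \<phi>(y))\<close> with
  \<open>\<phi>(x) = h (1 + d(x,0))\<close> and set \<open>A(x) = inf\<^sub>y (d(y,x) k(y,x) + \<phi>(y))\<close>.  Then \<open>\<bar>A\<bar> \<le> \<phi>\<close>, and up to an
  \<open>L\<^sup>1(\<mu>)\<close>-small error \<open>\<Phi> A \<ge> g\<close>: where \<open>d \<ge> \<phi>(x) + \<phi>(y)\<close>, the function \<open>A\<close> drops from nearly \<open>\<phi>\<close> at the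
  first coordinate to nearly \<open>- \<phi>\<close> at the second.  The Lipschitz constant \<open>C\<close> of \<open>A\<close> is not controlled, but
  \<open>\<Phi>\<^sup>*\<mu> \<in> F(M)\<close> is tested only after \<open>C\<close> is known: choose a finite set \<open>S\<close> so large that \<open>\<Phi>\<^sup>*\<mu>\<close> is small
  on \<open>(C + 2)\<close>-Lipschitz functions vanishing on \<open>S\<close>, and clamp \<open>A\<close> between \<open>\<plusminus> \<kappa>\<close> times the distance to a
  neighbourhood of \<open>S\<close>.  The clamped function \<open>B\<close> still satisfies \<open>\<Phi> B \<ge> - 2 \<kappa>\<close> up to the error, however
  large \<open>C\<close> is, it agrees with \<open>A\<close> far from \<open>S\<close>, and \<open>\<Phi> B\<close> vanishes on most of \<open>p\<^sup>-\<^sup>1(M \<times> M)\<close>.  Since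
  \<open>\<integral> \<Phi> B d\<mu>\<close> is nearly \<open>0\<close>, letting first \<open>h \<rightarrow> 0\<close> with \<open>\<kappa> = 1\<close>, and then \<open>h = \<kappa> H\<close> with \<open>\<kappa> \<rightarrow> 0\<close>, shows
  that \<open>\<mu>\<close> has no mass off \<open>p\<^sup>-\<^sup>1(M \<times> M)\<close>, on and off the diagonal respectively.
\<close>

section \<open>Domination by sublinear functionals\<close>

text \<open>Only an inequality is asked for positive scalars, since an infimum inherits it at once;
  equality for all c \<ge> 0 is recovered in \<open>sublinear_scale\<close>.\<close>

definition sublinear_on :: "('b \<Rightarrow> real) set \<Rightarrow> (('b \<Rightarrow> real) \<Rightarrow> real) \<Rightarrow> bool" where
  "sublinear_on V p \<longleftrightarrow>
     (\<forall>f\<in>V. \<forall>g\<in>V. p (\<lambda>x. f x + g x) \<le> p f + p g) \<and>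
     (\<forall>f\<in>V. \<forall>c>0. p (\<lambda>x. c * f x) \<le> c * p f) \<and> p (\<lambda>x. 0) = 0"

lemma sublinear_on_add: "sublinear_on V p \<Longrightarrow> f \<in> V \<Longrightarrow> g \<in> V \<Longrightarrow> p (\<lambda>x. f x + g x) \<le> p f + p g"
  and sublinear_on_zero: "sublinear_on V p \<Longrightarrow> p (\<lambda>x. 0) = 0"
  and sublinear_on_scale_le: "sublinear_on V p \<Longrightarrow> f \<in> V \<Longrightarrow> 0 < c \<Longrightarrow> p (\<lambda>x. c * f x) \<le> c * p f"
  by (auto simp: sublinear_on_def)

locale function_space =
  fixes V :: "('b \<Rightarrow> real) set"
  assumes add_mem: "f \<in> V \<Longrightarrow> g \<in> V \<Longrightarrow> (\<lambda>x. f x + g x) \<in> V"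
    and scale_mem: "f \<in> V \<Longrightarrow> (\<lambda>x. c * f x) \<in> V"
    and zero_mem: "(\<lambda>x. 0) \<in> V"
begin

lemma uminus_mem: "f \<in> V \<Longrightarrow> (\<lambda>x. - f x) \<in> V"
  using scale_mem[of f "-1"] by simp

lemma sublinear_scale:
  assumes "sublinear_on V p" "f \<in> V" "0 \<le> c"
  shows "p (\<lambda>x. c * f x) = c * p f"
proof (cases "c = 0")
  case True
  then show ?thesis using sublinear_on_zero[OF assms(1)] by simp
next
  case False
  then have c: "c > 0" using assms by simp
  have "p (\<lambda>x. inverse c * (c * f x)) \<le> inverse c * p (\<lambda>x. c * f x)"
    using assms c by (intro sublinear_on_scale_le[OF assms(1)] scale_mem) auto
  then have "c * p f \<le> p (\<lambda>x. c * f x)"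
    using c by (simp add: field_simps)
  with sublinear_on_scale_le[OF assms(1,2) c] show ?thesis by simp
qed

lemma sublinear_lower:
  assumes "sublinear_on V p" "f \<in> V"
  shows "- p (\<lambda>x. - f x) \<le> p f"
  using sublinear_on_add[OF assms(1,2) uminus_mem[OF assms(2)]] sublinear_on_zero[OF assms(1)]
  by simp

text \<open>The infimum lies below p (take t = 0) and is at most - p y at - y (take t = 1). Hence a
  minimal sublinear p must already satisfy p (- y) = - p y.\<close>

definition shift :: "(('b \<Rightarrow> real) \<Rightarrow> real) \<Rightarrow> ('b \<Rightarrow> real) \<Rightarrow> ('b \<Rightarrow> real) \<Rightarrow> real" where
  "shift p y f = (INF t\<in>{0..}. p (\<lambda>x. f x + t * y x) - t * p y)"

lemma shift_bdd:
  assumes p: "sublinear_on V p" and y: "y \<in> V" and f: "f \<in> V"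
  shows "bdd_below ((\<lambda>t. p (\<lambda>x. f x + t * y x) - t * p y) ` {0..})"
proof (rule bdd_belowI2)
  fix t :: real assume "t \<in> {0..}"
  then have t: "t \<ge> 0" by simp
  have "p (\<lambda>x. (f x + t * y x) + - f x) \<le> p (\<lambda>x. f x + t * y x) + p (\<lambda>x. - f x)"
    using y f by (intro sublinear_on_add[OF p] add_mem scale_mem uminus_mem)
  moreover have "p (\<lambda>x. t * y x) = t * p y" using sublinear_scale[OF p y t] .
  ultimately show "- p (\<lambda>x. - f x) \<le> p (\<lambda>x. f x + t * y x) - t * p y"
    by simp
qed

lemma shift_le_t:
  assumes "sublinear_on V p" "y \<in> V" "f \<in> V" "t \<ge> 0"
  shows "shift p y f \<le> p (\<lambda>x. f x + t * y x) - t * p y"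
  unfolding shift_def using assms by (intro cINF_lower shift_bdd) auto

lemma shift_le:
  assumes "sublinear_on V p" "y \<in> V" "f \<in> V"
  shows "shift p y f \<le> p f"
  using shift_le_t[OF assms, of 0] by simp

lemma shift_uminus:
  assumes "sublinear_on V p" "y \<in> V"
  shows "shift p y (\<lambda>x. - y x) \<le> - p y"
  using shift_le_t[OF assms uminus_mem[OF assms(2)], of 1] sublinear_on_zero[OF assms(1)] by simp

lemma sublinear_shift:
  assumes p: "sublinear_on V p" and y: "y \<in> V"
  shows "sublinear_on V (shift p y)"
  unfolding sublinear_on_def
proof (intro conjI ballI allI impI)
  fix f g assume fg: "f \<in> V" "g \<in> V"
  have *: "shift p y (\<lambda>x. f x + g x) \<le>
      (p (\<lambda>x. f x + s * y x) - s * p y) + (p (\<lambda>x. g x + t * y x) - t * p y)"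
    if "s \<ge> 0" "t \<ge> 0" for s t
  proof -
    have "shift p y (\<lambda>x. f x + g x) \<le> p (\<lambda>x. f x + g x + (s + t) * y x) - (s + t) * p y"
      using that fg by (intro shift_le_t p y add_mem) auto
    also have "(\<lambda>x. f x + g x + (s + t) * y x) = (\<lambda>x. (f x + s * y x) + (g x + t * y x))"
      by (auto simp: algebra_simps)
    also have "p \<dots> \<le> p (\<lambda>x. f x + s * y x) + p (\<lambda>x. g x + t * y x)"
      using y fg by (intro sublinear_on_add[OF p] add_mem scale_mem)
    finally show ?thesis by (simp add: algebra_simps)
  qed
  have "shift p y (\<lambda>x. f x + g x) - (p (\<lambda>x. f x + s * y x) - s * p y) \<le> shift p y g" if "s \<ge> 0" for s
    unfolding shift_def[of p y] using *[OF that]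
    by (intro cINF_greatest) (auto simp: shift_def algebra_simps)
  then have "shift p y (\<lambda>x. f x + g x) - shift p y g \<le> shift p y f"
    unfolding shift_def[of p y f] by (intro cINF_greatest) (auto simp: algebra_simps)
  then show "shift p y (\<lambda>x. f x + g x) \<le> shift p y f + shift p y g" by simp
next
  fix f and c :: real assume f: "f \<in> V" and c: "0 < c"
  have "shift p y (\<lambda>x. c * f x) / c \<le> shift p y f"
    unfolding shift_def[of p y f]
  proof (rule cINF_greatest)
    fix t :: real assume t: "t \<in> {0..}"
    have "shift p y (\<lambda>x. c * f x) \<le> p (\<lambda>x. c * f x + (c * t) * y x) - (c * t) * p y"
      using f c t by (intro shift_le_t p y scale_mem) auto
    also have "p (\<lambda>x. c * f x + (c * t) * y x) = p (\<lambda>x. c * (f x + t * y x))"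
      by (simp add: algebra_simps)
    also have "\<dots> = c * p (\<lambda>x. f x + t * y x)"
      using f c y by (intro sublinear_scale p add_mem scale_mem) auto
    finally show "shift p y (\<lambda>x. c * f x) / c \<le> p (\<lambda>x. f x + t * y x) - t * p y"
      using c by (simp add: field_simps)
  qed auto
  then show "shift p y (\<lambda>x. c * f x) \<le> c * shift p y f"
    using c by (simp add: field_simps)
next
  have "p (\<lambda>x. t * y x) - t * p y = 0" if "t \<in> {0..}" for t
    using sublinear_scale[OF p y] that by simp
  then have "(\<lambda>t. p (\<lambda>x. 0 + t * y x) - t * p y) ` {0..} = (\<lambda>t::real. 0) ` {0..}"
    by (intro image_cong) simp_all
  then have "shift p y (\<lambda>x. 0) = (INF t\<in>{0::real..}. 0)"
    unfolding shift_def by metis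
  then show "shift p y (\<lambda>x. 0) = 0" by simp
qed

lemma minimal_sublinear_below:
  assumes Q: "sublinear_on V Q"
  obtains p where "sublinear_on V p" "\<And>f. f \<in> V \<Longrightarrow> p f \<le> Q f"
    "\<And>q. sublinear_on V q \<Longrightarrow> (\<And>f. f \<in> V \<Longrightarrow> q f \<le> p f) \<Longrightarrow> (\<And>f. f \<in> V \<Longrightarrow> q f = p f)"
proof -
  \<comment> \<open>Members of \<open>A\<close> are fixed to be 0 off V: \<open>P\<close> compares
    values on V only and would otherwise fail to be antisymmetric.\<close>
  define A where "A = {p. sublinear_on V p \<and> (\<forall>f\<in>V. p f \<le> Q f) \<and> (\<forall>f. f \<notin> V \<longrightarrow> p f = 0)}"
  define P where "P = (\<lambda>p q :: ('b \<Rightarrow> real) \<Rightarrow> real. \<forall>f\<in>V. q f \<le> p f)"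
  define ex where "ex = (\<lambda>(p :: ('b \<Rightarrow> real) \<Rightarrow> real) f. if f \<in> V then p f else 0)"
  have ex_sub: "sublinear_on V (ex p)" if "sublinear_on V p" for p
    using that unfolding sublinear_on_def ex_def by (auto simp: add_mem scale_mem zero_mem)
  have "\<exists>m\<in>A. \<forall>a\<in>A. P m a \<longrightarrow> a = m"
  proof (rule predicate_Zorn)
    show "partial_order_on A (relation_of P A)"
    proof (rule partial_order_on_relation_ofI)
      fix a b assume "a \<in> A" "b \<in> A" "P a b" "P b a"
      then show "a = b" unfolding A_def P_def
        by (intro ext) (case_tac "x \<in> V"; simp add: order_antisym)
    next
      fix a b c assume "P a b" "P b c"
      then show "P a c" unfolding P_def by force
    qed (simp add: P_def)
  next
    fix C assume C: "C \<in> Chains (relation_of P A)"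
    then have CA: "C \<subseteq> A" unfolding Chains_def relation_of_def by auto
    have Ctot: "P a b \<or> P b a" if "a \<in> C" "b \<in> C" for a b
      using C that unfolding Chains_def relation_of_def by auto
    show "\<exists>u\<in>A. \<forall>a\<in>C. P a u"
    proof (cases "C = {}")
      case True
      have "ex Q \<in> A" using ex_sub[OF Q] by (auto simp: A_def ex_def)
      then show ?thesis using True by auto
    next
      case False
      define u where "u = ex (\<lambda>f. INF p\<in>C. p f)"
      have subC: "sublinear_on V p" if "p \<in> C" for p using that CA by (auto simp: A_def)
      have lb: "- Q (\<lambda>x. - f x) \<le> p f" if "p \<in> C" "f \<in> V" for p f
      proof -
        have "p (\<lambda>x. - f x) \<le> Q (\<lambda>x. - f x)"
          using CA that(1) uminus_mem[OF that(2)] unfolding A_def by auto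
        then show ?thesis using sublinear_lower[OF subC[OF that(1)] that(2)] by simp
      qed
      have bdd: "bdd_below ((\<lambda>p. p f) ` C)" if "f \<in> V" for f
        using lb[OF _ that] by (auto intro!: bdd_belowI2)
      have ule: "u f \<le> p f" if "p \<in> C" "f \<in> V" for p f
        using that unfolding u_def ex_def by (auto intro!: cINF_lower bdd)
      have "sublinear_on V (\<lambda>f. INF p\<in>C. p f)"
        unfolding sublinear_on_def
      proof (intro conjI ballI allI impI)
        fix f g assume fg: "f \<in> V" "g \<in> V"
        \<comment> \<open>Subadditivity of the infimum needs one functional that is small at f and
          at g simultaneously; the smaller of p and q in the chain is such an r.\<close>
        have *: "(INF p\<in>C. p (\<lambda>x. f x + g x)) \<le> p f + q g" if pq: "p \<in> C" "q \<in> C" for p q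
        proof -
          obtain r where r: "r \<in> C" "r f \<le> p f" "r g \<le> q g"
            using Ctot[OF pq] pq fg unfolding P_def by blast
          have "(INF p\<in>C. p (\<lambda>x. f x + g x)) \<le> r (\<lambda>x. f x + g x)"
            using r fg by (intro cINF_lower bdd add_mem) auto
          also have "\<dots> \<le> r f + r g" using sublinear_on_add[OF subC[OF r(1)] fg] .
          finally show ?thesis using r by simp
        qed
        have "(INF p\<in>C. p (\<lambda>x. f x + g x)) - p f \<le> (INF q\<in>C. q g)" if "p \<in> C" for p
          using *[OF that] False by (intro cINF_greatest) (auto simp: algebra_simps)
        then have "(INF p\<in>C. p (\<lambda>x. f x + g x)) - (INF q\<in>C. q g) \<le> (INF p\<in>C. p f)"
          using False by (intro cINF_greatest) (auto simp: algebra_simps)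
        then show "(INF p\<in>C. p (\<lambda>x. f x + g x)) \<le> (INF p\<in>C. p f) + (INF p\<in>C. p g)" by simp
      next
        fix f and c :: real assume f: "f \<in> V" and c: "0 < c"
        have "(INF p\<in>C. p (\<lambda>x. c * f x)) / c \<le> (INF p\<in>C. p f)"
        proof (rule cINF_greatest)
          fix p assume p: "p \<in> C"
          have "(INF p\<in>C. p (\<lambda>x. c * f x)) \<le> p (\<lambda>x. c * f x)"
            using p f by (intro cINF_lower bdd scale_mem) auto
          also have "\<dots> \<le> c * p f" using sublinear_on_scale_le[OF subC[OF p] f c] .
          finally show "(INF p\<in>C. p (\<lambda>x. c * f x)) / c \<le> p f" using c by (simp add: field_simps)
        qed (use False in auto)
        then show "(INF p\<in>C. p (\<lambda>x. c * f x)) \<le> c * (INF p\<in>C. p f)"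
          using c by (simp add: field_simps)
      next
        have "(\<lambda>p. p (\<lambda>x. 0)) ` C = (\<lambda>p. 0) ` C"
          by (intro image_cong) (simp_all add: sublinear_on_zero[OF subC])
        then show "(INF p\<in>C. p (\<lambda>x. 0)) = 0" using False by (metis cINF_const)
      qed
      then have "sublinear_on V u" unfolding u_def by (rule ex_sub)
      moreover have "u f \<le> Q f" if "f \<in> V" for f
      proof -
        obtain p where "p \<in> C" using False by auto
        then have "u f \<le> p f" "p f \<le> Q f" using ule that CA unfolding A_def by auto
        then show ?thesis by simp
      qed
      ultimately have "u \<in> A" unfolding A_def by (auto simp: u_def ex_def)
      moreover have "\<forall>a\<in>C. P a u" using ule by (auto simp: P_def)
      ultimately show ?thesis by blast
    qed
  qed
  then obtain m where m: "m \<in> A" and min: "\<And>a. a \<in> A \<Longrightarrow> P m a \<Longrightarrow> a = m" by blast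
  show ?thesis
  proof (rule that[of m])
    show "sublinear_on V m" "\<And>f. f \<in> V \<Longrightarrow> m f \<le> Q f" using m by (auto simp: A_def)
    fix q f assume q: "sublinear_on V q" "\<And>f. f \<in> V \<Longrightarrow> q f \<le> m f" and f: "f \<in> V"
    have "ex q \<in> A" using ex_sub[OF q(1)] order_trans[OF q(2)] m unfolding A_def by (simp add: ex_def)
    moreover have "P m (ex q)" using q(2) by (auto simp: P_def ex_def)
    ultimately have "ex q = m" by (rule min)
    then have "ex q f = m f" by simp
    then show "q f = m f" using f by (simp add: ex_def)
  qed
qed

text \<open>Take p minimal below \<open>shift Q f0\<close>. Minimality against
  \<open>shift p y\<close> makes p odd, and an odd subadditive functional is additive. Starting from
  the shift by f0, rather than from Q, forces p (- f0) \<le> - Q f0, hence equality at f0.\<close>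

theorem hahn_banach_dominated:
  assumes Q: "sublinear_on V Q" and f0: "f0 \<in> V"
  obtains L where "\<And>f g. f \<in> V \<Longrightarrow> g \<in> V \<Longrightarrow> L (\<lambda>x. f x + g x) = L f + L g"
    "\<And>f c. f \<in> V \<Longrightarrow> L (\<lambda>x. c * f x) = c * L f"
    "\<And>f. f \<in> V \<Longrightarrow> L f \<le> Q f" "L f0 = Q f0"
proof -
  obtain p where p: "sublinear_on V p" and ple: "\<And>f. f \<in> V \<Longrightarrow> p f \<le> shift Q f0 f"
    and min: "\<And>q f. sublinear_on V q \<Longrightarrow> (\<And>f. f \<in> V \<Longrightarrow> q f \<le> p f) \<Longrightarrow> f \<in> V \<Longrightarrow> q f = p f"
    using minimal_sublinear_below[OF sublinear_shift[OF Q f0], of thesis] by blast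
  have neg: "p (\<lambda>x. - y x) = - p y" if y: "y \<in> V" for y
  proof -
    have "shift p y (\<lambda>x. - y x) = p (\<lambda>x. - y x)"
      using y by (intro min sublinear_shift p shift_le uminus_mem)
    then show ?thesis
      using shift_uminus[OF p y] sublinear_lower[OF p y] by simp
  qed
  show ?thesis
  proof (rule that[of p])
    fix f g assume fg: "f \<in> V" "g \<in> V"
    have "p (\<lambda>x. - f x + - g x) \<le> p (\<lambda>x. - f x) + p (\<lambda>x. - g x)"
      using fg by (intro sublinear_on_add[OF p] uminus_mem)
    moreover have "p (\<lambda>x. - (f x + g x)) = - p (\<lambda>x. f x + g x)"
      using fg by (intro neg add_mem)
    ultimately show "p (\<lambda>x. f x + g x) = p f + p g"
      using sublinear_on_add[OF p fg] neg fg by simp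
  next
    fix f and c :: real assume f: "f \<in> V"
    show "p (\<lambda>x. c * f x) = c * p f"
    proof (cases "c \<ge> 0")
      case True
      then show ?thesis using sublinear_scale[OF p f] by simp
    next
      case False
      then have "p (\<lambda>x. (- c) * - f x) = (- c) * p (\<lambda>x. - f x)"
        using f by (intro sublinear_scale[OF p] uminus_mem) auto
      then show ?thesis using neg[OF f] by simp
    qed
  next
    fix f assume "f \<in> V"
    then show "p f \<le> Q f" using order_trans[OF ple shift_le[OF Q f0]] by simp
  next
    have "- p f0 \<le> - Q f0"
      using ple[OF uminus_mem[OF f0]] shift_uminus[OF Q f0] neg[OF f0] by simp
    moreover have "p f0 \<le> Q f0" using ple[OF f0] shift_le[OF Q f0 f0] by simp
    ultimately show "p f0 = Q f0" by simp
  qed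
qed

end

section \<open>Riesz representation on compact Hausdorff spaces\<close>

lemma radon_on_continuous_measurable:
  assumes "radon_on T \<mu>" "continuous_map T euclideanreal f"
  shows "f \<in> borel_measurable \<mu>"
proof (rule borel_measurableI)
  fix S :: "real set" assume "open S"
  then have "openin T {x \<in> topspace T. f x \<in> S}"
    using assms(2) openin_continuous_map_preimage by (metis open_openin)
  moreover have "f -` S \<inter> space \<mu> = {x \<in> topspace T. f x \<in> S}"
    using assms(1) by (auto simp: radon_on_def)
  ultimately show "f -` S \<inter> space \<mu> \<in> sets \<mu>"
    using assms(1) by (auto simp: radon_on_def)
qed

lemma compact_space_continuous_real_bounded:
  assumes "compact_space T" "continuous_map T euclideanreal f"
  obtains B where "B > 0" "\<And>x. x \<in> topspace T \<Longrightarrow> \<bar>f x\<bar> \<le> B"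
proof -
  have "compactin euclideanreal (f ` topspace T)"
    using assms image_compactin compact_space_def by blast
  then have "bounded (f ` topspace T)" by (simp add: compact_imp_bounded)
  then obtain B where "B > 0" "\<forall>y\<in>f ` topspace T. norm y \<le> B" by (auto simp: bounded_pos)
  then show ?thesis using that by auto
qed

lemma radon_on_finite_measure: "radon_on T \<mu> \<Longrightarrow> finite_measure \<mu>"
proof (rule finite_measureI)
  assume "radon_on T \<mu>"
  then have "emeasure \<mu> (space \<mu>) < \<infinity>" unfolding radon_on_def by (elim conjE)
  then show "emeasure \<mu> (space \<mu>) \<noteq> \<infinity>" by (rule less_imp_neq)
qed

lemma radon_on_continuous_integrable:
  assumes "radon_on T \<mu>" "compact_space T" "continuous_map T euclideanreal f"
  shows "integrable \<mu> f"
proof -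
  interpret finite_measure \<mu> using radon_on_finite_measure[OF assms(1)] .
  obtain B where B: "\<And>x. x \<in> topspace T \<Longrightarrow> \<bar>f x\<bar> \<le> B"
    using compact_space_continuous_real_bounded[OF assms(2,3)] by metis
  show ?thesis
    using B assms(1) radon_on_continuous_measurable[OF assms(1,3)]
    by (intro integrable_const_bound[of _ B]) (auto simp: radon_on_def)
qed

text \<open>Cuts a nonnegative number into layers of height 1; \<open>integral_riesz_le_unit\<close>
  slices functions in this way.\<close>

lemma sum_clip:
  fixes t :: real
  assumes "t \<ge> 0"
  shows "(\<Sum>i<n. max 0 (min 1 (t - real i))) = min t (real n)"
  using assms by (induction n) (auto simp: min_def max_def)

text \<open>Monotonicity compares functions on \<open>topspace T\<close> only, so \<open>L\<close>
  cannot depend on values outside the space.\<close>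

locale positive_functional =
  fixes T :: "'b topology" and L :: "('b \<Rightarrow> real) \<Rightarrow> real"
  assumes compact: "compact_space T" and hausdorff: "Hausdorff_space T"
    and add: "continuous_map T euclideanreal f \<Longrightarrow> continuous_map T euclideanreal g \<Longrightarrow>
        L (\<lambda>x. f x + g x) = L f + L g"
    and scale: "continuous_map T euclideanreal f \<Longrightarrow> L (\<lambda>x. c * f x) = c * L f"
    and mono: "continuous_map T euclideanreal f \<Longrightarrow> continuous_map T euclideanreal g \<Longrightarrow>
        (\<And>x. x \<in> topspace T \<Longrightarrow> f x \<le> g x) \<Longrightarrow> L f \<le> L g"
begin

abbreviation "cmap f \<equiv> continuous_map T euclideanreal f"

lemma zero: "L (\<lambda>x. 0) = 0"
  using scale[of "\<lambda>x. 0" 0] by simp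

lemma nonneg: "cmap f \<Longrightarrow> (\<And>x. x \<in> topspace T \<Longrightarrow> 0 \<le> f x) \<Longrightarrow> 0 \<le> L f"
  using mono[of "\<lambda>x. 0" f] zero by simp

lemma sum_functional:
  assumes "\<And>i. i < n \<Longrightarrow> cmap (f i)"
  shows "L (\<lambda>x. \<Sum>i<n. f i x) = (\<Sum>i<(n::nat). L (f i))"
  using assms
proof (induction n)
  case 0
  then show ?case by (simp add: zero)
next
  case (Suc n)
  have "cmap (\<lambda>x. \<Sum>i<n. f i x)" using Suc.prems by (intro continuous_map_sum) auto
  then show ?case using Suc add by simp
qed

section \<open>The content of open sets and its outer measure\<close>

definition below :: "'b set \<Rightarrow> ('b \<Rightarrow> real) set" where
  "below U = {f. cmap f \<and> (\<forall>x\<in>topspace T. 0 \<le> f x \<and> f x \<le> 1) \<and> (\<forall>x\<in>topspace T - U. f x = 0)}"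

definition open_content :: "'b set \<Rightarrow> ennreal" where
  "open_content U = (SUP f\<in>below U. ennreal (L f))"

definition outer :: "'b set \<Rightarrow> ennreal" where
  "outer A = (INF U\<in>{U. openin T U \<and> A \<subseteq> U}. open_content U)"

lemma belowD: assumes "f \<in> below U" shows "cmap f" "\<And>x. x \<in> topspace T \<Longrightarrow> 0 \<le> f x"
    "\<And>x. x \<in> topspace T \<Longrightarrow> f x \<le> 1" "\<And>x. x \<in> topspace T \<Longrightarrow> x \<notin> U \<Longrightarrow> f x = 0"
  using assms by (auto simp: below_def)

lemma below_nonneg: "f \<in> below U \<Longrightarrow> 0 \<le> L f"
  using belowD by (intro nonneg) auto

lemma zero_below: "(\<lambda>x. 0) \<in> below U"
  by (auto simp: below_def)

lemma content_upper: "f \<in> below U \<Longrightarrow> ennreal (L f) \<le> open_content U"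
  unfolding open_content_def by (rule SUP_upper)

lemma content_mono: "U \<subseteq> V \<Longrightarrow> open_content U \<le> open_content V"
  unfolding open_content_def by (rule SUP_subset_mono) (auto simp: below_def)

lemma content_empty: "open_content {} = 0"
proof -
  have "L f = 0" if "f \<in> below {}" for f
    using mono[OF belowD(1)[OF that], of "\<lambda>x. 0"] below_nonneg[OF that] belowD(4)[OF that] zero by simp
  then have "open_content {} \<le> 0" unfolding open_content_def by (intro SUP_least) simp
  then show ?thesis by simp
qed

lemma content_topspace: "open_content (topspace T) = ennreal (L (\<lambda>x. 1))"
proof (rule antisym)
  show "open_content (topspace T) \<le> ennreal (L (\<lambda>x. 1))"
    unfolding open_content_def by (intro SUP_least ennreal_leI mono) (auto simp: below_def)
  show "ennreal (L (\<lambda>x. 1)) \<le> open_content (topspace T)"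
    by (rule content_upper) (auto simp: below_def)
qed

lemma outer_open: "openin T U \<Longrightarrow> outer U = open_content U"
  unfolding outer_def by (intro antisym INF_lower INF_greatest content_mono) auto

lemma outer_le: "openin T U \<Longrightarrow> A \<subseteq> U \<Longrightarrow> outer A \<le> open_content U"
  unfolding outer_def by (intro INF_lower) auto

lemma outer_mono: "A \<subseteq> B \<Longrightarrow> outer A \<le> outer B"
  unfolding outer_def by (rule INF_superset_mono) auto

text \<open>A function in \<open>below U\<close> may be positive right up to the boundary of U.
  Lowering it by e confines its positive part to f > e, and costs at most e * L 1 because f \<le>
  max 0 (f - e) + e.\<close>

lemma trunc_below:
  assumes f: "f \<in> below U" and "0 < e" "e < 1" "\<And>x. x \<in> topspace T \<Longrightarrow> e < f x \<Longrightarrow> x \<in> V"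
  shows "(\<lambda>x. max 0 (f x - e)) \<in> below V" "L f \<le> L (\<lambda>x. max 0 (f x - e)) + e * L (\<lambda>x. 1)"
proof -
  note fD = belowD[OF f]
  have c: "cmap (\<lambda>x. max 0 (f x - e))"
    using fD by (intro continuous_map_real_max continuous_map_diff) auto
  have *: "f x \<le> 1 + e" if "x \<in> topspace T" for x using fD(3)[OF that] assms by simp
  then show "(\<lambda>x. max 0 (f x - e)) \<in> below V"
    using c assms by (fastforce simp: below_def max_def not_less)
  have "L f \<le> L (\<lambda>x. max 0 (f x - e) + e * 1)"
    using fD c by (intro mono continuous_map_add) auto
  also have "\<dots> = L (\<lambda>x. max 0 (f x - e)) + L (\<lambda>x. e * 1)"
    using c by (intro add) auto
  finally show "L f \<le> L (\<lambda>x. max 0 (f x - e)) + e * L (\<lambda>x. 1)"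
    using scale[of "\<lambda>x. 1" e] by simp
qed

text \<open>Truncation is arbitrarily cheap, so truncated functions exhaust the content. The lemmas
  below can therefore work with the set f \<ge> e, which is compact and contained in U.\<close>

lemma content_le_trunc:
  assumes "\<And>e f. 0 < e \<Longrightarrow> e < 1 \<Longrightarrow> f \<in> below U \<Longrightarrow> ennreal (L (\<lambda>x. max 0 (f x - e))) \<le> c"
  shows "open_content U \<le> c"
  unfolding open_content_def
proof (rule SUP_least)
  fix f assume f: "f \<in> below U"
  have L1: "L (\<lambda>x. 1) \<ge> 0" by (intro nonneg) auto
  show "ennreal (L f) \<le> c"
  proof (rule ennreal_le_epsilon)
    fix d :: real assume d: "0 < d"
    \<comment> \<open>The bound 1/2 secures e < 1; adding 1 in the denominator covers the case L 1 =
      0.\<close>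
    define e where "e = min (1/2) (d / (L (\<lambda>x. 1) + 1))"
    have e: "0 < e" "e < 1" using d L1 by (auto simp: e_def)
    have "e * L (\<lambda>x. 1) \<le> d / (L (\<lambda>x. 1) + 1) * L (\<lambda>x. 1)"
      using L1 by (intro mult_right_mono) (auto simp: e_def)
    also have "\<dots> \<le> d" using d L1 by (simp add: field_simps)
    finally have ed: "e * L (\<lambda>x. 1) \<le> d" .
    have mem: "(\<lambda>x. max 0 (f x - e)) \<in> below U"
      using e belowD(4)[OF f] by (intro trunc_below(1)[OF f]) force+
    have "L f \<le> L (\<lambda>x. max 0 (f x - e)) + e * L (\<lambda>x. 1)"
      using e belowD(4)[OF f] by (intro trunc_below(2)[OF f, where V = U]) force+
    also have "\<dots> \<le> L (\<lambda>x. max 0 (f x - e)) + d" using ed by simp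
    finally have "ennreal (L f) \<le> ennreal (L (\<lambda>x. max 0 (f x - e)) + d)" by (rule ennreal_leI)
    also have "\<dots> = ennreal (L (\<lambda>x. max 0 (f x - e))) + ennreal d"
      using d below_nonneg[OF mem] by (intro ennreal_plus) auto
    also have "\<dots> \<le> c + ennreal d" using assms[OF e f] by (rule add_right_mono)
    finally show "ennreal (L f) \<le> c + ennreal d" .
  qed
qed

lemma closedin_ge: "cmap f \<Longrightarrow> closedin T {x \<in> topspace T. a \<le> f x}"
  using closedin_continuous_map_preimage[of T euclideanreal f "{a..}"] by simp

lemma openin_gt: "cmap f \<Longrightarrow> openin T {x \<in> topspace T. a < f x}"
  using openin_continuous_map_preimage[of T euclideanreal f "{a<..}"] by simp

lemma urysohn_below:
  assumes "closedin T C" "openin T W" "C \<subseteq> W"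
  obtains v where "v \<in> below W" "\<And>x. x \<in> C \<Longrightarrow> v x = 1"
proof -
  have n: "normal_space T"
    using compact hausdorff compact_Hausdorff_or_regular_imp_normal_space by blast
  obtain f where f: "continuous_map T (top_of_set {0..1}) f" "f ` (topspace T - W) \<subseteq> {0::real}" "f ` C \<subseteq> {1}"
    by (rule Urysohn_lemma[OF n, of "topspace T - W" C 0 1]) (use assms in \<open>auto simp: disjnt_def\<close>)
  then have "cmap f" "\<And>x. x \<in> topspace T \<Longrightarrow> f x \<in> {0..1}"
    by (auto simp: continuous_map_in_subtopology)
  then show ?thesis using that[of f] f(2,3) by (fastforce simp: below_def)
qed

text \<open>The part C of f \<ge> e outside V is closed and lies in U. A Urysohn function v below U
  with v = 1 on C splits the truncation h into h v, which vanishes off U, and h (1 - v), which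
  vanishes off V.\<close>

lemma content_Un:
  assumes U: "openin T U" and V: "openin T V"
  shows "open_content (U \<union> V) \<le> open_content U + open_content V"
proof (rule content_le_trunc)
  fix e f assume e: "0 < (e::real)" "e < 1" and f: "f \<in> below (U \<union> V)"
  note fD = belowD[OF f]
  let ?C = "{x \<in> topspace T. e \<le> f x} - V"
  let ?h = "\<lambda>x. max 0 (f x - e)"
  have "closedin T ?C" using closedin_ge[OF fD(1)] V by (intro closedin_diff) auto
  moreover have "?C \<subseteq> U" using fD(4) e by force
  ultimately obtain v where v: "v \<in> below U" "\<And>x. x \<in> ?C \<Longrightarrow> v x = 1" using urysohn_below U by metis
  note vD = belowD[OF v(1)]
  have h: "?h \<in> below (U \<union> V)" using e fD(4) by (intro trunc_below(1)[OF f]) force+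
  note hD = belowD[OF h]
  have 1: "(\<lambda>x. ?h x * v x) \<in> below U"
    using hD vD by (auto simp: below_def intro!: continuous_map_real_mult mult_le_one)
  have "?h x * (1 - v x) = 0" if "x \<in> topspace T" "x \<notin> V" for x
    using that v(2)[of x] by (cases "e \<le> f x") auto
  then have 2: "(\<lambda>x. ?h x * (1 - v x)) \<in> below V"
    using hD vD by (auto simp: below_def intro!: continuous_map_real_mult continuous_map_diff mult_le_one)
  have "?h = (\<lambda>x. ?h x * v x + ?h x * (1 - v x))" by (auto simp: algebra_simps)
  then have "L ?h = L (\<lambda>x. ?h x * v x) + L (\<lambda>x. ?h x * (1 - v x))"
    using add[OF belowD(1)[OF 1] belowD(1)[OF 2]] by simp
  then have "ennreal (L ?h) = ennreal (L (\<lambda>x. ?h x * v x)) + ennreal (L (\<lambda>x. ?h x * (1 - v x)))"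
    using below_nonneg[OF 1] below_nonneg[OF 2] by simp
  also have "\<dots> \<le> open_content U + open_content V" using 1 2 by (intro add_mono content_upper)
  finally show "ennreal (L ?h) \<le> open_content U + open_content V" .
qed

lemma content_UN_finite:
  assumes "\<And>i. openin T (U i)"
  shows "open_content (\<Union>i<n. U i) \<le> (\<Sum>i<(n::nat). open_content (U i))"
proof (induction n)
  case 0
  then show ?case by (simp add: content_empty)
next
  case (Suc n)
  have "open_content (\<Union>i<Suc n. U i) \<le> open_content (\<Union>i<n. U i) + open_content (U n)"
    using content_Un[of "\<Union>i<n. U i" "U n"] assms by (simp add: lessThan_Suc Un_commute openin_clauses(3) openin_Union)
  also have "\<dots> \<le> (\<Sum>i<Suc n. open_content (U i))" using Suc by (simp add: add_right_mono)
  finally show ?case .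
qed

text \<open>Compactness of f \<ge> e leaves finitely many of the sets U i to deal with.\<close>

lemma content_UN:
  assumes U: "\<And>i::nat. openin T (U i)"
  shows "open_content (\<Union>i. U i) \<le> (\<Sum>i. open_content (U i))"
proof (rule content_le_trunc)
  fix e f assume e: "0 < (e::real)" "e < 1" and f: "f \<in> below (\<Union>i. U i)"
  note fD = belowD[OF f]
  let ?C = "{x \<in> topspace T. e \<le> f x}"
  have "compactin T ?C" using closedin_ge[OF fD(1)] closedin_compact_space[OF compact] by blast
  moreover have "?C \<subseteq> \<Union>(range U)" using fD(4) e by force
  ultimately obtain F where F: "finite F" "F \<subseteq> range U" "?C \<subseteq> \<Union>F"
    using U unfolding compactin_def by (smt (verit) image_iff)
  then obtain I where I: "finite I" "F = U ` I" by (meson finite_subset_image)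
  then obtain n where n: "I \<subseteq> {..<n}" using finite_nat_iff_bounded by blast
  have "(\<lambda>x. max 0 (f x - e)) \<in> below (\<Union>i<n. U i)"
    using e F I n by (intro trunc_below(1)[OF f]) force+
  then have "ennreal (L (\<lambda>x. max 0 (f x - e))) \<le> open_content (\<Union>i<n. U i)" by (rule content_upper)
  also have "\<dots> \<le> (\<Sum>i<n. open_content (U i))" using U by (rule content_UN_finite)
  also have "\<dots> \<le> (\<Sum>i. open_content (U i))" by (rule sum_le_suminf) auto
  finally show "ennreal (L (\<lambda>x. max 0 (f x - e))) \<le> (\<Sum>i. open_content (U i))" .
qed

lemma outer_approx:
  assumes "A \<subseteq> topspace T" "0 < (e::real)"
  obtains U where "openin T U" "A \<subseteq> U" "open_content U \<le> outer A + ennreal e"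
proof -
  have fin: "outer A \<noteq> \<top>"
    using outer_le[OF openin_topspace assms(1)] content_topspace by (auto simp: top_unique)
  have "outer A < outer A + ennreal e"
    using fin assms(2) by (cases "outer A") (auto simp: ennreal_plus[symmetric] ennreal_less_iff simp del: ennreal_plus)
  then obtain U where "openin T U" "A \<subseteq> U" "open_content U < outer A + ennreal e"
    unfolding outer_def by (auto simp: INF_less_iff)
  then show ?thesis using that by (simp add: less_imp_le)
qed

lemma outer_finite: "A \<subseteq> topspace T \<Longrightarrow> outer A \<noteq> \<top>"
  using outer_le[OF openin_topspace, of A] content_topspace by (auto simp: top_unique)

lemma outer_measure: "outer_measure_space (Pow (topspace T)) outer"
proof -
  have "positive (Pow (topspace T)) outer"
    using outer_open[of "{}"] content_empty by (auto simp: positive_def)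
  moreover have "increasing (Pow (topspace T)) outer"
    by (auto simp: increasing_def intro: outer_mono)
  moreover have "countably_subadditive (Pow (topspace T)) outer"
    unfolding countably_subadditive_def
  proof (intro allI impI)
    fix A :: "nat \<Rightarrow> 'b set" assume A: "range A \<subseteq> Pow (topspace T)"
    show "outer (\<Union>i. A i) \<le> (\<Sum>i. outer (A i))"
    proof (rule ennreal_le_epsilon)
      fix e :: real assume e: "0 < e"
      have "\<exists>U. openin T U \<and> A i \<subseteq> U \<and> open_content U \<le> outer (A i) + ennreal (e * (1/2) ^ Suc i)" for i
      proof -
        have "A i \<subseteq> topspace T" "0 < e * (1/2) ^ Suc i" using A e by auto
        then show ?thesis by (rule outer_approx) blast
      qed
      then obtain U where U: "\<And>i. openin T (U i)" "\<And>i. A i \<subseteq> U i"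
          "\<And>i. open_content (U i) \<le> outer (A i) + ennreal (e * (1/2) ^ Suc i)" by metis
      have "outer (\<Union>i. A i) \<le> open_content (\<Union>i. U i)" using U by (intro outer_le openin_Union) auto
      also have "\<dots> \<le> (\<Sum>i. open_content (U i))" using U(1) by (rule content_UN)
      also have "\<dots> \<le> (\<Sum>i. outer (A i) + ennreal (e * (1/2) ^ Suc i))" using U(3) by (intro suminf_le) auto
      also have "\<dots> = (\<Sum>i. outer (A i)) + (\<Sum>i. ennreal (e * (1/2) ^ Suc i))"
        by (rule suminf_add[symmetric]) auto
      also have "(\<Sum>i. ennreal (e * (1/2) ^ Suc i)) = ennreal e"
        using sums_mult[OF power_half_series, of e] e by (intro suminf_ennreal_eq) auto
      finally show "outer (\<Union>i. A i) \<le> (\<Sum>i. outer (A i)) + ennreal e" .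
    qed
  qed
  ultimately show ?thesis by (simp add: outer_measure_space_def)
qed

text \<open>Let h be the truncation of a function f below V \<inter> U, and let g be below W, the
  part of V where f < e. Then h vanishes where f < e and g where f \<ge> e, so g + h is again below
  V. As W contains V - U, the supremum over g dominates \<open>outer (V - U)\<close>.\<close>

lemma open_caratheodory:
  assumes U: "openin T U" and V: "openin T V"
  shows "open_content (V \<inter> U) + outer (V - U) \<le> open_content V"
proof -
  have fin: "outer (V - U) \<noteq> \<top>" using openin_subset[OF V] by (intro outer_finite) auto
  have "open_content (V \<inter> U) \<le> open_content V - outer (V - U)"
  proof (rule content_le_trunc)
    fix e f assume e: "0 < (e::real)" "e < 1" and f: "f \<in> below (V \<inter> U)"
    note fD = belowD[OF f]
    let ?W = "V - {x \<in> topspace T. e \<le> f x}"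
    let ?h = "\<lambda>x. max 0 (f x - e)"
    have h: "?h \<in> below (V \<inter> U)" using e fD(4) by (intro trunc_below(1)[OF f]) force+
    have W: "openin T ?W" using V closedin_ge[OF fD(1)] by (intro openin_diff) auto
    have sub: "V - U \<subseteq> ?W" using fD(4) e by force
    have "outer (V - U) + ennreal (L ?h) \<le> open_content V"
    proof -
      have "open_content ?W + ennreal (L ?h) \<le> open_content V"
      proof -
        have "ennreal (L g) + ennreal (L ?h) \<le> open_content V" if g: "g \<in> below ?W" for g
        proof -
          have "g x + ?h x \<le> 1" if x: "x \<in> topspace T" for x
            using belowD(3,4)[OF g x] belowD(3)[OF h x] x by (cases "e \<le> f x") simp_all
          then have "(\<lambda>x. g x + ?h x) \<in> below V"
            using belowD[OF g] belowD[OF h] by (auto simp: below_def intro!: continuous_map_add)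
          then have "ennreal (L (\<lambda>x. g x + ?h x)) \<le> open_content V" by (rule content_upper)
          then show ?thesis
            using add[OF belowD(1)[OF g] belowD(1)[OF h]] below_nonneg[OF g] below_nonneg[OF h] by simp
        qed
        moreover have "open_content ?W + ennreal (L ?h) = (SUP g\<in>below ?W. ennreal (L g) + ennreal (L ?h))"
          unfolding open_content_def using zero_below by (subst ennreal_SUP_add_left) auto
        ultimately show ?thesis by (auto intro: SUP_least)
      qed
      then show ?thesis using outer_le[OF W sub] by (meson add_right_mono order_trans)
    qed
    then show "ennreal (L ?h) \<le> open_content V - outer (V - U)"
      by (metis ennreal_minus_mono order_refl ennreal_add_diff_cancel_left fin)
  qed
  moreover have "outer (V - U) \<le> open_content V" using V by (intro outer_le) auto
  moreover have "open_content V \<noteq> \<top>"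
    using content_mono[OF openin_subset[OF V]] content_topspace by (auto simp: top_unique)
  ultimately show ?thesis
    using add_right_mono[of "open_content (V \<inter> U)" "open_content V - outer (V - U)" "outer (V - U)"]
      diff_add_cancel_ennreal by simp
qed

text \<open>For open U the Caratheodory equation is tested on an arbitrary A by enclosing A in an
  open V and applying \<open>open_caratheodory\<close> to V.\<close>

lemma outer_sets: "sigma_sets (topspace T) {U. openin T U} \<subseteq> lambda_system (topspace T) (Pow (topspace T)) outer"
proof -
  interpret P: sigma_algebra "topspace T" "Pow (topspace T)" by (rule sigma_algebra_Pow)
  let ?l = "lambda_system (topspace T) (Pow (topspace T)) outer"
  have "measure_space (topspace T) ?l outer"
    using outer_measure by (rule P.caratheodory_lemma)
  then interpret l: sigma_algebra "topspace T" ?l by (simp add: measure_space_def)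
  have "U \<in> ?l" if U: "openin T U" for U
    unfolding P.lambda_system_eq
  proof (intro CollectI conjI ballI)
    show "U \<in> Pow (topspace T)" using openin_subset[OF U] by simp
    fix A assume A: "A \<in> Pow (topspace T)"
    show "outer (A \<inter> U) + outer (A - U) = outer A"
    proof (rule antisym)
      show "outer (A \<inter> U) + outer (A - U) \<le> outer A"
        unfolding outer_def[of A]
      proof (rule INF_greatest)
        fix V assume V: "V \<in> {U. openin T U \<and> A \<subseteq> U}"
        have "outer (A \<inter> U) + outer (A - U) \<le> open_content (V \<inter> U) + outer (V - U)"
          using V U by (intro add_mono outer_le outer_mono) auto
        also have "\<dots> \<le> open_content V" using V U by (intro open_caratheodory) auto
        finally show "outer (A \<inter> U) + outer (A - U) \<le> open_content V" .
      qed
      have "subadditive (Pow (topspace T)) outer"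
        using outer_measure P.countably_subadditive_subadditive unfolding outer_measure_space_def by blast
      then have "outer ((A \<inter> U) \<union> (A - U)) \<le> outer (A \<inter> U) + outer (A - U)"
        by (rule subadditiveD) (use A in auto)
      then show "outer A \<le> outer (A \<inter> U) + outer (A - U)" by (simp add: Int_Diff_Un)
    qed
  qed
  then show ?thesis by (intro l.sigma_sets_subset) auto
qed

section \<open>The representing measure and its integral\<close>

definition riesz_measure :: "'b measure" where
  "riesz_measure = measure_of (topspace T) {U. openin T U} outer"

lemma space_riesz: "space riesz_measure = topspace T"
  and sets_riesz: "sets riesz_measure = sigma_sets (topspace T) {U. openin T U}"
proof -
  have "{U. openin T U} \<subseteq> Pow (topspace T)" using openin_subset by auto
  then show "space riesz_measure = topspace T"
    "sets riesz_measure = sigma_sets (topspace T) {U. openin T U}"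
    unfolding riesz_measure_def by (simp_all add: space_measure_of sets_measure_of)
qed

lemma emeasure_riesz:
  assumes "A \<in> sets riesz_measure"
  shows "emeasure riesz_measure A = outer A"
proof (rule emeasure_measure_of[OF riesz_measure_def _ _ _ assms])
  show "{U. openin T U} \<subseteq> Pow (topspace T)" using openin_subset by auto
  show "positive (sets riesz_measure) outer"
    using outer_measure by (auto simp: outer_measure_space_def positive_def)
  interpret P: sigma_algebra "topspace T" "Pow (topspace T)" by (rule sigma_algebra_Pow)
  have "measure_space (topspace T) (lambda_system (topspace T) (Pow (topspace T)) outer) outer"
    using outer_measure by (rule P.caratheodory_lemma)
  then show "countably_additive (sets riesz_measure) outer"
    using outer_sets unfolding measure_space_def countably_additive_def sets_riesz by blast
qed

lemma open_riesz: "openin T U \<Longrightarrow> U \<in> sets riesz_measure \<and> emeasure riesz_measure U = open_content U"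
  using emeasure_riesz outer_open sets_riesz by auto

text \<open>Inner regularity is outer regularity of the complement: an open U slightly larger than
  the complement of B has a complement that is compact and contained in B.\<close>

lemma radon_riesz: "radon_on T riesz_measure"
  unfolding radon_on_def
proof (intro conjI ballI space_riesz sets_riesz)
  show "emeasure riesz_measure (space riesz_measure) < \<infinity>"
    using open_riesz[OF openin_topspace] content_topspace space_riesz by simp
  then interpret finite_measure riesz_measure by (intro finite_measureI) auto
  fix B assume B: "B \<in> sets riesz_measure"
  have BT: "B \<subseteq> topspace T" using sets.sets_into_space[OF B] space_riesz by simp
  have Ksets: "K \<in> sets riesz_measure" if "compactin T K" for K
  proof -
    have "openin T (topspace T - K)" using compactin_imp_closedin[OF hausdorff that] by auto
    then have "space riesz_measure - (topspace T - K) \<in> sets riesz_measure"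
      using open_riesz by blast
    moreover have "space riesz_measure - (topspace T - K) = K"
      using compactin_subset_topspace[OF that] space_riesz by auto
    ultimately show ?thesis by simp
  qed
  show "emeasure riesz_measure B = (SUP K\<in>{K. compactin T K \<and> K \<subseteq> B}. emeasure riesz_measure K)"
  proof (rule antisym)
    show "(SUP K\<in>{K. compactin T K \<and> K \<subseteq> B}. emeasure riesz_measure K) \<le> emeasure riesz_measure B"
      using B by (intro SUP_least emeasure_mono) auto
    show "emeasure riesz_measure B \<le> (SUP K\<in>{K. compactin T K \<and> K \<subseteq> B}. emeasure riesz_measure K)"
    proof (rule ennreal_le_epsilon)
      fix e :: real assume e: "0 < e"
      have C: "topspace T - B \<in> sets riesz_measure" using B space_riesz by (metis sets.compl_sets)
      obtain U where U: "openin T U" "topspace T - B \<subseteq> U" "open_content U \<le> outer (topspace T - B) + ennreal e"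
        using outer_approx[of "topspace T - B" e] e by auto
      let ?K = "topspace T - U"
      have K: "compactin T ?K" "?K \<subseteq> B"
        using closedin_compact_space[OF compact] U BT by auto
      have "emeasure riesz_measure B \<le> emeasure riesz_measure (?K \<union> (U - (topspace T - B)))"
        using BT B C Ksets[OF K(1)] open_riesz[OF U(1)] by (intro emeasure_mono) auto
      also have "\<dots> \<le> emeasure riesz_measure ?K + emeasure riesz_measure (U - (topspace T - B))"
        using C Ksets[OF K(1)] open_riesz[OF U(1)] by (intro emeasure_subadditive) auto
      also have "emeasure riesz_measure (U - (topspace T - B)) =
          emeasure riesz_measure U - emeasure riesz_measure (topspace T - B)"
        using C U(2) open_riesz[OF U(1)] by (intro emeasure_Diff) auto
      also have "\<dots> = open_content U - outer (topspace T - B)"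
        using open_riesz[OF U(1)] emeasure_riesz[OF C] by (simp only:)
      also have "\<dots> \<le> ennreal e" using U(3) outer_finite[of "topspace T - B"]
        by (auto simp: ennreal_minus_le_iff)
      finally have "emeasure riesz_measure B \<le> emeasure riesz_measure ?K + ennreal e"
        by (auto intro: add_left_mono)
      also have "\<dots> \<le> (SUP K\<in>{K. compactin T K \<and> K \<subseteq> B}. emeasure riesz_measure K) + ennreal e"
        using K by (intro add_right_mono SUP_upper) auto
      finally show "emeasure riesz_measure B \<le> (SUP K\<in>{K. compactin T K \<and> K \<subseteq> B}. emeasure riesz_measure K) + ennreal e" .
    qed
  qed
qed

lemma measure_space_riesz: "measure riesz_measure (topspace T) = L (\<lambda>x. 1)"
  using open_riesz[OF openin_topspace] content_topspace nonneg[of "\<lambda>x. 1"]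
  by (simp add: measure_def)

text \<open>Let l i be the i-th unit layer of n f, and m i the measure of n f > i. The layer lies
  below the indicator of n f > i and equals 1 on n f > i + 1, so its integral is at most m i, while
  m (i + 1) \<le> L (l i). The two sums over i differ by a shift of the index, hence by at most m 0
  \<le> L 1, and division by n makes this error small.\<close>

lemma integral_riesz_le_unit:
  assumes f: "cmap f" and f01: "\<And>x. x \<in> topspace T \<Longrightarrow> 0 \<le> f x \<and> f x \<le> 1"
  shows "integral\<^sup>L riesz_measure f \<le> L f"
proof (rule field_le_epsilon)
  fix e :: real assume e: "0 < e"
  interpret finite_measure riesz_measure by (rule radon_on_finite_measure[OF radon_riesz])
  note int = radon_on_continuous_integrable[OF radon_riesz compact]
  define c where "c = L (\<lambda>x. 1)"
  have c0: "c \<ge> 0" unfolding c_def by (intro nonneg) auto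
  obtain n :: nat where n: "c / e < real n" using reals_Archimedean2 by blast
  moreover have "0 \<le> c / e" using c0 e by simp
  ultimately have n0: "n > 0" by (metis gr_zeroI not_less of_nat_0)
  define l where "l = (\<lambda>i x. max 0 (min 1 (real n * f x - real i)))"
  define m where "m = (\<lambda>i. measure riesz_measure {x \<in> topspace T. real i < real n * f x})"
  have nf: "cmap (\<lambda>x. real n * f x)" using f by (intro continuous_map_real_mult_left)
  have lc: "cmap (l i)" for i
    unfolding l_def using nf by (intro continuous_map_real_max continuous_map_real_min continuous_map_diff) auto
  have op: "openin T {x \<in> topspace T. real i < real n * f x}" for i :: nat by (rule openin_gt[OF nf])
  have suml: "(\<Sum>i<n. l i x) = real n * f x" if "x \<in> topspace T" for x
    using sum_clip[of "real n * f x" n] f01[OF that] n0 by (simp add: l_def mult_left_le min_def)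
  have int_le: "integral\<^sup>L riesz_measure (l i) \<le> m i" for i
  proof -
    have "integral\<^sup>L riesz_measure (l i) \<le>
        integral\<^sup>L riesz_measure (indicat_real {x \<in> topspace T. real i < real n * f x})"
    proof (intro integral_mono int[OF lc] integrable_real_indicator)
      show "{x \<in> topspace T. real i < real n * f x} \<in> sets riesz_measure"
        using open_riesz[OF op] by blast
      show "emeasure riesz_measure {x \<in> topspace T. real i < real n * f x} < \<infinity>"
        by (simp add: less_top[symmetric])
      show "l i x \<le> indicat_real {x \<in> topspace T. real i < real n * f x} x" if "x \<in> space riesz_measure" for x
        using that space_riesz by (auto simp: l_def indicator_def)
    qed
    also have "\<dots> = m i" using open_riesz[OF op] sets.sets_into_space by (auto simp: m_def Int_absorb2 space_riesz)
    finally show ?thesis .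
  qed
  have L_ge: "m (Suc i) \<le> L (l i)" for i
  proof -
    have "open_content {x \<in> topspace T. real (Suc i) < real n * f x} \<le> ennreal (L (l i))"
      unfolding open_content_def
    proof (intro SUP_least ennreal_leI mono lc)
      fix g x assume g: "g \<in> below {x \<in> topspace T. real (Suc i) < real n * f x}" and x: "x \<in> topspace T"
      show "g x \<le> l i x"
        using belowD(3,4)[OF g x] x by (cases "real (Suc i) < real n * f x") (auto simp: l_def)
    qed (auto simp: below_def)
    moreover have "L (l i) \<ge> 0" by (intro nonneg lc) (auto simp: l_def)
    ultimately show ?thesis
      unfolding m_def using open_riesz[OF op[of "Suc i"]] by (simp add: measure_def enn2real_leI)
  qed
  have m0: "m 0 \<le> c"
    using measure_space_riesz bounded_measure[of "{x \<in> topspace T. real 0 < real n * f x}"] space_riesz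
    by (simp add: m_def c_def)
  have "real n * integral\<^sup>L riesz_measure f = integral\<^sup>L riesz_measure (\<lambda>x. \<Sum>i<n. l i x)"
  proof -
    have "integral\<^sup>L riesz_measure (\<lambda>x. \<Sum>i<n. l i x) = integral\<^sup>L riesz_measure (\<lambda>x. real n * f x)"
      using suml space_riesz by (intro Bochner_Integration.integral_cong) auto
    then show ?thesis by simp
  qed
  also have "\<dots> = (\<Sum>i<n. integral\<^sup>L riesz_measure (l i))"
    using int[OF lc] by (intro Bochner_Integration.integral_sum) auto
  also have "\<dots> \<le> (\<Sum>i<n. m i)" by (intro sum_mono int_le)
  also have "\<dots> \<le> (\<Sum>i<Suc n. m i)" by (simp add: m_def)
  also have "\<dots> = m 0 + (\<Sum>i<n. m (Suc i))" by (rule sum.lessThan_Suc_shift)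
  also have "\<dots> \<le> c + (\<Sum>i<n. L (l i))" using m0 L_ge by (intro add_mono sum_mono) auto
  also have "(\<Sum>i<n. L (l i)) = L (\<lambda>x. \<Sum>i<n. l i x)" using lc by (intro sum_functional[symmetric])
  also have "\<dots> \<le> L (\<lambda>x. real n * f x)"
    using lc nf suml by (intro mono continuous_map_sum) auto
  also have "\<dots> = real n * L f" using f by (rule scale)
  finally have "integral\<^sup>L riesz_measure f \<le> L f + c / real n" using n0 by (simp add: field_simps)
  also have "c / real n \<le> e" using n n0 e by (simp add: field_simps)
  finally show "integral\<^sup>L riesz_measure f \<le> L f + e" by simp
qed

lemma integral_riesz_le:
  assumes f: "cmap f"
  shows "integral\<^sup>L riesz_measure f \<le> L f"
proof -
  interpret finite_measure riesz_measure by (rule radon_on_finite_measure[OF radon_riesz])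
  obtain B where B: "B > 0" "\<And>x. x \<in> topspace T \<Longrightarrow> \<bar>f x\<bar> \<le> B"
    using compact_space_continuous_real_bounded[OF compact f] by metis
  \<comment> \<open>An affine change maps [- B, B] onto [0, 1]; it is harmless because the measure
    has total mass L 1.\<close>
  define g where "g = (\<lambda>x. (1 / (2 * B)) * f x + 1 / 2)"
  have g: "cmap g" unfolding g_def using f by (intro continuous_map_add continuous_map_real_mult_left) auto
  have "0 \<le> g x \<and> g x \<le> 1" if "x \<in> topspace T" for x
    using B(2)[OF that] B(1) by (simp add: g_def abs_le_iff field_simps)
  then have "integral\<^sup>L riesz_measure g \<le> L g" by (intro integral_riesz_le_unit g)
  moreover have "L g = (1 / (2 * B)) * L f + (1/2) * L (\<lambda>x. 1)"
  proof -
    have "L g = L (\<lambda>x. (1 / (2 * B)) * f x) + L (\<lambda>x. (1/2) * 1)"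
      unfolding g_def using continuous_map_real_mult_left[OF f, of "1 / (2 * B)"]
      by (subst add[symmetric]) simp_all
    moreover have "L (\<lambda>x. (1/2) * 1) = (1/2) * L (\<lambda>x. 1)" by (rule scale) simp
    ultimately show ?thesis by (simp only: scale[OF f])
  qed
  moreover have "integral\<^sup>L riesz_measure g = (1 / (2 * B)) * integral\<^sup>L riesz_measure f + (1/2) * L (\<lambda>x. 1)"
    unfolding g_def using radon_on_continuous_integrable[OF radon_riesz compact f] measure_space_riesz space_riesz
    by (subst Bochner_Integration.integral_add) auto
  ultimately show ?thesis using B(1) by (simp add: field_simps)
qed

theorem riesz_representation:
  assumes f: "cmap f"
  shows "integral\<^sup>L riesz_measure f = L f"
proof -
  have "integral\<^sup>L riesz_measure (\<lambda>x. (-1) * f x) \<le> L (\<lambda>x. (-1) * f x)"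
    using f by (intro integral_riesz_le continuous_map_real_mult_left)
  then show ?thesis using integral_riesz_le[OF f] scale[OF f, of "-1"] by simp
qed

end

section \<open>The compactification and the dual form of minimality\<close>

abbreviation bcont :: "(((('a::metric_space \<times> 'a) \<Rightarrow> real) \<Rightarrow> real) \<Rightarrow> real) \<Rightarrow> bool" where
  "bcont \<equiv> continuous_map beta_top euclideanreal"

text \<open>The indices in \<open>Cb_tilde\<close> are normalised to 0 off \<open>Mtilde\<close>, so
  a function has to be cut off before a point of the compactification can be evaluated at it. If
  \<open>tilde u\<close> is such an index, \<open>bext u\<close> is the continuous extension of
  u.\<close>

definition tilde :: "(('a::metric_space \<times> 'a) \<Rightarrow> real) \<Rightarrow> ('a \<times> 'a) \<Rightarrow> real" where
  "tilde u = (\<lambda>q. if q \<in> Mtilde then u q else 0)"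

definition bext :: "(('a::metric_space \<times> 'a) \<Rightarrow> real) \<Rightarrow> ((('a \<times> 'a) \<Rightarrow> real) \<Rightarrow> real) \<Rightarrow> real" where
  "bext u \<zeta> = \<zeta> (tilde u)"

lemma tilde_mem:
  assumes "continuous_on Mtilde u" "\<And>q. q \<in> Mtilde \<Longrightarrow> \<bar>u q\<bar> \<le> B"
  shows "tilde u \<in> Cb_tilde"
proof -
  have "continuous_on Mtilde (tilde u)"
    using assms(1) by (rule continuous_on_cong[THEN iffD1, rotated 2]) (auto simp: tilde_def)
  moreover have "bounded (tilde u ` Mtilde)"
    using assms(2) by (intro boundedI[of _ B]) (auto simp: tilde_def)
  ultimately show ?thesis by (auto simp: Cb_tilde_def tilde_def)
qed

lemma topspace_beta: "topspace beta_top = powertop_real Cb_tilde closure_of (beta_emb ` Mtilde)"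
  unfolding beta_top_def topspace_subtopology by (rule Int_absorb1[OF closure_of_subset_topspace])

lemma beta_emb_topspace: "q \<in> Mtilde \<Longrightarrow> beta_emb q \<in> topspace beta_top"
proof -
  assume q: "q \<in> Mtilde"
  have "beta_emb ` Mtilde \<subseteq> topspace (powertop_real Cb_tilde)"
    by (auto simp: beta_emb_def)
  from closure_of_subset[OF this] q show ?thesis unfolding topspace_beta by blast
qed

lemma bcont_eval: "w \<in> Cb_tilde \<Longrightarrow> bcont (\<lambda>\<zeta>. \<zeta> w)"
  unfolding beta_top_def
  by (intro continuous_map_from_subtopology continuous_map_product_projection)

lemma bcont_bext: "tilde u \<in> Cb_tilde \<Longrightarrow> bcont (bext u)"
  unfolding bext_def by (rule bcont_eval)

lemma bext_emb: "tilde u \<in> Cb_tilde \<Longrightarrow> q \<in> Mtilde \<Longrightarrow> bext u (beta_emb q) = u q"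
  by (simp add: bext_def beta_emb_def tilde_def)

lemma beta_dense:
  assumes "openin beta_top W" "\<zeta> \<in> W"
  obtains q where "q \<in> Mtilde" "beta_emb q \<in> W"
proof -
  obtain V where V: "openin (powertop_real Cb_tilde) V"
      "W = V \<inter> (powertop_real Cb_tilde closure_of (beta_emb ` Mtilde))"
    using assms(1) unfolding beta_top_def openin_subtopology by blast
  then have "\<zeta> \<in> powertop_real Cb_tilde closure_of (beta_emb ` Mtilde)" "\<zeta> \<in> V" using assms(2) by auto
  then obtain q where "q \<in> Mtilde" "beta_emb q \<in> V" using V(1) unfolding in_closure_of by blast
  then show ?thesis using that V(2) beta_emb_topspace topspace_beta by blast
qed

lemma beta_nonneg:
  assumes "openin beta_top W" "bcont f" "\<And>q. q \<in> Mtilde \<Longrightarrow> beta_emb q \<in> W \<Longrightarrow> 0 \<le> f (beta_emb q)"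
    and "\<zeta> \<in> W"
  shows "0 \<le> f \<zeta>"
proof (rule ccontr)
  assume "\<not> 0 \<le> f \<zeta>"
  moreover have "openin beta_top (W \<inter> {\<zeta> \<in> topspace beta_top. f \<zeta> \<in> {..<0}})"
    using assms(1,2) by (intro openin_Int openin_continuous_map_preimage[where Y = euclideanreal]) auto
  moreover have "\<zeta> \<in> topspace beta_top" using assms(1,4) openin_subset by blast
  ultimately obtain q where "q \<in> Mtilde" "beta_emb q \<in> W \<inter> {\<zeta> \<in> topspace beta_top. f \<zeta> \<in> {..<0}}"
    using assms(4) beta_dense[of "W \<inter> {\<zeta> \<in> topspace beta_top. f \<zeta> \<in> {..<0}}" \<zeta> thesis] by auto
  then show False using assms(3)[of q] by auto
qed

lemma Hausdorff_beta: "Hausdorff_space beta_top"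
  unfolding beta_top_def
  by (intro Hausdorff_space_subtopology) (simp add: Hausdorff_space_product_topology)

lemma compact_beta: "compact_space (beta_top :: ((('a::metric_space \<times> 'a) \<Rightarrow> real) \<Rightarrow> real) topology)"
proof -
  have "\<exists>B. \<forall>q\<in>Mtilde. \<bar>g q\<bar> \<le> B" if "g \<in> Cb_tilde" for g :: "'a \<times> 'a \<Rightarrow> real"
    using that by (auto simp: Cb_tilde_def bounded_iff)
  then obtain B where B: "\<And>(g :: 'a \<times> 'a \<Rightarrow> real) q. g \<in> Cb_tilde \<Longrightarrow> q \<in> Mtilde \<Longrightarrow> \<bar>g q\<bar> \<le> B g"
    by metis
  let ?P = "powertop_real (Cb_tilde :: ('a \<times> 'a \<Rightarrow> real) set)"
  let ?S = "PiE (Cb_tilde :: ('a \<times> 'a \<Rightarrow> real) set) (\<lambda>g. {- B g..B g})"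
  have S: "compactin ?P ?S" by (simp add: compactin_PiE)
  have "Hausdorff_space ?P" by (simp add: Hausdorff_space_product_topology)
  then have "closedin ?P ?S" using S compactin_imp_closedin by blast
  moreover have "beta_emb ` Mtilde \<subseteq> ?S"
    using B by (fastforce simp: beta_emb_def abs_le_iff)
  ultimately have "?P closure_of (beta_emb ` Mtilde) \<subseteq> ?S" by (rule closure_of_minimal[rotated])
  then have "compactin ?P (?P closure_of (beta_emb ` Mtilde))"
    by (rule closed_compactin[OF S]) simp
  then show ?thesis unfolding beta_top_def by (rule compact_space_subtopology)
qed

section \<open>The cone G and the dual form of minimality\<close>

lemma G_set_cont: "g \<in> G_set \<Longrightarrow> bcont g"
  by (simp add: G_set_def)

lemma G_set_add: "f \<in> G_set \<Longrightarrow> g \<in> G_set \<Longrightarrow> (\<lambda>\<zeta>. f \<zeta> + g \<zeta>) \<in> G_set"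
  unfolding G_set_def
  by (simp add: continuous_map_add distrib_left) (smt (verit))

lemma G_set_scale: "f \<in> G_set \<Longrightarrow> 0 \<le> c \<Longrightarrow> (\<lambda>\<zeta>. c * f \<zeta>) \<in> G_set"
  unfolding G_set_def
  by (simp add: continuous_map_real_mult_left mult.left_commute[of _ c] distrib_left[symmetric] mult_left_mono)

lemma G_set_const: "0 \<le> c \<Longrightarrow> (\<lambda>\<zeta>. c) \<in> G_set"
  unfolding G_set_def
  by (simp add: distrib_right[symmetric] mult_right_mono dist_triangle)

text \<open>Let Q h be the infimum of the integrals of the k in G above h. A linear L \<le> Q with L
  (- g) = Q (- g) is positive, so it is integration against a Radon measure, and L \<le> Q on G puts
  this measure below \<mu>. Minimality then yields that the \<mu>-integral of g is at most L g = - Q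
  (- g), and k is taken nearly optimal for Q (- g).\<close>

lemma minimal_dual:
  fixes \<mu> :: "((('a::metric_space \<times> 'a) \<Rightarrow> real) \<Rightarrow> real) measure"
  assumes radon: "radon_on beta_top \<mu>" and minimal: "preceq_minimal \<mu>"
    and g: "g \<in> G_set" and \<eta>: "0 < (\<eta>::real)"
  obtains k where "k \<in> G_set" "\<And>\<zeta>. \<zeta> \<in> topspace beta_top \<Longrightarrow> 0 \<le> k \<zeta> + g \<zeta>"
    "integral\<^sup>L \<mu> (\<lambda>\<zeta>. k \<zeta> + g \<zeta>) \<le> \<eta>"
proof -
  note int = radon_on_continuous_integrable[OF radon compact_beta]
  have sp: "space \<mu> = topspace beta_top" using radon by (simp add: radon_on_def)
  have int_mono: "integral\<^sup>L \<mu> f \<le> integral\<^sup>L \<mu> h"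
    if "bcont f" "bcont h" "\<And>\<zeta>. \<zeta> \<in> topspace beta_top \<Longrightarrow> f \<zeta> \<le> h \<zeta>" for f h
    using that sp by (intro integral_mono int) auto
  \<comment> \<open>Every continuous h has a majorant in G, namely a large constant; so Q is an
    infimum over a nonempty set.\<close>
  define Above where "Above = (\<lambda>h :: (('a \<times> 'a \<Rightarrow> real) \<Rightarrow> real) \<Rightarrow> real. {k \<in> G_set. \<forall>\<zeta>\<in>topspace beta_top. h \<zeta> \<le> k \<zeta>})"
  define Q where "Q h = (INF k\<in>Above h. integral\<^sup>L \<mu> k)" for h
  have ne: "Above h \<noteq> {}" if h: "bcont h" for h
  proof -
    obtain B where "B > 0" "\<And>\<zeta>. \<zeta> \<in> topspace beta_top \<Longrightarrow> \<bar>h \<zeta>\<bar> \<le> B"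
      using compact_space_continuous_real_bounded[OF compact_beta h] by metis
    then have "(\<lambda>\<zeta>. B) \<in> Above h" by (force simp: Above_def intro: G_set_const)
    then show ?thesis by auto
  qed
  have bdd: "bdd_below (integral\<^sup>L \<mu> ` Above h)" if h: "bcont h" for h
    using h by (intro bdd_belowI2[of _ "integral\<^sup>L \<mu> h"]) (auto simp: Above_def intro!: int_mono G_set_cont)
  have Q_le: "Q h \<le> integral\<^sup>L \<mu> k" if "bcont h" "k \<in> Above h" for h k
    unfolding Q_def using that by (intro cINF_lower bdd)
  let ?V = "{h. bcont h} :: ((('a \<times> 'a \<Rightarrow> real) \<Rightarrow> real) \<Rightarrow> real) set"
  interpret function_space ?V
    by unfold_locales (auto intro: continuous_map_add continuous_map_real_mult_left)
  have Q: "sublinear_on ?V Q"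
    unfolding sublinear_on_def
  proof (intro conjI ballI allI impI)
    fix f h assume fh: "f \<in> ?V" "h \<in> ?V"
    have *: "Q (\<lambda>x. f x + h x) \<le> integral\<^sup>L \<mu> k + integral\<^sup>L \<mu> l" if kl: "k \<in> Above f" "l \<in> Above h" for k l
    proof -
      have "(\<lambda>x. k x + l x) \<in> Above (\<lambda>x. f x + h x)"
        using kl by (auto simp: Above_def intro: G_set_add add_mono)
      then have "Q (\<lambda>x. f x + h x) \<le> integral\<^sup>L \<mu> (\<lambda>x. k x + l x)"
        using fh by (intro Q_le continuous_map_add) auto
      also have "\<dots> = integral\<^sup>L \<mu> k + integral\<^sup>L \<mu> l"
        using kl by (intro Bochner_Integration.integral_add int G_set_cont) (auto simp: Above_def)
      finally show ?thesis .
    qed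
    have "Q (\<lambda>x. f x + h x) - integral\<^sup>L \<mu> k \<le> Q h" if "k \<in> Above f" for k
      unfolding Q_def[of h] using *[OF that] ne fh by (intro cINF_greatest) (auto simp: algebra_simps)
    then have "Q (\<lambda>x. f x + h x) - Q h \<le> Q f"
      unfolding Q_def[of f] using ne fh by (intro cINF_greatest) (auto simp: algebra_simps)
    then show "Q (\<lambda>x. f x + h x) \<le> Q f + Q h" by simp
  next
    fix f and c :: real assume f: "f \<in> ?V" and c: "0 < c"
    have "Q (\<lambda>x. c * f x) / c \<le> Q f"
      unfolding Q_def[of f]
    proof (rule cINF_greatest)
      fix k assume k: "k \<in> Above f"
      then have "(\<lambda>x. c * k x) \<in> Above (\<lambda>x. c * f x)"
        using c by (auto simp: Above_def intro: G_set_scale)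
      then have "Q (\<lambda>x. c * f x) \<le> integral\<^sup>L \<mu> (\<lambda>x. c * k x)"
        using f by (intro Q_le continuous_map_real_mult_left) auto
      then show "Q (\<lambda>x. c * f x) / c \<le> integral\<^sup>L \<mu> k" using c by (simp add: field_simps)
    qed (use ne f in auto)
    then show "Q (\<lambda>x. c * f x) \<le> c * Q f" using c by (simp add: field_simps)
  next
    have "Q (\<lambda>x. 0) \<le> integral\<^sup>L \<mu> (\<lambda>x. 0)"
      by (intro Q_le) (auto simp: Above_def intro: G_set_const)
    moreover have "0 \<le> Q (\<lambda>x. 0)"
      unfolding Q_def
    proof (rule cINF_greatest)
      fix k assume "k \<in> Above (\<lambda>x. 0)"
      then have "integral\<^sup>L \<mu> (\<lambda>x. 0) \<le> integral\<^sup>L \<mu> k" by (intro int_mono) (auto simp: Above_def G_set_cont)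
      then show "0 \<le> integral\<^sup>L \<mu> k" by simp
    qed (use ne in auto)
    ultimately show "Q (\<lambda>x. 0) = 0" by simp
  qed
  have gc: "bcont g" using g by (rule G_set_cont)
  obtain L where L: "\<And>f h. bcont f \<Longrightarrow> bcont h \<Longrightarrow> L (\<lambda>x. f x + h x) = L f + L h"
      "\<And>f c. bcont f \<Longrightarrow> L (\<lambda>x. c * f x) = c * L f"
      "\<And>f. bcont f \<Longrightarrow> L f \<le> Q f" "L (\<lambda>x. - g x) = Q (\<lambda>x. - g x)"
    using hahn_banach_dominated[OF Q, of "\<lambda>x. - g x"] gc by auto
  interpret L: positive_functional beta_top L
  proof
    fix f h :: "(('a \<times> 'a \<Rightarrow> real) \<Rightarrow> real) \<Rightarrow> real"
    assume fh: "bcont f" "bcont h" "\<And>x. x \<in> topspace beta_top \<Longrightarrow> f x \<le> h x"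
    \<comment> \<open>Positivity: for f \<le> h the zero function lies in G above f - h, so L (f -
      h) \<le> Q (f - h) \<le> 0.\<close>
    have d: "bcont (\<lambda>x. f x + (-1) * h x)" using fh by (intro continuous_map_add continuous_map_real_mult_left)
    have "L (\<lambda>x. f x + (-1) * h x) \<le> Q (\<lambda>x. f x + (-1) * h x)" using d by (rule L(3))
    also have "\<dots> \<le> integral\<^sup>L \<mu> (\<lambda>x. 0)"
      using d fh by (intro Q_le) (auto simp: Above_def intro: G_set_const)
    finally have "L (\<lambda>x. f x + (-1) * h x) \<le> 0" by simp
    moreover have "L (\<lambda>x. f x + (-1) * h x) = L f + (-1) * L h"
      using fh L(1)[of f "\<lambda>x. (-1) * h x"] L(2)[of h "-1"] continuous_map_real_mult_left by metis
    ultimately show "L f \<le> L h" by simp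
  qed (use L compact_beta Hausdorff_beta in auto)
  have "preceq L.riesz_measure \<mu>"
    unfolding preceq_def
  proof
    fix f :: "(('a \<times> 'a \<Rightarrow> real) \<Rightarrow> real) \<Rightarrow> real" assume f: "f \<in> G_set"
    then have "L f \<le> Q f" by (intro L(3) G_set_cont)
    also have "\<dots> \<le> integral\<^sup>L \<mu> f" using f by (intro Q_le G_set_cont) (auto simp: Above_def)
    finally show "integral\<^sup>L L.riesz_measure f \<le> integral\<^sup>L \<mu> f"
      using L.riesz_representation[OF G_set_cont[OF f]] by simp
  qed
  then have "preceq \<mu> L.riesz_measure"
    using minimal L.radon_riesz by (simp add: preceq_minimal_def)
  then have "integral\<^sup>L \<mu> g \<le> L g"
    using g L.riesz_representation[OF gc] by (auto simp: preceq_def)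
  also have "L g = - Q (\<lambda>x. - g x)" using L(2)[OF gc, of "-1"] L(4) by simp
  finally have "Q (\<lambda>x. - g x) < - integral\<^sup>L \<mu> g + \<eta>" using \<eta> by simp
  moreover have "bcont (\<lambda>x. - g x)" using gc by simp
  ultimately obtain k where k: "k \<in> Above (\<lambda>x. - g x)" "integral\<^sup>L \<mu> k < - integral\<^sup>L \<mu> g + \<eta>"
    unfolding Q_def using ne bdd by (metis cINF_less_iff)
  have kc: "bcont k" using k(1) by (auto simp: Above_def intro: G_set_cont)
  show ?thesis
  proof (rule that)
    show "k \<in> G_set" using k by (simp add: Above_def)
    show "0 \<le> k \<zeta> + g \<zeta>" if "\<zeta> \<in> topspace beta_top" for \<zeta>
      using k(1) that by (force simp: Above_def)
    show "integral\<^sup>L \<mu> (\<lambda>\<zeta>. k \<zeta> + g \<zeta>) \<le> \<eta>"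
      using k(2) Bochner_Integration.integral_add[OF int[OF kc] int[OF gc]] by simp
  qed
qed

section \<open>Lipschitz potentials\<close>

text \<open>A x is the infimum over y of K y x + \<phi> y, where K may be asymmetric and take
  negative values. The choice y = x gives A \<le> \<phi>, \<open>lower\<close> gives A \<ge> -
  \<phi>, and \<open>tri\<close> gives A y \<le> A x + K x y. Using the last for both orders of x
  and y together with \<open>upper\<close> bounds the Lipschitz constant.\<close>

lemma hemimetric_potential:
  fixes K :: "'a::metric_space \<Rightarrow> 'a \<Rightarrow> real"
  assumes diag: "\<And>x. K x x = 0" and tri: "\<And>x u y. K x y \<le> K x u + K u y"
    and upper: "\<And>x y. K x y \<le> C * dist x y" and C: "0 \<le> C"
    and lower: "\<And>x y. - (\<phi> x + \<phi> y) \<le> K x y"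
  obtains A where "\<And>x. \<bar>A x\<bar> \<le> \<phi> x" "\<And>x y. - K x y \<le> A x - A y" "C-lipschitz_on UNIV A"
proof -
  define A where "A = (\<lambda>x. INF y. K y x + \<phi> y)"
  have bdd: "bdd_below (range (\<lambda>y. K y x + \<phi> y))" for x
    using lower[of _ x] by (intro bdd_belowI2[of _ "- \<phi> x"]) (smt (verit))
  have up: "A x \<le> K y x + \<phi> y" for x y
    unfolding A_def by (intro cINF_lower bdd) auto
  have low: "- \<phi> x \<le> A x" for x
    unfolding A_def using lower[of _ x] by (intro cINF_greatest) (auto, smt (verit))
  have "A x \<le> \<phi> x" for x using up[of x x] diag by simp
  then have 1: "\<bar>A x\<bar> \<le> \<phi> x" for x using low[of x] by (simp add: abs_le_iff)
  have "A y - K x y \<le> A x" for x y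
    unfolding A_def
  proof (rule cINF_greatest)
    fix w
    show "(INF w. K w y + \<phi> w) - K x y \<le> K w x + \<phi> w"
      using up[of y w] tri[of w y x] unfolding A_def by simp
  qed simp
  then have 2: "- K x y \<le> A x - A y" for x y by (simp add: algebra_simps)
  have "C-lipschitz_on UNIV A"
  proof (rule lipschitz_onI[OF _ C])
    fix x y
    show "dist (A x) (A y) \<le> C * dist x y"
      using 2[of x y] 2[of y x] upper[of x y] upper[of y x] by (auto simp: dist_real_def abs_le_iff dist_commute)
  qed
  with 1 2 show ?thesis using that by blast
qed

section \<open>Clamping with a variable radius\<close>

definition clamp_abs :: "real \<Rightarrow> real \<Rightarrow> real" where
  "clamp_abs p a = max (- p) (min p a)"

lemma clamp_abs_eq: "\<bar>a\<bar> \<le> p \<Longrightarrow> clamp_abs p a = a"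
  by (auto simp: clamp_abs_def)

lemma clamp_abs_diff: "\<bar>clamp_abs p a - clamp_abs q b\<bar> \<le> \<bar>a - b\<bar> + \<bar>p - q\<bar>"
  by (auto simp: clamp_abs_def max_def min_def)

text \<open>Clamping is monotone and 1-Lipschitz in a, and a change of radius costs at most its
  size. Hence a one-sided bound on a - b survives, however large a - b is; this keeps the Lipschitz
  constant of the potential out of the lower estimates.\<close>

lemma clamp_abs_diff_ge:
  "- e \<le> a - b \<Longrightarrow> \<bar>p - q\<bar> \<le> w \<Longrightarrow> 0 \<le> e \<Longrightarrow> - w - e \<le> clamp_abs p a - clamp_abs q b"
  by (auto simp: clamp_abs_def max_def min_def)

text \<open>The hypotheses force a \<ge> f - e and - b \<ge> g - e: both numbers are nearly extreme.
  Clamping each of them loses at most e, whence the factor 2.\<close>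

lemma clamp_abs_diff_ge_min:
  assumes "\<bar>a\<bar> \<le> f" "\<bar>b\<bar> \<le> g" "f + g - e \<le> a - b" "0 \<le> e" "0 \<le> p" "0 \<le> q"
  shows "min f p + min g q - 2 * e \<le> clamp_abs p a - clamp_abs q b"
  using assms by (auto simp: clamp_abs_def max_def min_def)

lemma infdist_lipschitz: "\<bar>infdist x S - infdist y S\<bar> \<le> dist x y"
  using infdist_triangle[of x S y] infdist_triangle[of y S x] by (simp add: abs_le_iff dist_commute)

lemma dist_diff_le: "\<bar>dist x z - dist y z\<bar> \<le> dist x (y :: 'a::metric_space)"
  using dist_triangle[of x z y] dist_triangle[of y z x] by (simp add: abs_le_iff dist_commute)

section \<open>Weights, relative distances and the function g\<close>

locale pointed =
  fixes z :: "'a::metric_space"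
begin

definition wt :: "'a \<Rightarrow> real" where "wt x = 1 + dist x z"

definition relinf :: "'a set \<Rightarrow> 'a \<Rightarrow> real" where "relinf S x = infdist x S / wt x"

text \<open>Up to the factor \<kappa>, this is the clamp radius. It vanishes where the relative
  distance to S is at most \<delta>, in particular on S, and for \<delta> in [0, 1] it is
  2-Lipschitz regardless of S.\<close>

definition margin :: "'a set \<Rightarrow> real \<Rightarrow> 'a \<Rightarrow> real" where
  "margin S \<delta> x = max 0 (infdist x S - \<delta> * wt x)"

text \<open>A bounded substitute for the metric. Its extension is defined on the whole
  compactification, and the zero set of the extension plays the role of the diagonal.\<close>

definition reldist :: "'a \<times> 'a \<Rightarrow> real" where
  "reldist q = dist (fst q) (snd q) / (wt (fst q) + wt (snd q))"

text \<open>The shares add up to 1. If one of them tends to 0, the other coordinate runs off to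
  infinity, see \<open>relinf_infinity\<close>.\<close>

definition share1 :: "'a \<times> 'a \<Rightarrow> real" where "share1 q = wt (fst q) / (wt (fst q) + wt (snd q))"
definition share2 :: "'a \<times> 'a \<Rightarrow> real" where "share2 q = wt (snd q) / (wt (fst q) + wt (snd q))"

text \<open>The function g to which minimality is applied: multiplied by the distance it is a
  truncated metric, see \<open>gap_dist\<close>.\<close>

definition gap :: "real \<Rightarrow> 'a \<times> 'a \<Rightarrow> real" where
  "gap h q = min 1 (h * (wt (fst q) + wt (snd q)) / dist (fst q) (snd q))"

lemma wt_ge1: "1 \<le> wt x" and wt_pos: "0 < wt x" and wt_nz: "wt x \<noteq> 0"
  using zero_le_dist[of x z] unfolding wt_def by linarith+

lemma wt_diff: "\<bar>wt x - wt y\<bar> \<le> dist x y"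
  unfolding wt_def using dist_diff_le[of x z y] by simp

lemma dist_le_wt: "dist x y \<le> wt x + wt y"
  unfolding wt_def using dist_triangle2[of x y z] by simp

lemma cont_wt: "continuous_on S wt"
  unfolding wt_def by (intro continuous_intros)

lemma cont_wt_comp: "continuous_on S f \<Longrightarrow> continuous_on S (\<lambda>x. wt (f x))"
  unfolding wt_def by (intro continuous_intros)

lemma infdist_le_wt: "z \<in> S \<Longrightarrow> infdist x S \<le> wt x"
  using infdist_le[of z S x] by (simp add: wt_def)

lemma relinf_range: "z \<in> S \<Longrightarrow> 0 \<le> relinf S x \<and> relinf S x \<le> 1"
  using infdist_le_wt[of S x] wt_pos[of x] infdist_nonneg[of x S] by (simp add: relinf_def)

lemma relinf_antimono: "S \<noteq> {} \<Longrightarrow> S \<subseteq> S' \<Longrightarrow> relinf S' x \<le> relinf S x"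
  unfolding relinf_def using wt_pos[of x] by (intro divide_right_mono infdist_mono) auto

lemma margin_relinf: "margin S \<delta> x = wt x * max 0 (relinf S x - \<delta>)"
proof -
  have "infdist x S - \<delta> * wt x = wt x * (relinf S x - \<delta>)"
    using wt_nz[of x] by (simp add: relinf_def algebra_simps)
  then show ?thesis using wt_pos[of x] by (simp add: margin_def max_mult_distrib_left)
qed

lemma margin_nonneg: "0 \<le> margin S \<delta> x" by (simp add: margin_def)

lemma margin_mem: "x \<in> S \<Longrightarrow> 0 \<le> \<delta> \<Longrightarrow> margin S \<delta> x = 0"
  using wt_pos[of x] by (simp add: margin_def)

lemma margin_diff:
  assumes "0 \<le> \<delta>" "\<delta> \<le> 1"
  shows "\<bar>margin S \<delta> x - margin S \<delta> y\<bar> \<le> 2 * dist x y"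
proof -
  have "\<bar>\<delta> * wt x - \<delta> * wt y\<bar> = \<delta> * \<bar>wt x - wt y\<bar>"
    using assms by (simp add: right_diff_distrib[symmetric] abs_mult)
  also have "\<dots> \<le> 1 * dist x y" using assms wt_diff[of x y] by (intro mult_mono) auto
  finally show ?thesis using infdist_lipschitz[of x S y] by (auto simp: margin_def)
qed

text \<open>Used to show that both coordinates are equally far from every S where the relative
  distance vanishes. The distance to S and the weight each vary by at most the distance of x and y,
  giving a factor 2; dividing by the larger weight, which is at least half of the sum, gives
  another.\<close>

lemma relinf_diff:
  assumes "z \<in> S"
  shows "\<bar>relinf S x - relinf S y\<bar> \<le> 4 * (dist x y / (wt x + wt y))"
proof -
  have *: "\<bar>relinf S x - relinf S y\<bar> \<le> 2 * dist x y / wt x" for x y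
  proof -
    have "relinf S x - relinf S y = ((infdist x S - infdist y S) + relinf S y * (wt y - wt x)) / wt x"
      using wt_nz[of x] wt_nz[of y] by (simp add: relinf_def field_simps)
    moreover have "\<bar>(infdist x S - infdist y S) + relinf S y * (wt y - wt x)\<bar> \<le> 2 * dist x y"
    proof -
      have "\<bar>relinf S y * (wt y - wt x)\<bar> \<le> 1 * dist x y"
        unfolding abs_mult using relinf_range[OF assms, of y] wt_diff[of y x]
        by (intro mult_mono) (auto simp: dist_commute)
      then show ?thesis using infdist_lipschitz[of x S y] by linarith
    qed
    ultimately show ?thesis using wt_pos[of x] by (simp add: divide_right_mono abs_divide)
  qed
  have h: "2 * dist x y / m \<le> 4 * (dist x y / (wt x + wt y))" if "wt x + wt y \<le> 2 * m" "m > 0" for m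
  proof -
    have "dist x y * (wt x + wt y) \<le> dist x y * (2 * m)" using that by (intro mult_left_mono) auto
    then show ?thesis using that wt_pos[of x] wt_pos[of y] by (simp add: field_simps)
  qed
  show ?thesis
  proof (cases "wt x \<le> wt y")
    case True
    then show ?thesis using *[of y x] h[of "wt y"] wt_pos[of y] by (auto simp: abs_minus_commute dist_commute)
  next
    case False
    then show ?thesis using *[of x y] h[of "wt x"] wt_pos[of x] by auto
  qed
qed

lemma infdist_ge_wt:
  assumes S: "finite S" "z \<in> S"
  obtains m where "m \<ge> 0" "\<And>x. wt x - (1 + m) \<le> infdist x S"
proof -
  define m where "m = Max ((\<lambda>s. dist s z) ` S)"
  have m: "dist s z \<le> m" if "s \<in> S" for s unfolding m_def using that S by (intro Max_ge) auto
  have "wt x - (1 + m) \<le> infdist x S" for x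
  proof -
    have "infdist x S = (INF s\<in>S. dist x s)" using S by (auto simp: infdist_def)
    moreover have "wt x - (1 + m) \<le> (INF s\<in>S. dist x s)"
    proof (rule cINF_greatest)
      fix s assume "s \<in> S"
      then show "wt x - (1 + m) \<le> dist x s"
        using m[of s] dist_triangle[of x z s] by (simp add: wt_def)
    qed (use S in auto)
    ultimately show ?thesis by simp
  qed
  moreover have "m \<ge> 0" using m[OF S(2)] by simp
  ultimately show ?thesis using that by blast
qed

text \<open>Seen from a point far away, a finite set containing z is about as distant as z itself,
  up to the constant 1 + m. As all weights are at least 1, the inverse of one weight is at most
  twice the share of the other, so a small share makes the relative distance nearly 1.\<close>

lemma relinf_infinity:
  assumes S: "finite S" "z \<in> S"
  obtains R where "R > 0" "\<And>q. 1 - R * share1 q \<le> relinf S (snd q)" "\<And>q. 1 - R * share2 q \<le> relinf S (fst q)"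
proof -
  obtain m where m0: "m \<ge> 0" and inf: "\<And>y. wt y - (1 + m) \<le> infdist y S"
    using infdist_ge_wt[OF S] by metis
  have *: "1 - 2 * (1 + m) * (wt x / (wt x + wt y)) \<le> relinf S y" for x y
  proof -
    have "1 - (1 + m) / wt y \<le> relinf S y"
    proof -
      have "1 - (1 + m) / wt y = (wt y - (1 + m)) / wt y" using wt_nz[of y] by (simp add: diff_divide_distrib)
      then show ?thesis unfolding relinf_def using inf[of y] wt_pos[of y] by (simp add: divide_right_mono)
    qed
    moreover have "(1 + m) / wt y \<le> 2 * (1 + m) * (wt x / (wt x + wt y))"
    proof -
      have "wt x \<le> wt x * wt y" "wt y \<le> wt x * wt y"
        using wt_ge1[of x] wt_ge1[of y] by simp_all
      then have "wt x + wt y \<le> 2 * wt x * wt y" by simp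
      then have "(1 + m) * (wt x + wt y) \<le> (1 + m) * (2 * wt x * wt y)" using m0 by (intro mult_left_mono) auto
      then show ?thesis using wt_pos[of x] wt_pos[of y] by (simp add: field_simps)
    qed
    ultimately show ?thesis by simp
  qed
  show ?thesis
  proof (rule that[of "2 * (1 + m)"])
    show "2 * (1 + m) > 0" using m0 by simp
    show "1 - 2 * (1 + m) * share1 q \<le> relinf S (snd q)" for q using *[of "fst q" "snd q"] by (simp add: share1_def)
    show "1 - 2 * (1 + m) * share2 q \<le> relinf S (fst q)" for q
      using *[of "snd q" "fst q"] by (simp add: share2_def add.commute)
  qed
qed

lemma cont_fst_snd: "continuous_on UNIV f \<Longrightarrow> continuous_on S (\<lambda>q :: 'a \<times> 'a. f (fst q))"
  "continuous_on UNIV f \<Longrightarrow> continuous_on S (\<lambda>q :: 'a \<times> 'a. f (snd q))"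
  by (auto intro!: continuous_on_compose2[of UNIV f] continuous_intros)

lemma mem_fst_snd:
  fixes f :: "'a \<Rightarrow> real"
  assumes "continuous_on UNIV f" "\<And>x. \<bar>f x\<bar> \<le> B"
  shows "tilde (\<lambda>q. f (fst q)) \<in> Cb_tilde" "tilde (\<lambda>q. f (snd q)) \<in> Cb_tilde"
  using assms(2) by (auto intro!: tilde_mem[of _ B] cont_fst_snd[OF assms(1)])

lemma cont_relinf: "continuous_on UNIV (relinf S)"
  unfolding relinf_def by (intro continuous_intros cont_wt) (simp add: wt_nz)

lemma mem_relinf:
  assumes "z \<in> S"
  shows "tilde (\<lambda>q. relinf S (fst q)) \<in> Cb_tilde" "tilde (\<lambda>q. relinf S (snd q)) \<in> Cb_tilde"
  using relinf_range[OF assms] by (auto intro!: mem_fst_snd[of _ 1] cont_relinf)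

lemma cont_sumwt: "continuous_on S (\<lambda>q. wt (fst q) + wt (snd q))"
  unfolding wt_def by (intro continuous_intros)

lemma sumwt_nz: "wt x + wt y \<noteq> 0" and sumwt_pos: "0 < wt x + wt y"
  using wt_pos[of x] wt_pos[of y] by auto

lemma mem_reldist: "tilde reldist \<in> Cb_tilde"
proof (rule tilde_mem)
  show "continuous_on Mtilde reldist"
    unfolding reldist_def using sumwt_nz by (intro continuous_intros cont_sumwt) auto
  show "\<bar>reldist q\<bar> \<le> 1" for q
    unfolding reldist_def using dist_le_wt sumwt_pos by (simp add: abs_divide less_imp_le)
qed

lemma mem_share: "tilde share1 \<in> Cb_tilde" "tilde share2 \<in> Cb_tilde"
proof -
  show "tilde share1 \<in> Cb_tilde"
  proof (rule tilde_mem)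
    show "continuous_on Mtilde share1"
      unfolding share1_def using sumwt_nz by (intro continuous_intros cont_sumwt cont_wt_comp) auto
    show "\<bar>share1 q\<bar> \<le> 1" for q
      unfolding share1_def using wt_pos[of "fst q"] wt_pos[of "snd q"] by simp
  qed
  show "tilde share2 \<in> Cb_tilde"
  proof (rule tilde_mem)
    show "continuous_on Mtilde share2"
      unfolding share2_def using sumwt_nz by (intro continuous_intros cont_sumwt cont_wt_comp) auto
    show "\<bar>share2 q\<bar> \<le> 1" for q
      unfolding share2_def using wt_pos[of "fst q"] wt_pos[of "snd q"] by simp
  qed
qed

lemma Mtilde_dist: "q \<in> Mtilde \<Longrightarrow> 0 < dist (fst q) (snd q)"
  by (auto simp: Mtilde_def)

lemma mem_gap:
  assumes "0 \<le> h"
  shows "tilde (gap h) \<in> Cb_tilde"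
proof (rule tilde_mem)
  show "continuous_on Mtilde (gap h)"
    unfolding gap_def using Mtilde_dist by (intro continuous_intros cont_wt_comp) force
  show "\<bar>gap h q\<bar> \<le> 1" for q
    unfolding gap_def using assms wt_pos[of "fst q"] wt_pos[of "snd q"] by (auto simp: abs_le_iff min_def)
qed

lemma gap_dist:
  assumes "x \<noteq> y"
  shows "dist x y * gap h (x, y) = min (dist x y) (h * wt x + h * wt y)"
  using assms by (simp add: gap_def min_mult_distrib_left distrib_left add_divide_distrib)

text \<open>The truncated metric is the length of the shorter route from x to y, either direct or
  through an additional hub at distance h * wt x from x. The triangle inequality holds because h *
  wt is 1-Lipschitz for h \<le> 1.\<close>

lemma gap_G_set:
  assumes "0 \<le> h" "h \<le> 1"
  shows "bext (gap h) \<in> G_set"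
  unfolding G_set_def
proof (intro CollectI conjI allI impI)
  show "bcont (bext (gap h))" using assms by (intro bcont_bext mem_gap)
  fix x u y :: 'a assume ne: "x \<noteq> u \<and> u \<noteq> y \<and> x \<noteq> y"
  have hw: "h * wt a \<le> h * wt b + dist a b" "0 \<le> h * wt a" for a b
  proof -
    have "h * (wt a - wt b) \<le> h * \<bar>wt a - wt b\<bar>" using assms by (intro mult_left_mono) auto
    also have "\<dots> \<le> 1 * dist a b" using assms wt_diff[of a b] by (intro mult_mono) auto
    finally have "h * (wt a - wt b) \<le> dist a b" by simp
    then show "h * wt a \<le> h * wt b + dist a b" by (simp add: algebra_simps)
  qed (use assms wt_pos[of a] in auto)
  have "min (dist x y) (h * wt x + h * wt y) \<le>
      min (dist x u) (h * wt x + h * wt u) + min (dist u y) (h * wt u + h * wt y)"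
    using hw(1)[of x u] hw(1)[of y u] hw(2)[of u] hw(2)[of x] hw(2)[of y] dist_triangle[of x y u]
    by (auto simp: min_def dist_commute)
  then show "dist x y * bext (gap h) (beta_emb (x, y)) \<le>
      dist x u * bext (gap h) (beta_emb (x, u)) + dist u y * bext (gap h) (beta_emb (u, y))"
    using ne assms by (simp add: bext_emb[OF mem_gap] Mtilde_def gap_dist)
qed

end

lemma slope_mem:
  assumes "L-lipschitz_on UNIV f"
  shows "tilde (\<lambda>q. (f (fst q) - f (snd q)) / dist (fst q) (snd q)) \<in> Cb_tilde"
proof (rule tilde_mem)
  have f: "continuous_on UNIV f" using assms by (rule lipschitz_on_continuous_on)
  have "continuous_on Mtilde (\<lambda>q :: 'a \<times> 'a. f (fst q))" "continuous_on Mtilde (\<lambda>q :: 'a \<times> 'a. f (snd q))"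
    by (auto intro!: continuous_on_compose2[OF f] continuous_intros)
  then show "continuous_on Mtilde (\<lambda>q. (f (fst q) - f (snd q)) / dist (fst q) (snd q))"
    by (intro continuous_intros) (auto simp: Mtilde_def)
  fix q :: "'a \<times> 'a" assume "q \<in> Mtilde"
  then have "0 < dist (fst q) (snd q)" by (auto simp: Mtilde_def)
  then show "\<bar>(f (fst q) - f (snd q)) / dist (fst q) (snd q)\<bar> \<le> L"
    using lipschitz_onD[OF assms, of "fst q" "snd q"] by (simp add: abs_divide dist_real_def divide_le_eq)
qed

lemma Phi_hat_bext: "Phi_hat f = bext (\<lambda>q. (f (fst q) - f (snd q)) / dist (fst q) (snd q))"
  by (auto simp: Phi_hat_def ext_beta_def Phi_def bext_def tilde_def fun_eq_iff)

section \<open>Points far from every finite set\<close>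

lemma beta_eq:
  assumes "bcont f" "bcont g" "\<And>q. q \<in> Mtilde \<Longrightarrow> f (beta_emb q) = g (beta_emb q)" "\<zeta> \<in> topspace beta_top"
  shows "f \<zeta> = g \<zeta>"
proof (rule antisym)
  show "f \<zeta> \<le> g \<zeta>"
    using beta_nonneg[OF openin_topspace continuous_map_diff[OF assms(2,1)] _ assms(4)] assms(3) by simp
  show "g \<zeta> \<le> f \<zeta>"
    using beta_nonneg[OF openin_topspace continuous_map_diff[OF assms(1,2)] _ assms(4)] assms(3) by simp
qed

lemma openin_beta_gt: "bcont f \<Longrightarrow> openin beta_top {\<zeta> \<in> topspace beta_top. a < f \<zeta>}"
  using openin_continuous_map_preimage[of beta_top euclideanreal f "{a<..}"] by simp

lemma openin_beta_lt: "bcont f \<Longrightarrow> openin beta_top {\<zeta> \<in> topspace beta_top. f \<zeta> < a}"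
  using openin_continuous_map_preimage[of beta_top euclideanreal f "{..<a}"] by simp

lemma closedin_beta_ge: "bcont f \<Longrightarrow> closedin beta_top {\<zeta> \<in> topspace beta_top. a \<le> f \<zeta>}"
  using closedin_continuous_map_preimage[of beta_top euclideanreal f "{a..}"] by simp

lemma closedin_beta_le: "bcont f \<Longrightarrow> closedin beta_top {\<zeta> \<in> topspace beta_top. f \<zeta> \<le> a}"
  using closedin_continuous_map_preimage[of beta_top euclideanreal f "{..a}"] by simp

lemma radon_open: "radon_on T \<mu> \<Longrightarrow> openin T U \<Longrightarrow> U \<in> sets \<mu>"
  by (auto simp: radon_on_def)

lemma radon_closed: assumes "radon_on T \<mu>" "closedin T C" shows "C \<in> sets \<mu>"
proof -
  have "space \<mu> - (topspace T - C) \<in> sets \<mu>" using assms by (intro sets.compl_sets radon_open[of T]) auto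
  moreover have "space \<mu> - (topspace T - C) = C" using assms closedin_subset by (fastforce simp: radon_on_def)
  ultimately show ?thesis by simp
qed

lemma radon_inner_compact:
  assumes radon: "radon_on T \<mu>" and B: "B \<in> sets \<mu>" and "0 < (\<epsilon>::real)"
  obtains K where "compactin T K" "K \<subseteq> B" "measure \<mu> B < measure \<mu> K + \<epsilon>"
proof -
  interpret finite_measure \<mu> using radon_on_finite_measure[OF radon] .
  show ?thesis
  \<comment> \<open>In the second case \<open>measure \<mu> B - \<epsilon>\<close> is nonnegative,
    so that \<open>ennreal\<close> does not truncate it.\<close>
  proof (cases "measure \<mu> B < \<epsilon>")
    case True
    then show ?thesis using that[of "{}"] by simp
  next
    case False
    have "ennreal (measure \<mu> B - \<epsilon>) < ennreal (measure \<mu> B)"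
      using False assms(3) by (intro ennreal_lessI) auto
    also have "\<dots> = (SUP K\<in>{K. compactin T K \<and> K \<subseteq> B}. emeasure \<mu> K)"
      using radon B by (simp add: radon_on_def emeasure_eq_measure[symmetric])
    finally obtain K where K: "compactin T K" "K \<subseteq> B" "ennreal (measure \<mu> B - \<epsilon>) < emeasure \<mu> K"
      by (auto simp: less_SUP_iff)
    then have "measure \<mu> B - \<epsilon> < measure \<mu> K"
      using False by (simp add: emeasure_eq_measure ennreal_less_iff)
    then show ?thesis using that K by simp
  qed
qed

text \<open>A functional in F(M) is close to a combination of evaluations at a finite set S, and
  functions vanishing on S annihilate the combination. The bound scales with L, so S depends on
  \<epsilon> alone and not on f.\<close>

lemma free_space_bound:
  fixes z :: "'a::metric_space"
  assumes radon: "radon_on beta_top \<mu>" and free: "in_free_space z (Phi_star \<mu>)" and \<epsilon>: "0 < \<epsilon>"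
  obtains S where "finite S" "\<And>L f. 0 < L \<Longrightarrow> L-lipschitz_on UNIV f \<Longrightarrow> (\<And>x. x \<in> insert z S \<Longrightarrow> f x = 0) \<Longrightarrow>
    \<bar>Phi_star \<mu> f\<bar> \<le> L * \<epsilon>"
proof -
  obtain S a where Sa: "finite S \<and> (\<forall>f. f \<in> Lip0 z \<and> lip_const f \<le> 1 \<longrightarrow>
      \<bar>Phi_star \<mu> f - (\<Sum>x\<in>S. a x * delta x f)\<bar> \<le> \<epsilon>)"
    using free[unfolded in_free_space_def, rule_format, OF \<epsilon>] by (elim exE)
  then have S: "finite S" and *: "\<And>f. f \<in> Lip0 z \<Longrightarrow> lip_const f \<le> 1 \<Longrightarrow>
      \<bar>Phi_star \<mu> f - (\<Sum>x\<in>S. a x * delta x f)\<bar> \<le> \<epsilon>" by simp_all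
  show ?thesis
  proof (rule that[OF S])
    fix L :: real and f :: "'a \<Rightarrow> real"
    assume L: "0 < L" and f: "L-lipschitz_on UNIV f" and f0: "\<And>x. x \<in> insert z S \<Longrightarrow> f x = 0"
    define f' where "f' = (\<lambda>x. f x / L)"
    have f': "1-lipschitz_on UNIV f'"
    proof (rule lipschitz_onI)
      fix x y
      have "dist (f' x) (f' y) = dist (f x) (f y) / L"
        using L by (simp add: f'_def dist_real_def diff_divide_distrib[symmetric] abs_divide)
      also have "\<dots> \<le> 1 * dist x y" using lipschitz_onD[OF f, of x y] L by (simp add: divide_le_eq mult.commute)
      finally show "dist (f' x) (f' y) \<le> 1 * dist x y" .
    qed simp
    have "lip_const f' \<le> 1"
      unfolding lip_const_def using f' by (intro cInf_lower bdd_belowI[of _ 0]) (auto dest: lipschitz_on_nonneg)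
    moreover have "f' \<in> Lip0 z" using f' f0 by (auto simp: Lip0_def f'_def)
    moreover have "(\<Sum>x\<in>S. a x * delta x f') = 0"
      using f0 by (intro sum.neutral) (auto simp: delta_def f'_def)
    ultimately have "\<bar>Phi_star \<mu> f'\<bar> \<le> \<epsilon>" using *[of f'] by simp
    moreover have "Phi_star \<mu> f = L * Phi_star \<mu> f'"
    proof -
      note cf = bcont_bext[OF slope_mem[OF f]] and cf' = bcont_bext[OF slope_mem[OF f']]
      have "Phi_hat f \<zeta> = L * Phi_hat f' \<zeta>" if "\<zeta> \<in> topspace beta_top" for \<zeta>
        unfolding Phi_hat_bext
      proof (rule beta_eq[OF cf continuous_map_real_mult_left[OF cf'] _ that])
        fix q :: "'a \<times> 'a" assume q: "q \<in> Mtilde"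
        show "bext (\<lambda>q. (f (fst q) - f (snd q)) / dist (fst q) (snd q)) (beta_emb q) =
          L * bext (\<lambda>q. (f' (fst q) - f' (snd q)) / dist (fst q) (snd q)) (beta_emb q)"
          unfolding bext_emb[OF slope_mem[OF f] q] bext_emb[OF slope_mem[OF f'] q]
          using L by (simp add: f'_def diff_divide_distrib[symmetric])
      qed
      then have "Phi_star \<mu> f = integral\<^sup>L \<mu> (\<lambda>\<zeta>. L * Phi_hat f' \<zeta>)"
        unfolding Phi_star_def using radon by (intro Bochner_Integration.integral_cong) (auto simp: radon_on_def)
      then show ?thesis by (simp add: Phi_star_def)
    qed
    ultimately show "\<bar>Phi_star \<mu> f\<bar> \<le> L * \<epsilon>" using L by (simp add: abs_mult)
  qed
qed

context pointed
begin

text \<open>Distances to finite sets are measured relative to \<open>1 + d(x,0)\<close>, so that points at infinite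
  distance from \<open>0\<close> are far from every finite set, too.  For complete \<open>M\<close>, the complement of \<open>bad\<close>
  is contained in \<open>p\<^sup>-\<^sup>1(M \<times> M)\<close>.\<close>

definition far1 :: "real \<Rightarrow> ((('a \<times> 'a) \<Rightarrow> real) \<Rightarrow> real) set" where
  "far1 \<sigma> = {\<zeta> \<in> topspace beta_top. \<forall>S. finite S \<and> z \<in> S \<longrightarrow> \<sigma> \<le> bext (\<lambda>q. relinf S (fst q)) \<zeta>}"

definition far2 :: "real \<Rightarrow> ((('a \<times> 'a) \<Rightarrow> real) \<Rightarrow> real) set" where
  "far2 \<sigma> = {\<zeta> \<in> topspace beta_top. \<forall>S. finite S \<and> z \<in> S \<longrightarrow> \<sigma> \<le> bext (\<lambda>q. relinf S (snd q)) \<zeta>}"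

definition bad :: "((('a \<times> 'a) \<Rightarrow> real) \<Rightarrow> real) set" where
  "bad = (\<Union>n. far1 (1 / real (Suc n)) \<union> far2 (1 / real (Suc n)))"

lemma far_antimono: "\<sigma> \<le> \<tau> \<Longrightarrow> far1 \<tau> \<subseteq> far1 \<sigma>" "\<sigma> \<le> \<tau> \<Longrightarrow> far2 \<tau> \<subseteq> far2 \<sigma>"
  unfolding far1_def far2_def by (auto intro: order_trans)

lemma closed_far: "closedin beta_top (far1 \<sigma>)" "closedin beta_top (far2 \<sigma>)"
proof -
  have *: "closedin beta_top {\<zeta> \<in> topspace beta_top. \<forall>S. finite S \<and> z \<in> S \<longrightarrow> \<sigma> \<le> bext (f S) \<zeta>}"
    if "\<And>S. z \<in> S \<Longrightarrow> tilde (f S) \<in> Cb_tilde" for f :: "'a set \<Rightarrow> 'a \<times> 'a \<Rightarrow> real"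
  proof -
    have "closedin beta_top (\<Inter>S\<in>{S. finite S \<and> z \<in> S}. {\<zeta> \<in> topspace beta_top. \<sigma> \<le> bext (f S) \<zeta>})"
      using that by (intro closedin_INT closedin_beta_ge bcont_bext) auto
    moreover have "{\<zeta> \<in> topspace beta_top. \<forall>S. finite S \<and> z \<in> S \<longrightarrow> \<sigma> \<le> bext (f S) \<zeta>} =
        (\<Inter>S\<in>{S. finite S \<and> z \<in> S}. {\<zeta> \<in> topspace beta_top. \<sigma> \<le> bext (f S) \<zeta>})"
      by (auto intro: exI[of _ "{z}"])
    ultimately show ?thesis by simp
  qed
  show "closedin beta_top (far1 \<sigma>)" "closedin beta_top (far2 \<sigma>)"
    unfolding far1_def far2_def by (intro * mem_relinf; simp)+
qed

lemma bad_topspace: "bad \<subseteq> topspace beta_top"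
  by (auto simp: bad_def far1_def far2_def)

lemma far_sets: "radon_on beta_top \<mu> \<Longrightarrow> far1 \<sigma> \<in> sets \<mu>" "radon_on beta_top \<mu> \<Longrightarrow> far2 \<sigma> \<in> sets \<mu>"
  "radon_on beta_top \<mu> \<Longrightarrow> bad \<in> sets \<mu>"
  using closed_far radon_closed unfolding bad_def by (blast intro!: sets.countable_UN)+

lemma far_bad: assumes "0 < \<sigma>" shows "far1 \<sigma> \<subseteq> bad" "far2 \<sigma> \<subseteq> bad"
proof -
  obtain n where n: "1 / real (Suc n) < \<sigma>" using assms nat_approx_posE by metis
  show "far1 \<sigma> \<subseteq> bad" "far2 \<sigma> \<subseteq> bad"
    using far_antimono[of "1 / real (Suc n)" \<sigma>] n unfolding bad_def by auto
qed

lemma relinf_beta_antimono: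
  assumes "z \<in> S" "S \<subseteq> S'" "\<zeta> \<in> topspace beta_top"
  shows "bext (\<lambda>q. relinf S' (fst q)) \<zeta> \<le> bext (\<lambda>q. relinf S (fst q)) \<zeta>"
    "bext (\<lambda>q. relinf S' (snd q)) \<zeta> \<le> bext (\<lambda>q. relinf S (snd q)) \<zeta>"
proof -
  have z': "z \<in> S'" using assms by auto
  have le: "relinf S' x \<le> relinf S x" for x using assms by (intro relinf_antimono) auto
  have c: "bcont (bext (\<lambda>q. relinf S (fst q)))" "bcont (bext (\<lambda>q. relinf S' (fst q)))"
    "bcont (bext (\<lambda>q. relinf S (snd q)))" "bcont (bext (\<lambda>q. relinf S' (snd q)))"
    using assms(1) z' by (intro bcont_bext mem_relinf; simp)+
  show "bext (\<lambda>q. relinf S' (fst q)) \<zeta> \<le> bext (\<lambda>q. relinf S (fst q)) \<zeta>"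
    using beta_nonneg[OF openin_topspace continuous_map_diff[OF c(1,2)] _ assms(3)] le
    by (simp add: bext_emb mem_relinf assms(1) z')
  show "bext (\<lambda>q. relinf S' (snd q)) \<zeta> \<le> bext (\<lambda>q. relinf S (snd q)) \<zeta>"
    using beta_nonneg[OF openin_topspace continuous_map_diff[OF c(3,4)] _ assms(3)] le
    by (simp add: bext_emb mem_relinf assms(1) z')
qed

lemma good_near:
  assumes "\<zeta> \<in> topspace beta_top" "\<zeta> \<notin> bad" "0 < \<delta>"
  obtains S where "finite S" "z \<in> S" "bext (\<lambda>q. relinf S (fst q)) \<zeta> < \<delta>" "bext (\<lambda>q. relinf S (snd q)) \<zeta> < \<delta>"
proof -
  have "\<zeta> \<notin> far1 \<delta>" "\<zeta> \<notin> far2 \<delta>" using far_bad[OF assms(3)] assms(2) by auto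
  then obtain S1 S2 where S: "finite S1" "z \<in> S1" "bext (\<lambda>q. relinf S1 (fst q)) \<zeta> < \<delta>"
      "finite S2" "z \<in> S2" "bext (\<lambda>q. relinf S2 (snd q)) \<zeta> < \<delta>"
    using assms(1) unfolding far1_def far2_def by (auto simp: not_le)
  then show ?thesis
    using that[of "S1 \<union> S2"] relinf_beta_antimono(1)[of S1 "S1 \<union> S2" \<zeta>] relinf_beta_antimono(2)[of S2 "S1 \<union> S2" \<zeta>] assms(1)
    by auto
qed

text \<open>Each good point is near some finite set, an open condition that persists when the set
  grows. A finite subcover of K therefore yields one finite set for all of K.\<close>

lemma good_compact_near:
  assumes K: "compactin beta_top K" "K \<inter> bad = {}" and \<delta>: "0 < \<delta>"
  obtains S where "finite S" "z \<in> S"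
    "\<And>\<zeta>. \<zeta> \<in> K \<Longrightarrow> bext (\<lambda>q. relinf S (fst q)) \<zeta> < \<delta> \<and> bext (\<lambda>q. relinf S (snd q)) \<zeta> < \<delta>"
proof -
  have KT: "K \<subseteq> topspace beta_top" using K(1) compactin_subset_topspace by blast
  define W where "W = (\<lambda>S. {\<zeta> \<in> topspace beta_top. bext (\<lambda>q. relinf S (fst q)) \<zeta> < \<delta>} \<inter>
      {\<zeta> \<in> topspace beta_top. bext (\<lambda>q. relinf S (snd q)) \<zeta> < \<delta>})"
  let ?F = "{S. finite S \<and> z \<in> S}"
  have "\<forall>U\<in>W ` ?F. openin beta_top U"
    unfolding W_def by (auto intro!: openin_Int openin_beta_lt bcont_bext mem_relinf)
  moreover have "K \<subseteq> \<Union>(W ` ?F)"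
  proof
    fix \<zeta> assume \<zeta>: "\<zeta> \<in> K"
    then have "\<zeta> \<in> topspace beta_top" "\<zeta> \<notin> bad" using K KT by auto
    then obtain S where "finite S" "z \<in> S" "bext (\<lambda>q. relinf S (fst q)) \<zeta> < \<delta>" "bext (\<lambda>q. relinf S (snd q)) \<zeta> < \<delta>"
      using good_near[OF _ _ \<delta>] by metis
    then show "\<zeta> \<in> \<Union>(W ` ?F)" using KT \<zeta> unfolding W_def by blast
  qed
  ultimately have "\<exists>\<V>. finite \<V> \<and> \<V> \<subseteq> W ` ?F \<and> K \<subseteq> \<Union>\<V>"
    using K(1) unfolding compactin_def by meson
  then obtain \<V> where V: "finite \<V>" "\<V> \<subseteq> W ` ?F" "K \<subseteq> \<Union>\<V>" by blast
  obtain \<S> where \<S>: "finite \<S>" "\<S> \<subseteq> ?F" "\<V> = W ` \<S>" using finite_subset_image[OF V(1,2)] by blast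
  show ?thesis
  proof (rule that[of "insert z (\<Union>\<S>)"])
    show "finite (insert z (\<Union>\<S>))" using \<S> by auto
    fix \<zeta> assume \<zeta>: "\<zeta> \<in> K"
    then obtain S where S: "S \<in> \<S>" "\<zeta> \<in> W S" using V(3) \<S>(3) by blast
    have "z \<in> S" "S \<subseteq> insert z (\<Union>\<S>)" using S \<S> by auto
    then show "bext (\<lambda>q. relinf (insert z (\<Union>\<S>)) (fst q)) \<zeta> < \<delta> \<and> bext (\<lambda>q. relinf (insert z (\<Union>\<S>)) (snd q)) \<zeta> < \<delta>"
      using relinf_beta_antimono[of S "insert z (\<Union>\<S>)" \<zeta>] S(2) KT \<zeta> unfolding W_def by force
  qed simp
qed

lemma hemimetric_of_G_set:
  fixes k :: "((('a \<times> 'a) \<Rightarrow> real) \<Rightarrow> real) \<Rightarrow> real"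
  assumes three: "\<exists>a b c :: 'a. a \<noteq> b \<and> b \<noteq> c \<and> a \<noteq> c" and k: "k \<in> G_set"
  defines "K \<equiv> \<lambda>x y. dist x y * k (beta_emb (x, y))"
  shows "K x y \<le> K x u + K u y"
proof -
  have tri: "K x y \<le> K x u + K u y" if "x \<noteq> u" "u \<noteq> y" "x \<noteq> y" for x u y
    using k that unfolding G_set_def K_def by blast
  \<comment> \<open>\<open>G_set\<close> only constrains triples of distinct points; a third point \<open>w\<close> gives the case \<open>x = y\<close>.\<close>
  have "0 \<le> K x u + K u x" if "x \<noteq> u" for x u
  proof -
    obtain w where "w \<noteq> x" "w \<noteq> u" using three by metis
    then show ?thesis using tri[of x u w] tri[of u x w] that by auto
  qed
  then show ?thesis using tri[of x u y] by (cases "x = u \<or> u = y"; cases "x = y") (auto simp: K_def)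
qed

end

section \<open>Test functions detecting far points\<close>

context pointed
begin

text \<open>\<open>hemimetric_potential\<close> is applied to K x y = d(x, y) k(x, y), with C a
  bound of k on the compact space and the lower bound coming from k + gap \<ge> 0. The defect k +
  gap stays in the conclusion because only its integral is small, not its values.\<close>

lemma gap_potential:
  fixes k :: "((('a \<times> 'a) \<Rightarrow> real) \<Rightarrow> real) \<Rightarrow> real"
  assumes three: "\<exists>a b c :: 'a. a \<noteq> b \<and> b \<noteq> c \<and> a \<noteq> c" and k: "k \<in> G_set"
    and h: "0 \<le> h"
    and nonneg: "\<And>\<zeta>. \<zeta> \<in> topspace beta_top \<Longrightarrow> 0 \<le> k \<zeta> + bext (gap h) \<zeta>"
  obtains A C where "0 < C" "C-lipschitz_on UNIV A" "\<And>x. \<bar>A x\<bar> \<le> h * wt x"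
    "\<And>x y. x \<noteq> y \<Longrightarrow> min (dist x y) (h * wt x + h * wt y)
        - dist x y * (k (beta_emb (x, y)) + bext (gap h) (beta_emb (x, y))) \<le> A x - A y"
proof -
  obtain C where C: "C > 0" "\<And>\<zeta>. \<zeta> \<in> topspace beta_top \<Longrightarrow> \<bar>k \<zeta>\<bar> \<le> C"
    using compact_space_continuous_real_bounded[OF compact_beta G_set_cont[OF k]] by metis
  define K where "K = (\<lambda>x y. dist x y * k (beta_emb (x, y)))"
  have top: "beta_emb (x, y) \<in> topspace beta_top" if "x \<noteq> y" for x y :: 'a
    using that by (intro beta_emb_topspace) (simp add: Mtilde_def)
  have K: "- K x y = min (dist x y) (h * wt x + h * wt y)
      - dist x y * (k (beta_emb (x, y)) + bext (gap h) (beta_emb (x, y)))" if "x \<noteq> y" for x y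
    unfolding gap_dist[OF that, of h, symmetric] K_def
    using that by (simp add: bext_emb[OF mem_gap[OF h]] Mtilde_def algebra_simps)
  have "K x y \<le> C * dist x y" for x y
  proof (cases "x = y")
    case False
    then have "dist x y * k (beta_emb (x, y)) \<le> dist x y * C"
      using C(2)[OF top] by (intro mult_left_mono) (auto simp: abs_le_iff)
    then show ?thesis by (simp add: K_def mult.commute)
  qed (simp add: K_def)
  moreover have "- (h * wt x + h * wt y) \<le> K x y" for x y
  proof (cases "x = y")
    case True
    then show ?thesis using h wt_pos[of y] by (simp add: K_def)
  next
    case False
    have "0 \<le> dist x y * (k (beta_emb (x, y)) + bext (gap h) (beta_emb (x, y)))"
      using nonneg[OF top[OF False]] by simp
    then show ?thesis using K[OF False] by linarith
  qed
  moreover have "K x y \<le> K x u + K u y" for x u y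
    unfolding K_def by (rule hemimetric_of_G_set[OF three k])
  moreover have "K x x = 0" for x by (simp add: K_def)
  ultimately obtain A where A: "\<And>x. \<bar>A x\<bar> \<le> h * wt x" "\<And>x y. - K x y \<le> A x - A y" "C-lipschitz_on UNIV A"
    using hemimetric_potential[of K C "\<lambda>x. h * wt x"] C(1) by (metis less_imp_le)
  show ?thesis using that[OF C(1) A(3,1)] A(2) K by metis
qed

text \<open>Collects what the mass estimates use. The slope of the clamp radius is at most 2 *
  \<kappa>, the height of the truncated metric is \<open>\<kappa> * H\<close>, and \<sigma> is the
  level of farness. The crude bound \<open>- 2 * \<kappa>\<close> is left for points close to the
  diagonal but not on it; the other two bounds make \<Psi> nonnegative or large, so a small integral
  leaves little room for far points.\<close>

definition detects_far :: "((('a \<times> 'a) \<Rightarrow> real) \<Rightarrow> real) measure \<Rightarrow> real \<Rightarrow> real \<Rightarrow> real \<Rightarrow> real \<Rightarrow>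
    (((('a \<times> 'a) \<Rightarrow> real) \<Rightarrow> real) \<Rightarrow> real) \<Rightarrow> bool" where
  "detects_far \<mu> \<kappa> H \<sigma> \<epsilon> \<Psi> \<longleftrightarrow> bcont \<Psi> \<and> (\<forall>\<zeta>\<in>topspace beta_top. - 2 * \<kappa> \<le> \<Psi> \<zeta>) \<and>
    (\<forall>\<zeta>\<in>topspace beta_top. \<kappa> * H < bext reldist \<zeta> \<longrightarrow>
        \<kappa> * H * (indicat_real (far1 \<sigma>) \<zeta> * bext share1 \<zeta> + indicat_real (far2 \<sigma>) \<zeta> * bext share2 \<zeta>) \<le> \<Psi> \<zeta>) \<and>
    (\<forall>\<zeta>\<in>far1 \<sigma>. \<zeta> \<in> far2 \<sigma> \<longrightarrow> bext reldist \<zeta> = 0 \<longrightarrow> 1 \<le> \<Psi> \<zeta>) \<and>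
    integral\<^sup>L \<mu> (\<lambda>\<zeta>. indicat_real bad \<zeta> * \<Psi> \<zeta>) \<le> \<epsilon>"

lemma detects_farD:
  assumes "detects_far \<mu> \<kappa> H \<sigma> \<epsilon> \<Psi>"
  shows "bcont \<Psi>" "\<zeta> \<in> topspace beta_top \<Longrightarrow> - 2 * \<kappa> \<le> \<Psi> \<zeta>"
    "\<zeta> \<in> topspace beta_top \<Longrightarrow> \<kappa> * H < bext reldist \<zeta> \<Longrightarrow>
        \<kappa> * H * (indicat_real (far1 \<sigma>) \<zeta> * bext share1 \<zeta> + indicat_real (far2 \<sigma>) \<zeta> * bext share2 \<zeta>) \<le> \<Psi> \<zeta>"
    "\<zeta> \<in> far1 \<sigma> \<Longrightarrow> \<zeta> \<in> far2 \<sigma> \<Longrightarrow> bext reldist \<zeta> = 0 \<Longrightarrow> 1 \<le> \<Psi> \<zeta>"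
    "integral\<^sup>L \<mu> (\<lambda>\<zeta>. indicat_real bad \<zeta> * \<Psi> \<zeta>) \<le> \<epsilon>"
  using assms by (simp_all add: detects_far_def)

text \<open>The choices are made in the order k, A and C, S, B. The witness is the slope of the
  clamped potential B plus twice the defect e, the amount lost in
  \<open>clamp_abs_diff_ge_min\<close>.\<close>

lemma ex_detects_far:
  fixes \<mu> :: "((('a \<times> 'a) \<Rightarrow> real) \<Rightarrow> real) measure"
  assumes three: "\<exists>a b c :: 'a. a \<noteq> b \<and> b \<noteq> c \<and> a \<noteq> c"
    and radon: "radon_on beta_top \<mu>" and minimal: "preceq_minimal \<mu>"
    and free: "in_free_space z (Phi_star \<mu>)"
    and \<kappa>: "0 < \<kappa>" "\<kappa> \<le> 1" and H: "0 < H" "2 * H \<le> \<sigma>" and \<sigma>: "\<sigma> \<le> 1" and \<epsilon>: "0 < \<epsilon>"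
  shows "\<exists>\<Psi>. detects_far \<mu> \<kappa> H \<sigma> \<epsilon> \<Psi>"
proof -
  interpret finite_measure \<mu> using radon_on_finite_measure[OF radon] .
  have sp: "space \<mu> = topspace beta_top" using radon by (simp add: radon_on_def)
  note int = radon_on_continuous_integrable[OF radon compact_beta]
  \<comment> \<open>If the relative distance of x to S exceeds 3/4 \<sigma>, then with \<delta> =
    \<sigma> / 4 the margin at x is at least (\<sigma> / 2) * wt x \<ge> H * wt x. Hence the clamp
    radius is at least h * wt x there, and A is left unchanged.\<close>
  define h where "h = \<kappa> * H"
  define \<delta> where "\<delta> = \<sigma> / 4"
  have h: "0 < h" "h \<le> 1"
    unfolding h_def using \<kappa> H \<sigma> by (auto intro: mult_le_one)
  have \<delta>: "0 < \<delta>" "\<delta> \<le> 1" using H \<sigma> by (auto simp: \<delta>_def)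
  define g where "g = bext (gap h)"
  have g: "g \<in> G_set" unfolding g_def using h by (intro gap_G_set) auto
  obtain k where k: "k \<in> G_set" "\<And>\<zeta>. \<zeta> \<in> topspace beta_top \<Longrightarrow> 0 \<le> k \<zeta> + g \<zeta>"
      "integral\<^sup>L \<mu> (\<lambda>\<zeta>. k \<zeta> + g \<zeta>) \<le> \<epsilon> / 16"
    using minimal_dual[OF radon minimal g, of "\<epsilon> / 16"] \<epsilon> by auto
  define e where "e = (\<lambda>\<zeta>. k \<zeta> + g \<zeta>)"
  have e0: "\<And>\<zeta>. \<zeta> \<in> topspace beta_top \<Longrightarrow> 0 \<le> e \<zeta>" and e_int: "integral\<^sup>L \<mu> e \<le> \<epsilon> / 16"
    using k by (simp_all add: e_def)
  have ec: "bcont e" unfolding e_def using g k(1) by (intro continuous_map_add G_set_cont)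
  obtain A C where C: "0 < C" "C-lipschitz_on UNIV A" and A: "\<And>x. \<bar>A x\<bar> \<le> h * wt x"
      and Adiff: "\<And>x y. x \<noteq> y \<Longrightarrow> min (dist x y) (h * wt x + h * wt y) - dist x y * e (beta_emb (x, y)) \<le> A x - A y"
    using gap_potential[OF three k(1) less_imp_le[OF h(1)] k(2)[unfolded g_def]]
    unfolding e_def g_def by metis
  \<comment> \<open>A Lipschitz constant of the function B below: C from the potential, and 2 \<ge>
    2 * \<kappa> from the clamp radius. It is known before S is chosen.\<close>
  define L where "L = C + 2"
  have L: "0 < L" using C by (simp add: L_def)
  obtain S0 where S0: "finite S0" "\<And>f. L-lipschitz_on UNIV f \<Longrightarrow> (\<And>x. x \<in> insert z S0 \<Longrightarrow> f x = 0) \<Longrightarrow>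
      \<bar>Phi_star \<mu> f\<bar> \<le> L * (\<epsilon> / (4 * L))"
    using free_space_bound[OF radon free, of "\<epsilon> / (4 * L)"] L \<epsilon> by (metis divide_pos_pos mult_pos_pos zero_less_numeral)
  define good where "good = space \<mu> - bad"
  have bad_sets: "bad \<in> sets \<mu>" using far_sets(3)[OF radon] .
  have good_sets: "good \<in> sets \<mu>" unfolding good_def using bad_sets by auto
  obtain Kc where Kc: "compactin beta_top Kc" "Kc \<subseteq> good" "measure \<mu> good < measure \<mu> Kc + \<epsilon> / 16"
    using radon_inner_compact[OF radon good_sets, of "\<epsilon> / 16"] \<epsilon> by auto
  have Kc_sets: "Kc \<in> sets \<mu>" using radon_closed[OF radon compactin_imp_closedin[OF Hausdorff_beta Kc(1)]] .
  have "Kc \<inter> bad = {}" using Kc(2) by (auto simp: good_def)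
  then obtain S1 where S1: "finite S1" "z \<in> S1" "\<And>\<zeta>. \<zeta> \<in> Kc \<Longrightarrow>
      bext (\<lambda>q. relinf S1 (fst q)) \<zeta> < \<delta> \<and> bext (\<lambda>q. relinf S1 (snd q)) \<zeta> < \<delta>"
    using good_compact_near[OF Kc(1) _ \<delta>(1)] by metis
  define S where "S = S0 \<union> S1"
  have S: "finite S" "z \<in> S" using S0 S1 by (auto simp: S_def)
  \<comment> \<open>S0 makes the functional small on B, which vanishes on S; S1 makes the slope of B
    vanish on the compact set Kc, which carries nearly all the mass of the good points.\<close>
  define B where "B = (\<lambda>x. clamp_abs (\<kappa> * margin S \<delta> x) (A x))"
  have cut0: "0 \<le> \<kappa> * margin S \<delta> x" for x using \<kappa> margin_nonneg by simp
  have cutd: "\<bar>\<kappa> * margin S \<delta> x - \<kappa> * margin S \<delta> y\<bar> \<le> 2 * \<kappa> * dist x y" for x y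
  proof -
    have "\<bar>\<kappa> * margin S \<delta> x - \<kappa> * margin S \<delta> y\<bar> = \<kappa> * \<bar>margin S \<delta> x - margin S \<delta> y\<bar>"
      using \<kappa> by (simp add: right_diff_distrib[symmetric] abs_mult)
    also have "\<dots> \<le> \<kappa> * (2 * dist x y)" using margin_diff[of \<delta> S x y] \<delta> \<kappa> by (intro mult_left_mono) auto
    finally show ?thesis by simp
  qed
  have BL: "L-lipschitz_on UNIV B"
  proof (rule lipschitz_onI)
    fix x y
    have "\<bar>B x - B y\<bar> \<le> \<bar>A x - A y\<bar> + \<bar>\<kappa> * margin S \<delta> x - \<kappa> * margin S \<delta> y\<bar>"
      unfolding B_def by (rule clamp_abs_diff)
    also have "\<dots> \<le> C * dist x y + 2 * dist x y"
    proof (rule add_mono)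
      show "\<bar>A x - A y\<bar> \<le> C * dist x y" using lipschitz_onD[OF C(2), of x y] by (simp add: dist_real_def)
      have "2 * \<kappa> * dist x y \<le> 2 * dist x y" using \<kappa> by (intro mult_right_mono) auto
      then show "\<bar>\<kappa> * margin S \<delta> x - \<kappa> * margin S \<delta> y\<bar> \<le> 2 * dist x y" using cutd[of x y] by simp
    qed
    finally show "dist (B x) (B y) \<le> L * dist x y" by (simp add: dist_real_def L_def algebra_simps)
  qed (use L in simp)
  have B0: "B x = 0" if "margin S \<delta> x = 0" for x using that by (simp add: B_def clamp_abs_def)
  define F where "F = Phi_hat B"
  have Fc: "bcont F" unfolding F_def Phi_hat_bext by (intro bcont_bext slope_mem[OF BL])
  have Fq: "F (beta_emb (x, y)) = (B x - B y) / dist x y" if "x \<noteq> y" for x y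
    unfolding F_def Phi_hat_bext using bext_emb[OF slope_mem[OF BL], of "(x, y)"] that by (simp add: Mtilde_def)
  have F_small: "\<bar>integral\<^sup>L \<mu> F\<bar> \<le> \<epsilon> / 4"
    using S0(2)[OF BL] B0 margin_mem[of _ S \<delta>] S \<delta> L unfolding F_def Phi_star_def by (auto simp: S_def)
  have Ed: "0 \<le> dist x y * e (beta_emb (x, y))" if "x \<noteq> y" for x y
    using e0[of "beta_emb (x, y)"] beta_emb_topspace[of "(x, y)"] that by (simp add: Mtilde_def)
  define \<Psi> where "\<Psi> = (\<lambda>\<zeta>. F \<zeta> + 2 * e \<zeta>)"
  have Psic: "bcont \<Psi>" unfolding \<Psi>_def using Fc ec by (intro continuous_map_add continuous_map_real_mult_left)
  have lb: "c \<le> F (beta_emb (x, y)) + b * e (beta_emb (x, y))"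
    if "x \<noteq> y" "c * dist x y - b * (dist x y * e (beta_emb (x, y))) \<le> B x - B y" for x y b c
    using that by (simp add: Fq field_simps)
  \<comment> \<open>The truncated metric is nonnegative, so A can decrease only through the defect
    e, and the moving clamp radius contributes at most 2 * \<kappa>.\<close>
  have F_lower: "- 2 * \<kappa> \<le> F \<zeta> + 1 * e \<zeta>" if \<zeta>: "\<zeta> \<in> topspace beta_top" for \<zeta>
  proof -
    have "0 \<le> F \<zeta> + 1 * e \<zeta> - - 2 * \<kappa>"
    proof (rule beta_nonneg[OF openin_topspace _ _ \<zeta>])
      show "bcont (\<lambda>\<zeta>. F \<zeta> + 1 * e \<zeta> - - 2 * \<kappa>)"
        using Fc ec by (intro continuous_map_diff continuous_map_add continuous_map_real_mult_left) auto
      fix q :: "'a \<times> 'a" assume "q \<in> Mtilde"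
      then obtain x y where q: "q = (x, y)" "x \<noteq> y" by (auto simp: Mtilde_def)
      have "0 \<le> min (dist x y) (h * wt x + h * wt y)" using h wt_pos[of x] wt_pos[of y] by simp
      then have "- (2 * \<kappa> * dist x y) - dist x y * e (beta_emb (x, y)) \<le> B x - B y"
        unfolding B_def using Adiff[OF q(2)] by (intro clamp_abs_diff_ge[OF _ cutd Ed[OF q(2)]]) linarith
      then have "- 2 * \<kappa> \<le> F (beta_emb (x, y)) + 1 * e (beta_emb (x, y))"
        by (intro lb q(2)) (simp add: algebra_simps)
      then show "0 \<le> F (beta_emb q) + 1 * e (beta_emb q) - - 2 * \<kappa>" by (simp add: q)
    qed
    then show ?thesis by simp
  qed
  have margin_ge: "h * wt x \<le> \<kappa> * margin S \<delta> x" if "3 * \<sigma> / 4 < relinf S x" for x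
  proof -
    have "H \<le> max 0 (relinf S x - \<delta>)" using that H by (simp add: \<delta>_def)
    then have "wt x * H \<le> margin S \<delta> x"
      unfolding margin_relinf using wt_pos[of x] by (intro mult_left_mono) auto
    then have "\<kappa> * (wt x * H) \<le> \<kappa> * margin S \<delta> x" using \<kappa> by (intro mult_left_mono) auto
    then show ?thesis by (simp add: h_def algebra_simps)
  qed
  \<comment> \<open>Open neighbourhoods of the far sets: lowering the threshold from \<sigma> to 3/4
    \<sigma> makes the condition open and refers to the single set S.\<close>
  define W1 where "W1 = {\<zeta> \<in> topspace beta_top. 3 * \<sigma> / 4 < bext (\<lambda>q. relinf S (fst q)) \<zeta>}"
  define W2 where "W2 = {\<zeta> \<in> topspace beta_top. 3 * \<sigma> / 4 < bext (\<lambda>q. relinf S (snd q)) \<zeta>}"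
  have W_open: "openin beta_top W1" "openin beta_top W2"
    unfolding W1_def W2_def using S by (intro openin_beta_gt bcont_bext mem_relinf; simp)+
  have \<sigma>0: "0 < \<sigma>" using H by simp
  have W_far: "far1 \<sigma> \<subseteq> W1" "far2 \<sigma> \<subseteq> W2"
    using S \<sigma>0 unfolding far1_def far2_def W1_def W2_def by force+
  have W_emb: "beta_emb (x, y) \<in> W1 \<longleftrightarrow> 3 * \<sigma> / 4 < relinf S x" "beta_emb (x, y) \<in> W2 \<longleftrightarrow> 3 * \<sigma> / 4 < relinf S y"
    if "x \<noteq> y" for x y
    using that beta_emb_topspace[of "(x, y)"] S unfolding W1_def W2_def
    by (auto simp: bext_emb mem_relinf Mtilde_def)
  have reldist_c: "bcont (bext reldist)" and share_c: "bcont (bext share1)" "bcont (bext share2)"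
    by (intro bcont_bext mem_reldist mem_share)+
  have "detects_far \<mu> \<kappa> H \<sigma> \<epsilon> \<Psi>"
    unfolding detects_far_def
  proof (intro conjI Psic ballI impI)
    show "- 2 * \<kappa> \<le> \<Psi> \<zeta>" if "\<zeta> \<in> topspace beta_top" for \<zeta>
      using F_lower[OF that] e0[OF that] by (simp add: \<Psi>_def)
  next
    fix \<zeta> assume \<zeta>: "\<zeta> \<in> topspace beta_top" "\<kappa> * H < bext reldist \<zeta>"
    \<comment> \<open>The indicators are frozen at their values at \<zeta>, since as functions they
      are not continuous. \<open>V1\<close> and \<open>V2\<close> impose nearness to a far set only
      if \<zeta> belongs to it.\<close>
    define c1 where "c1 = indicat_real (far1 \<sigma>) \<zeta>"
    define c2 where "c2 = indicat_real (far2 \<sigma>) \<zeta>"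
    define V1 where "V1 = (if \<zeta> \<in> far1 \<sigma> then W1 else topspace beta_top)"
    define V2 where "V2 = (if \<zeta> \<in> far2 \<sigma> then W2 else topspace beta_top)"
    have "0 \<le> \<Psi> \<zeta> - h * (c1 * bext share1 \<zeta> + c2 * bext share2 \<zeta>)"
    proof (rule beta_nonneg[where W = "{\<zeta> \<in> topspace beta_top. h < bext reldist \<zeta>} \<inter> (V1 \<inter> V2)" and \<zeta> = \<zeta>
          and f = "\<lambda>\<zeta>. \<Psi> \<zeta> - h * (c1 * bext share1 \<zeta> + c2 * bext share2 \<zeta>)"])
      show "openin beta_top ({\<zeta> \<in> topspace beta_top. h < bext reldist \<zeta>} \<inter> (V1 \<inter> V2))"
        using W_open reldist_c by (intro openin_Int openin_beta_gt) (auto simp: V1_def V2_def)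
      show "\<zeta> \<in> {\<zeta> \<in> topspace beta_top. h < bext reldist \<zeta>} \<inter> (V1 \<inter> V2)"
        using \<zeta> W_far by (auto simp: V1_def V2_def h_def)
      show "bcont (\<lambda>\<zeta>. \<Psi> \<zeta> - h * (c1 * bext share1 \<zeta> + c2 * bext share2 \<zeta>))"
        using Psic share_c by (intro continuous_map_diff continuous_map_add continuous_map_real_mult_left)
      fix q :: "'a \<times> 'a"
      assume qM: "q \<in> Mtilde" and qW: "beta_emb q \<in> {\<zeta> \<in> topspace beta_top. h < bext reldist \<zeta>} \<inter> (V1 \<inter> V2)"
      obtain x y where q: "q = (x, y)" "x \<noteq> y" using qM by (auto simp: Mtilde_def)
      have d: "0 < dist x y" using q by simp
      have "h < dist x y / (wt x + wt y)"
        using qW qM by (simp add: bext_emb[OF mem_reldist] reldist_def q)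
      then have hd: "h * wt x + h * wt y \<le> dist x y"
        using sumwt_pos[of x y] by (simp add: less_divide_eq distrib_left)
      have "min (h * wt x) (\<kappa> * margin S \<delta> x) + min (h * wt y) (\<kappa> * margin S \<delta> y)
          - 2 * (dist x y * e (beta_emb (x, y))) \<le> B x - B y"
        unfolding B_def using Adiff[OF q(2)] hd Ed[OF q(2)] A cut0
        by (intro clamp_abs_diff_ge_min) auto
      moreover have "c1 * (h * wt x) \<le> min (h * wt x) (\<kappa> * margin S \<delta> x)"
        using margin_ge[of x] qW W_emb(1)[OF q(2)] cut0[of x] h wt_pos[of x]
        by (auto simp: c1_def V1_def indicator_def q)
      moreover have "c2 * (h * wt y) \<le> min (h * wt y) (\<kappa> * margin S \<delta> y)"
        using margin_ge[of y] qW W_emb(2)[OF q(2)] cut0[of y] h wt_pos[of y]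
        by (auto simp: c2_def V2_def indicator_def q)
      \<comment> \<open>The shares times the distance are at most the weights, because the distance
        never exceeds the sum of the weights.\<close>
      moreover have "h * (c1 * share1 q + c2 * share2 q) * dist x y \<le> c1 * (h * wt x) + c2 * (h * wt y)"
      proof -
        have "h * (c1 * share1 q + c2 * share2 q) * dist x y
            = (c1 * (h * wt x) + c2 * (h * wt y)) * (dist x y / (wt x + wt y))"
          by (simp add: share1_def share2_def q add_divide_distrib distrib_left distrib_right mult_ac)
        also have "\<dots> \<le> (c1 * (h * wt x) + c2 * (h * wt y)) * 1"
          using dist_le_wt[of x y] sumwt_pos[of x y] h wt_pos[of x] wt_pos[of y]
          by (intro mult_left_mono) (auto simp: c1_def c2_def)
        finally show ?thesis by simp
      qed
      ultimately have "h * (c1 * share1 q + c2 * share2 q) \<le> F (beta_emb (x, y)) + 2 * e (beta_emb (x, y))"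
        by (intro lb q(2)) linarith
      then show "0 \<le> \<Psi> (beta_emb q) - h * (c1 * bext share1 (beta_emb q) + c2 * bext share2 (beta_emb q))"
        unfolding bext_emb[OF mem_share(1) qM] bext_emb[OF mem_share(2) qM] by (simp add: \<Psi>_def q)
    qed
    then show "\<kappa> * H * (indicat_real (far1 \<sigma>) \<zeta> * bext share1 \<zeta> + indicat_real (far2 \<sigma>) \<zeta> * bext share2 \<zeta>) \<le> \<Psi> \<zeta>"
      by (simp add: h_def c1_def c2_def)
  next
    \<comment> \<open>Near the diagonal the truncated metric is the metric itself, so the slope of A
      is at least 1 - e, and far from S the clamp leaves A unchanged.\<close>
    fix \<zeta> assume \<zeta>: "\<zeta> \<in> far1 \<sigma>" "\<zeta> \<in> far2 \<sigma>" "bext reldist \<zeta> = 0"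
    have "0 \<le> \<Psi> \<zeta> - 1"
    proof (rule beta_nonneg[where W = "{\<zeta> \<in> topspace beta_top. bext reldist \<zeta> < h} \<inter> (W1 \<inter> W2)" and \<zeta> = \<zeta>
          and f = "\<lambda>\<zeta>. \<Psi> \<zeta> - 1"])
      show "openin beta_top ({\<zeta> \<in> topspace beta_top. bext reldist \<zeta> < h} \<inter> (W1 \<inter> W2))"
        using W_open reldist_c by (intro openin_Int openin_beta_lt) auto
      show "\<zeta> \<in> {\<zeta> \<in> topspace beta_top. bext reldist \<zeta> < h} \<inter> (W1 \<inter> W2)"
        using \<zeta> W_far h by (auto simp: far1_def)
      show "bcont (\<lambda>\<zeta>. \<Psi> \<zeta> - 1)" using Psic by (intro continuous_map_diff) auto
      fix q :: "'a \<times> 'a"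
      assume qM: "q \<in> Mtilde" and qW: "beta_emb q \<in> {\<zeta> \<in> topspace beta_top. bext reldist \<zeta> < h} \<inter> (W1 \<inter> W2)"
      obtain x y where q: "q = (x, y)" "x \<noteq> y" using qM by (auto simp: Mtilde_def)
      have "dist x y / (wt x + wt y) < h"
        using qW qM by (simp add: bext_emb[OF mem_reldist] reldist_def q)
      then have hd: "dist x y \<le> h * wt x + h * wt y"
        using sumwt_pos[of x y] by (simp add: divide_less_eq distrib_left)
      have "B x = A x" "B y = A y"
        unfolding B_def using A[of x] A[of y] margin_ge[of x] margin_ge[of y] qW W_emb[OF q(2)]
        by (auto intro!: clamp_abs_eq simp: q)
      then have "1 \<le> F (beta_emb (x, y)) + 1 * e (beta_emb (x, y))"
        using Adiff[OF q(2)] hd by (intro lb q(2)) simp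
      moreover have "0 \<le> e (beta_emb (x, y))" using e0 beta_emb_topspace[OF qM] q by simp
      ultimately show "0 \<le> \<Psi> (beta_emb q) - 1" by (simp add: \<Psi>_def q)
    qed
    then show "1 \<le> \<Psi> \<zeta>" by simp
  next
    \<comment> \<open>Both coordinates of pairs near a point of Kc lie within relative distance
      \<delta> of S, where B is zero.\<close>
    have F0: "F \<zeta> = 0" if \<zeta>: "\<zeta> \<in> Kc" for \<zeta>
    proof -
      have \<zeta>T: "\<zeta> \<in> topspace beta_top" using \<zeta> Kc(1) compactin_subset_topspace by blast
      let ?W = "{\<zeta> \<in> topspace beta_top. bext (\<lambda>q. relinf S (fst q)) \<zeta> < \<delta>} \<inter>
          {\<zeta> \<in> topspace beta_top. bext (\<lambda>q. relinf S (snd q)) \<zeta> < \<delta>}"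
      have W: "openin beta_top ?W" using S by (intro openin_Int openin_beta_lt bcont_bext mem_relinf) auto
      have "S1 \<subseteq> S" by (simp add: S_def)
      then have \<zeta>W: "\<zeta> \<in> ?W"
        using \<zeta>T S1(3)[OF \<zeta>] relinf_beta_antimono[OF S1(2) _ \<zeta>T] by (auto intro: le_less_trans)
      have F0: "F (beta_emb q) = 0" if q: "q \<in> Mtilde" "beta_emb q \<in> ?W" for q
      proof -
        have "relinf S (fst q) < \<delta>" "relinf S (snd q) < \<delta>" using q S by (auto simp: bext_emb mem_relinf)
        then have "B (fst q) = 0" "B (snd q) = 0" by (auto intro!: B0 simp: margin_relinf)
        then show ?thesis using Fq[of "fst q" "snd q"] q(1) by (auto simp: Mtilde_def)
      qed
      have "0 \<le> F \<zeta>" using beta_nonneg[OF W Fc _ \<zeta>W] F0 by simp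
      moreover have "0 \<le> - F \<zeta>" using beta_nonneg[OF W _ _ \<zeta>W, of "\<lambda>\<zeta>. - F \<zeta>"] F0 Fc by simp
      ultimately show ?thesis by simp
    qed
    have Kgood: "measure \<mu> (good - Kc) \<le> \<epsilon> / 16"
      using Kc finite_measure_Diff[OF good_sets Kc_sets] by simp
    have ib: "integrable \<mu> (\<lambda>\<zeta>. indicat_real X \<zeta> * f \<zeta>)" if "X \<in> sets \<mu>" "bcont f" for X f
      using integrable_real_mult_indicator[OF that(1) int[OF that(2)]] by (simp add: mult.commute)
    have gK: "good - Kc \<in> sets \<mu>" using good_sets Kc_sets by auto
    \<comment> \<open>On \<open>bad\<close>, F + 2 e \<le> F + 3 e; on Kc, F = 0; on the small
      remainder, F + e \<ge> - 2 * \<kappa> \<ge> - 2 is absorbed by the last term.\<close>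
    have pt: "indicat_real bad \<zeta> * \<Psi> \<zeta> \<le> F \<zeta> + 3 * e \<zeta> + 2 * indicat_real (good - Kc) \<zeta>"
      if \<zeta>: "\<zeta> \<in> space \<mu>" for \<zeta>
    proof -
      have \<zeta>T: "\<zeta> \<in> topspace beta_top" using \<zeta> sp by simp
      consider "\<zeta> \<in> bad" | "\<zeta> \<in> Kc" "\<zeta> \<notin> bad" | "\<zeta> \<in> good - Kc" "\<zeta> \<notin> bad" using \<zeta> by (auto simp: good_def)
      then show ?thesis
      proof cases
        case 1
        then show ?thesis using e0[OF \<zeta>T] by (simp add: \<Psi>_def indicator_def)
      next
        case 2
        then show ?thesis using e0[OF \<zeta>T] F0 by (simp add: indicator_def)
      next
        case 3
        then show ?thesis using e0[OF \<zeta>T] F_lower[OF \<zeta>T] \<kappa> by (simp add: indicator_def)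
      qed
    qed
    have "integral\<^sup>L \<mu> (\<lambda>\<zeta>. indicat_real bad \<zeta> * \<Psi> \<zeta>) \<le>
        integral\<^sup>L \<mu> (\<lambda>\<zeta>. F \<zeta> + 3 * e \<zeta> + 2 * indicat_real (good - Kc) \<zeta>)"
      using pt int[OF Fc] int[OF ec] gK
      by (intro integral_mono ib bad_sets Psic) (auto simp: less_top[symmetric])
    also have "\<dots> = integral\<^sup>L \<mu> F + 3 * integral\<^sup>L \<mu> e + 2 * measure \<mu> (good - Kc)"
      using int[OF Fc] int[OF ec] gK sets.sets_into_space[OF gK]
      by (simp add: less_top[symmetric] Int_absorb2)
    \<comment> \<open>The three terms are at most 4/16, 3/16 and 2/16 of \<epsilon>.\<close>
    also have "\<dots> \<le> \<epsilon>" using F_small e_int Kgood \<epsilon> by linarith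
    finally show "integral\<^sup>L \<mu> (\<lambda>\<zeta>. indicat_real bad \<zeta> * \<Psi> \<zeta>) \<le> \<epsilon>" .
  qed
  then show ?thesis by blast
qed

end

section \<open>Vanishing of the mass at far points\<close>

context pointed
begin

lemma share_beta:
  assumes "\<zeta> \<in> topspace beta_top"
  shows "0 \<le> bext share1 \<zeta>" "0 \<le> bext share2 \<zeta>" "bext share1 \<zeta> + bext share2 \<zeta> = 1"
proof -
  have c: "bcont (bext share1)" "bcont (bext share2)" by (intro bcont_bext mem_share)+
  have "0 \<le> share1 q" "0 \<le> share2 q" "share1 q + share2 q = 1" for q
    using wt_pos[of "fst q"] wt_pos[of "snd q"] sumwt_nz[of "fst q" "snd q"]
    by (auto simp: share1_def share2_def add_divide_distrib[symmetric])
  then show "0 \<le> bext share1 \<zeta>" "0 \<le> bext share2 \<zeta>" "bext share1 \<zeta> + bext share2 \<zeta> = 1"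
    using beta_nonneg[OF openin_topspace c(1) _ assms] beta_nonneg[OF openin_topspace c(2) _ assms]
      beta_eq[OF continuous_map_add[OF c] _ _ assms, of "\<lambda>_. 1"]
    by (simp_all add: bext_emb mem_share)
qed

text \<open>By \<open>relinf_infinity\<close>, a vanishing share gives the other coordinate relative
  distance at least 1 to every finite set containing z.\<close>

lemma share_zero_far:
  assumes \<zeta>: "\<zeta> \<in> topspace beta_top" and \<sigma>: "\<sigma> \<le> 1"
  shows "bext share1 \<zeta> = 0 \<Longrightarrow> \<zeta> \<in> far2 \<sigma>" "bext share2 \<zeta> = 0 \<Longrightarrow> \<zeta> \<in> far1 \<sigma>"
proof -
  have *: "bext share1 \<zeta> = 0 \<Longrightarrow> \<sigma> \<le> bext (\<lambda>q. relinf S (snd q)) \<zeta>"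
    "bext share2 \<zeta> = 0 \<Longrightarrow> \<sigma> \<le> bext (\<lambda>q. relinf S (fst q)) \<zeta>" if S: "finite S" "z \<in> S" for S
  proof -
    obtain R where R: "\<And>q. 1 - R * share1 q \<le> relinf S (snd q)" "\<And>q. 1 - R * share2 q \<le> relinf S (fst q)"
      using relinf_infinity[OF S] by metis
    have c: "bcont (\<lambda>\<zeta>. bext (\<lambda>q. relinf S (snd q)) \<zeta> - (1 - R * bext share1 \<zeta>))"
      "bcont (\<lambda>\<zeta>. bext (\<lambda>q. relinf S (fst q)) \<zeta> - (1 - R * bext share2 \<zeta>))"
      using S by (intro continuous_map_diff continuous_map_real_mult_left bcont_bext mem_relinf mem_share; simp)+
    have "0 \<le> bext (\<lambda>q. relinf S (snd q)) \<zeta> - (1 - R * bext share1 \<zeta>)"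
      using beta_nonneg[OF openin_topspace c(1) _ \<zeta>] R S by (simp add: bext_emb mem_share mem_relinf)
    moreover have "0 \<le> bext (\<lambda>q. relinf S (fst q)) \<zeta> - (1 - R * bext share2 \<zeta>)"
      using beta_nonneg[OF openin_topspace c(2) _ \<zeta>] R S by (simp add: bext_emb mem_share mem_relinf)
    ultimately show "bext share1 \<zeta> = 0 \<Longrightarrow> \<sigma> \<le> bext (\<lambda>q. relinf S (snd q)) \<zeta>"
      "bext share2 \<zeta> = 0 \<Longrightarrow> \<sigma> \<le> bext (\<lambda>q. relinf S (fst q)) \<zeta>"
      using \<sigma> by auto
  qed
  show "bext share1 \<zeta> = 0 \<Longrightarrow> \<zeta> \<in> far2 \<sigma>" "bext share2 \<zeta> = 0 \<Longrightarrow> \<zeta> \<in> far1 \<sigma>"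
    using * \<zeta> by (auto simp: far1_def far2_def)
qed

lemma reldist_beta_nonneg:
  assumes "\<zeta> \<in> topspace beta_top" shows "0 \<le> bext reldist \<zeta>"
proof (rule beta_nonneg[OF openin_topspace bcont_bext[OF mem_reldist] _ assms])
  fix q :: "'a \<times> 'a" assume "q \<in> Mtilde"
  then show "0 \<le> bext reldist (beta_emb q)"
    using sumwt_pos[of "fst q" "snd q"] by (simp add: bext_emb[OF mem_reldist] reldist_def)
qed

lemma reldist_zero_far:
  assumes \<zeta>: "\<zeta> \<in> topspace beta_top" and 0: "bext reldist \<zeta> = 0"
  shows "\<zeta> \<in> far1 \<sigma> \<longleftrightarrow> \<zeta> \<in> far2 \<sigma>"
proof -
  have "bext (\<lambda>q. relinf S (fst q)) \<zeta> = bext (\<lambda>q. relinf S (snd q)) \<zeta>" if S: "z \<in> S" for S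
  proof -
    have c: "bcont (\<lambda>\<zeta>. 4 * bext reldist \<zeta> - \<bar>bext (\<lambda>q. relinf S (fst q)) \<zeta> - bext (\<lambda>q. relinf S (snd q)) \<zeta>\<bar>)"
      using S by (intro continuous_map_diff continuous_map_real_abs continuous_map_real_mult_left bcont_bext mem_relinf mem_reldist)
    have "0 \<le> 4 * bext reldist \<zeta> - \<bar>bext (\<lambda>q. relinf S (fst q)) \<zeta> - bext (\<lambda>q. relinf S (snd q)) \<zeta>\<bar>"
      using beta_nonneg[OF openin_topspace c _ \<zeta>] relinf_diff[OF S] S
      by (simp add: bext_emb mem_relinf mem_reldist reldist_def)
    then show ?thesis using 0 by simp
  qed
  then show ?thesis using \<zeta> by (auto simp: far1_def far2_def)
qed

end

lemma (in finite_measure) decreasing_measure_small: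
  assumes "\<And>n. D n \<in> sets M" "decseq D" "0 < (\<epsilon>::real)"
  shows "\<forall>\<^sub>F n in sequentially. measure M (D n) < measure M (\<Inter>n. D n) + \<epsilon>"
proof -
  have "(\<lambda>n. measure M (D n)) \<longlonglongrightarrow> measure M (\<Inter>n. D n)"
    using assms by (intro finite_Lim_measure_decseq) auto
  then show ?thesis using assms(3) by (intro order_tendstoD(2)) auto
qed

context pointed
begin

section \<open>Limits of the test functions: no mass at far points\<close>

lemma decseq_reldist_small:
  assumes "0 < H"
  shows "decseq (\<lambda>m. {\<zeta> \<in> bad. bext reldist \<zeta> \<le> H / real (Suc m)} - X)"
    and "(\<Inter>m. {\<zeta> \<in> bad. bext reldist \<zeta> \<le> H / real (Suc m)} - X) = {\<zeta> \<in> bad. bext reldist \<zeta> = 0} - X"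
proof -
  show "decseq (\<lambda>m. {\<zeta> \<in> bad. bext reldist \<zeta> \<le> H / real (Suc m)} - X)"
  proof (rule decseq_SucI)
    fix m
    have "H / real (Suc (Suc m)) \<le> H / real (Suc m)" using assms by (intro divide_left_mono) auto
    then show "{\<zeta> \<in> bad. bext reldist \<zeta> \<le> H / real (Suc (Suc m))} - X \<subseteq> {\<zeta> \<in> bad. bext reldist \<zeta> \<le> H / real (Suc m)} - X"
      by auto
  qed
  have "bext reldist \<zeta> = 0" if "\<zeta> \<in> bad" and le: "\<And>m. bext reldist \<zeta> \<le> H / real (Suc m)" for \<zeta>
  proof (rule antisym)
    have "(\<lambda>m. H * inverse (real (Suc m))) \<longlonglongrightarrow> H * 0" by (intro tendsto_mult LIMSEQ_inverse_real_of_nat) auto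
    then show "bext reldist \<zeta> \<le> 0"
      using le by (intro LIMSEQ_le_const[of "\<lambda>m. H * inverse (real (Suc m))"]) (auto simp: divide_inverse)
    show "0 \<le> bext reldist \<zeta>" using that(1) bad_topspace by (intro reldist_beta_nonneg) auto
  qed
  then show "(\<Inter>m. {\<zeta> \<in> bad. bext reldist \<zeta> \<le> H / real (Suc m)} - X) = {\<zeta> \<in> bad. bext reldist \<zeta> = 0} - X"
    using assms by auto
qed

lemma reldist_small_sets:
  assumes "radon_on beta_top \<mu>"
  shows "{\<zeta> \<in> bad. bext reldist \<zeta> \<le> a} \<in> sets \<mu>"
proof -
  have "{\<zeta> \<in> topspace beta_top. bext reldist \<zeta> \<le> a} \<in> sets \<mu>"
    by (intro radon_closed[OF assms] closedin_beta_le bcont_bext mem_reldist)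
  then have "bad \<inter> {\<zeta> \<in> topspace beta_top. bext reldist \<zeta> \<le> a} \<in> sets \<mu>" using far_sets(3)[OF assms] by auto
  moreover have "bad \<inter> {\<zeta> \<in> topspace beta_top. bext reldist \<zeta> \<le> a} = {\<zeta> \<in> bad. bext reldist \<zeta> \<le> a}"
    using bad_topspace by auto
  ultimately show ?thesis by simp
qed

text \<open>Here \<kappa> = 1 and H tends to 0. The test function is at least 1 on the far part of
  the diagonal and nonnegative where the relative distance exceeds H; the remaining set E m carries
  little mass and costs at most twice that mass.\<close>

lemma bad_diagonal_null:
  fixes \<mu> :: "((('a \<times> 'a) \<Rightarrow> real) \<Rightarrow> real) measure"
  assumes three: "\<exists>a b c :: 'a. a \<noteq> b \<and> b \<noteq> c \<and> a \<noteq> c"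
    and radon: "radon_on beta_top \<mu>" and minimal: "preceq_minimal \<mu>"
    and free: "in_free_space z (Phi_star \<mu>)"
  shows "measure \<mu> {\<zeta> \<in> bad. bext reldist \<zeta> = 0} = 0"
proof -
  interpret finite_measure \<mu> using radon_on_finite_measure[OF radon] .
  note int = radon_on_continuous_integrable[OF radon compact_beta]
  define Z where "Z = {\<zeta> \<in> bad. bext reldist \<zeta> = 0}"
  have ZT: "\<zeta> \<in> topspace beta_top" if "\<zeta> \<in> bad" for \<zeta> using that bad_topspace by auto
  have Z_eq: "Z = {\<zeta> \<in> bad. bext reldist \<zeta> \<le> 0}"
    unfolding Z_def using reldist_beta_nonneg[OF ZT] by force
  have Z: "Z \<in> sets \<mu>" unfolding Z_eq by (rule reldist_small_sets[OF radon])
  \<comment> \<open>One \<epsilon> comes from the integral of the test function, 2 * 2 \<epsilon>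
    from E m, and one from the part of Z outside \<open>far1 \<sigma>\<close>.\<close>
  have bound: "measure \<mu> Z \<le> 6 * \<epsilon>" if \<epsilon>: "0 < \<epsilon>" for \<epsilon>
  proof -
    have "decseq (\<lambda>n. Z - far1 (1 / real (Suc n)))"
    proof (rule decseq_SucI)
      fix n
      have "1 / real (Suc (Suc n)) \<le> 1 / real (Suc n)" by (intro divide_left_mono) auto
      from far_antimono(1)[OF this] show "Z - far1 (1 / real (Suc (Suc n))) \<subseteq> Z - far1 (1 / real (Suc n))" by auto
    qed
    \<comment> \<open>A point of Z is far in at least one coordinate, and on the diagonal this means
      far in both.\<close>
    moreover have "(\<Inter>n. Z - far1 (1 / real (Suc n))) = {}"
    proof -
      have "\<exists>n. \<zeta> \<in> far1 (1 / real (Suc n))" if "\<zeta> \<in> Z" for \<zeta>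
        using that reldist_zero_far[OF ZT] unfolding Z_def bad_def by blast
      then show ?thesis by auto
    qed
    moreover have "Z - far1 (1 / real (Suc n)) \<in> sets \<mu>" for n using Z far_sets(1)[OF radon] by (rule sets.Diff)
    ultimately have "\<forall>\<^sub>F n in sequentially. measure \<mu> (Z - far1 (1 / real (Suc n))) < measure \<mu> {} + \<epsilon>"
      using decreasing_measure_small[of "\<lambda>n. Z - far1 (1 / real (Suc n))" \<epsilon>] \<epsilon> by metis
    then obtain n where n: "measure \<mu> (Z - far1 (1 / real (Suc n))) < \<epsilon>"
      by (auto simp: eventually_sequentially)
    define \<sigma> where "\<sigma> = 1 / real (Suc n)"
    have \<sigma>: "0 < \<sigma>" "\<sigma> \<le> 1" by (auto simp: \<sigma>_def divide_le_eq)
    \<comment> \<open>The points of \<open>bad\<close> where only the crude lower bound is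
      available. As m grows they shrink to the part of Z outside \<open>far1 \<sigma>\<close>, which
      has measure below \<epsilon> by the choice of \<sigma>.\<close>
    define E where "E = (\<lambda>m. {\<zeta> \<in> bad. bext reldist \<zeta> \<le> (\<sigma> / 2) / real (Suc m)} - (Z \<inter> far1 \<sigma>))"
    have E_sets: "E m \<in> sets \<mu>" for m
      unfolding E_def using reldist_small_sets[OF radon] Z far_sets(1)[OF radon] by auto
    have "decseq E" "(\<Inter>m. E m) = Z - far1 \<sigma>"
      unfolding E_def using decseq_reldist_small[of "\<sigma> / 2" "Z \<inter> far1 \<sigma>"] \<sigma> by (auto simp: Z_def)
    then have "\<forall>\<^sub>F m in sequentially. measure \<mu> (E m) < measure \<mu> (Z - far1 \<sigma>) + \<epsilon>"
      using decreasing_measure_small[of E \<epsilon>] E_sets \<epsilon> by simp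
    then obtain m where "measure \<mu> (E m) < measure \<mu> (Z - far1 \<sigma>) + \<epsilon>"
      by (auto simp: eventually_sequentially)
    then have Em: "measure \<mu> (E m) \<le> 2 * \<epsilon>" using n by (simp add: \<sigma>_def)
    define H where "H = (\<sigma> / 2) / real (Suc m)"
    have "H \<le> \<sigma> / 2" unfolding H_def using \<sigma> divide_left_mono[of 1 "real (Suc m)" "\<sigma> / 2"] by simp
    then have "2 * H \<le> \<sigma>" by linarith
    moreover have "0 < H" using \<sigma> by (simp add: H_def)
    ultimately have H: "0 < H" "2 * H \<le> \<sigma>" by blast+
    obtain \<Psi> where "detects_far \<mu> 1 H \<sigma> \<epsilon> \<Psi>"
      using ex_detects_far[OF three radon minimal free zero_less_one order_refl H \<sigma>(2) \<epsilon>] by blast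
    note \<Psi> = detects_farD[OF this]
    have pt: "indicat_real (Z \<inter> far1 \<sigma>) \<zeta> - 2 * indicat_real (E m) \<zeta> \<le> indicat_real bad \<zeta> * \<Psi> \<zeta>" for \<zeta>
    proof (cases "\<zeta> \<in> bad")
      case False
      then show ?thesis by (simp add: Z_def E_def)
    next
      case True
      note T = ZT[OF True]
      consider "\<zeta> \<in> Z \<inter> far1 \<sigma>" | "\<zeta> \<in> E m" "\<zeta> \<notin> Z \<inter> far1 \<sigma>" | "H < bext reldist \<zeta>" "\<zeta> \<notin> Z \<inter> far1 \<sigma>"
      proof -
        have "\<zeta> \<in> E m \<longleftrightarrow> bext reldist \<zeta> \<le> H \<and> \<zeta> \<notin> Z \<inter> far1 \<sigma>" using True by (simp add: E_def H_def)
        then show ?thesis using that by linarith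
      qed
      then show ?thesis
      proof cases
        case 1
        then have "1 \<le> \<Psi> \<zeta>" using \<Psi>(4) reldist_zero_far[OF T] by (auto simp: Z_def)
        then show ?thesis using 1 True by (simp add: E_def)
      next
        case 2
        then show ?thesis using \<Psi>(2)[OF T] True by simp
      next
        case 3
        have "0 \<le> 1 * H * (indicat_real (far1 \<sigma>) \<zeta> * bext share1 \<zeta> + indicat_real (far2 \<sigma>) \<zeta> * bext share2 \<zeta>)"
          using H share_beta[OF T] by simp
        then have "0 \<le> \<Psi> \<zeta>" using \<Psi>(3)[OF T] 3 by simp
        then show ?thesis using 3 True by (auto simp: indicator_def)
      qed
    qed
    have zf: "Z \<inter> far1 \<sigma> \<in> sets \<mu>" using Z far_sets(1)[OF radon] by auto
    have "measure \<mu> (Z \<inter> far1 \<sigma>) - 2 * measure \<mu> (E m) =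
        integral\<^sup>L \<mu> (\<lambda>\<zeta>. indicat_real (Z \<inter> far1 \<sigma>) \<zeta> - 2 * indicat_real (E m) \<zeta>)"
      using zf E_sets[of m] sets.sets_into_space[OF zf] sets.sets_into_space[OF E_sets[of m]]
      by (simp add: less_top[symmetric] Int_absorb2)
    also have "\<dots> \<le> integral\<^sup>L \<mu> (\<lambda>\<zeta>. indicat_real bad \<zeta> * \<Psi> \<zeta>)"
      using pt zf E_sets[of m] integrable_real_mult_indicator[OF far_sets(3)[OF radon] int[OF \<Psi>(1)]]
      by (intro integral_mono) (auto simp: less_top[symmetric] mult.commute)
    also have "\<dots> \<le> \<epsilon>" by (rule \<Psi>(5))
    finally have "measure \<mu> (Z \<inter> far1 \<sigma>) \<le> 5 * \<epsilon>" using Em by simp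
    moreover have "measure \<mu> Z = measure \<mu> (Z - far1 \<sigma>) + measure \<mu> (Z \<inter> far1 \<sigma>)"
      using finite_measure_Union[of "Z - far1 \<sigma>" "Z \<inter> far1 \<sigma>"] zf Z far_sets(1)[OF radon]
      by (simp add: Un_Diff_Int sets.Diff Int_commute[of _ "Z - far1 \<sigma>"] disjoint_iff)
    ultimately show ?thesis using n by (simp add: \<sigma>_def)
  qed
  have "measure \<mu> Z \<le> 0"
  proof (rule field_le_epsilon)
    show "measure \<mu> Z \<le> 0 + e" if "0 < e" for e using bound[of "e / 6"] that by simp
  qed
  then show ?thesis unfolding Z_def by (intro antisym measure_nonneg)
qed

lemma far_null:
  fixes \<mu> :: "((('a \<times> 'a) \<Rightarrow> real) \<Rightarrow> real) measure"
  assumes three: "\<exists>a b c :: 'a. a \<noteq> b \<and> b \<noteq> c \<and> a \<noteq> c"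
    and radon: "radon_on beta_top \<mu>" and minimal: "preceq_minimal \<mu>"
    and free: "in_free_space z (Phi_star \<mu>)" and \<sigma>: "0 < \<sigma>" "\<sigma> \<le> 1"
  shows "far1 \<sigma> \<union> far2 \<sigma> \<in> null_sets \<mu>"
proof -
  interpret finite_measure \<mu> using radon_on_finite_measure[OF radon] .
  have sp: "space \<mu> = topspace beta_top" using radon by (simp add: radon_on_def)
  note int = radon_on_continuous_integrable[OF radon compact_beta]
  note sets = far_sets[OF radon]
  define H where "H = \<sigma> / 2"
  have H: "0 < H" "2 * H \<le> \<sigma>" "H \<le> 1" using \<sigma> by (auto simp: H_def)
  define u where "u = (\<lambda>\<zeta>. indicat_real (far1 \<sigma>) \<zeta> * bext share1 \<zeta> + indicat_real (far2 \<sigma>) \<zeta> * bext share2 \<zeta>)"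
  have far_bad': "far1 \<sigma> \<subseteq> bad" "far2 \<sigma> \<subseteq> bad" using far_bad[OF \<sigma>(1)] by auto
  have ui: "integrable \<mu> u"
    unfolding u_def
    using integrable_real_mult_indicator[OF sets(1) int[OF bcont_bext[OF mem_share(1)]]]
      integrable_real_mult_indicator[OF sets(2) int[OF bcont_bext[OF mem_share(2)]]]
    by (intro Bochner_Integration.integrable_add) (auto simp: mult.commute)
  have u0: "0 \<le> u \<zeta>" and u1: "u \<zeta> \<le> 1" if "\<zeta> \<in> topspace beta_top" for \<zeta>
    using share_beta[OF that] by (auto simp: u_def indicator_def)
  have uout: "u \<zeta> = 0" if "\<zeta> \<notin> bad" for \<zeta> using that far_bad' by (auto simp: u_def indicator_def)
  have "integral\<^sup>L \<mu> u \<le> 0 + \<epsilon>" if \<epsilon>: "0 < \<epsilon>" for \<epsilon>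
  proof -
    define D where "D = (\<lambda>m. {\<zeta> \<in> bad. bext reldist \<zeta> \<le> H / real (Suc m)})"
    have D_sets: "D m \<in> sets \<mu>" for m unfolding D_def by (rule reldist_small_sets[OF radon])
    have "decseq D" "(\<Inter>m. D m) = {\<zeta> \<in> bad. bext reldist \<zeta> = 0}"
      unfolding D_def using decseq_reldist_small[of H "{}"] H by auto
    then have "\<forall>\<^sub>F m in sequentially. measure \<mu> (D m) < H * \<epsilon> / 6"
      using decreasing_measure_small[of D "H * \<epsilon> / 6"] D_sets H \<epsilon> bad_diagonal_null[OF three radon minimal free]
      by simp
    then obtain m where m: "measure \<mu> (D m) < H * \<epsilon> / 6" by (auto simp: eventually_sequentially)
    define \<kappa> where "\<kappa> = 1 / real (Suc m)"
    have \<kappa>: "0 < \<kappa>" "\<kappa> \<le> 1" by (auto simp: \<kappa>_def divide_le_eq)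
    have "0 < \<kappa> * (H * \<epsilon> / 6)" using \<kappa> H \<epsilon> by simp
    then obtain \<Psi> where "detects_far \<mu> \<kappa> H \<sigma> (\<kappa> * (H * \<epsilon> / 6)) \<Psi>"
      using ex_detects_far[OF three radon minimal free \<kappa> H(1,2) \<sigma>(2)] by blast
    note \<Psi> = detects_farD[OF this]
    \<comment> \<open>On D m the coefficient 3 covers 2 * \<kappa> for the crude lower bound and
      \<kappa> for the term with u, because H * u \<le> 1.\<close>
    have pt: "\<kappa> * H * u \<zeta> - 3 * \<kappa> * indicat_real (D m) \<zeta> \<le> indicat_real bad \<zeta> * \<Psi> \<zeta>"
      if \<zeta>: "\<zeta> \<in> space \<mu>" for \<zeta>
    proof -
      have T: "\<zeta> \<in> topspace beta_top" using \<zeta> sp by simp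
      consider "\<zeta> \<notin> bad" | "\<zeta> \<in> bad" "\<zeta> \<in> D m" | "\<zeta> \<in> bad" "\<zeta> \<notin> D m" "\<kappa> * H < bext reldist \<zeta>"
        by (auto simp: D_def \<kappa>_def)
      then show ?thesis
      proof cases
        case 1
        then show ?thesis using uout by (simp add: D_def)
      next
        case 2
        have "H * u \<zeta> \<le> 1" using H u0[OF T] u1[OF T] by (intro mult_le_one) auto
        then have "\<kappa> * (H * u \<zeta>) \<le> \<kappa> * 1" using \<kappa> by (intro mult_left_mono) auto
        then show ?thesis using 2 \<Psi>(2)[OF T] by (simp add: mult.assoc)
      next
        case 3
        then show ?thesis using \<Psi>(3)[OF T] by (simp add: u_def)
      qed
    qed
    have "\<kappa> * H * integral\<^sup>L \<mu> u - 3 * \<kappa> * measure \<mu> (D m) =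
        integral\<^sup>L \<mu> (\<lambda>\<zeta>. \<kappa> * H * u \<zeta> - 3 * \<kappa> * indicat_real (D m) \<zeta>)"
      using ui D_sets[of m] sets.sets_into_space[OF D_sets[of m]]
      by (simp add: less_top[symmetric] Int_absorb2)
    also have "\<dots> \<le> integral\<^sup>L \<mu> (\<lambda>\<zeta>. indicat_real bad \<zeta> * \<Psi> \<zeta>)"
      using pt ui D_sets[of m] integrable_real_mult_indicator[OF sets(3) int[OF \<Psi>(1)]]
      by (intro integral_mono) (auto simp: less_top[symmetric] mult.commute)
    also have "\<dots> \<le> \<kappa> * (H * \<epsilon> / 6)" by (rule \<Psi>(5))
    finally have "\<kappa> * (H * integral\<^sup>L \<mu> u) \<le> \<kappa> * (H * \<epsilon> / 6 + 3 * measure \<mu> (D m))"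
      by (simp add: algebra_simps)
    then have "H * integral\<^sup>L \<mu> u \<le> H * \<epsilon> / 6 + 3 * measure \<mu> (D m)"
      using \<kappa>(1) by (rule mult_left_le_imp_le)
    also have "\<dots> \<le> H * \<epsilon>" using m mult_pos_pos[OF H(1) \<epsilon>] by linarith
    finally show ?thesis using H by simp
  qed
  then have "integral\<^sup>L \<mu> u \<le> 0" by (rule field_le_epsilon)
  moreover have nn: "AE \<zeta> in \<mu>. 0 \<le> u \<zeta>" using u0 sp by (intro AE_I2) auto
  ultimately have "integral\<^sup>L \<mu> u = 0" using integral_nonneg_AE[OF nn] by simp
  then have "AE \<zeta> in \<mu>. u \<zeta> = 0" using integral_nonneg_eq_0_iff_AE[OF ui nn] by simp
  \<comment> \<open>If u vanishes at a point of \<open>far1 \<sigma>\<close>, its first share is 0.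
    The point is then in \<open>far2 \<sigma>\<close>, so its second share is 0 as well, although
    the shares add up to 1. The other case is symmetric.\<close>
  moreover have "\<zeta> \<notin> far1 \<sigma> \<union> far2 \<sigma>" if "u \<zeta> = 0" "\<zeta> \<in> space \<mu>" for \<zeta>
  proof -
    have T: "\<zeta> \<in> topspace beta_top" using that sp by simp
    note s = share_beta[OF T] and f = share_zero_far[OF T \<sigma>(2)]
    have 1: "\<zeta> \<in> far1 \<sigma> \<Longrightarrow> bext share1 \<zeta> = 0" and 2: "\<zeta> \<in> far2 \<sigma> \<Longrightarrow> bext share2 \<zeta> = 0"
      using that(1) s by (cases "\<zeta> \<in> far1 \<sigma>"; cases "\<zeta> \<in> far2 \<sigma>"; simp add: u_def)+
    then show ?thesis using f s(3) by auto
  qed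
  ultimately have "AE \<zeta> in \<mu>. \<zeta> \<notin> far1 \<sigma> \<union> far2 \<sigma>" by (auto elim: AE_mp)
  then show ?thesis using sets by (subst AE_iff_null_sets) auto
qed

lemma bad_null:
  fixes \<mu> :: "((('a \<times> 'a) \<Rightarrow> real) \<Rightarrow> real) measure"
  assumes "\<exists>a b c :: 'a. a \<noteq> b \<and> b \<noteq> c \<and> a \<noteq> c" "radon_on beta_top \<mu>" "preceq_minimal \<mu>"
    "in_free_space z (Phi_star \<mu>)"
  shows "bad \<in> null_sets \<mu>"
  unfolding bad_def using far_null[OF assms] by (intro null_sets_UN) (simp add: divide_le_eq)

section \<open>From small relative distances to points of M\<close>

lemma bounded_projection_near:
  assumes \<pi>: "\<And>f :: 'a \<Rightarrow> real. continuous_on UNIV f \<Longrightarrow> continuous_on Mtilde (\<lambda>q :: 'a \<times> 'a. f (\<pi> q))"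
    and \<zeta>: "\<zeta> \<in> topspace beta_top"
    and near: "\<And>\<delta>. 0 < \<delta> \<Longrightarrow> \<exists>S. finite S \<and> z \<in> S \<and> bext (\<lambda>q. relinf S (\<pi> q)) \<zeta> < \<delta>"
    and \<epsilon>: "0 < \<epsilon>"
  shows "\<exists>s. bext (\<lambda>q. min 1 (dist (\<pi> q) s)) \<zeta> < \<epsilon>"
proof (rule ccontr)
  assume "\<not> ?thesis"
  then have far: "\<epsilon> \<le> bext (\<lambda>q. min 1 (dist (\<pi> q) s)) \<zeta>" for s by (simp add: not_less)
  have mem: "tilde (\<lambda>q. relinf S (\<pi> q)) \<in> Cb_tilde" if "z \<in> S" for S
    using relinf_range[OF that] by (intro tilde_mem[of _ 1] \<pi> cont_relinf) auto
  have mem_d: "tilde (\<lambda>q. min 1 (dist (\<pi> q) s)) \<in> Cb_tilde" for s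
    by (intro tilde_mem[of _ 1] \<pi>[of "\<lambda>x. min 1 (dist x s)"] continuous_intros) auto
  \<comment> \<open>Two finite sets are used in turn. Relative distance below 1/2 to S1 gives wt x -
    (1 + m) < wt x / 2, hence wt x < R; relative distance below \<epsilon> / (2 R) to S2 then means
    true distance below \<epsilon> / 2.\<close>
  obtain S1 where S1: "finite S1" "z \<in> S1" "bext (\<lambda>q. relinf S1 (\<pi> q)) \<zeta> < 1 / 2" using near[of "1 / 2"] by auto
  obtain m where m: "m \<ge> 0" "\<And>x. wt x - (1 + m) \<le> infdist x S1" using infdist_ge_wt[OF S1(1,2)] by metis
  define R where "R = 2 * (1 + m)"
  have R: "R > 0" using m by (simp add: R_def)
  obtain S2 where S2: "finite S2" "z \<in> S2" "bext (\<lambda>q. relinf S2 (\<pi> q)) \<zeta> < \<epsilon> / (2 * R)"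
    using near[of "\<epsilon> / (2 * R)"] R \<epsilon> by auto
  \<comment> \<open>All conditions are open and finite in number, so they hold together at an actual
    pair, where they contradict each other.\<close>
  define W where "W = {\<zeta> \<in> topspace beta_top. bext (\<lambda>q. relinf S1 (\<pi> q)) \<zeta> < 1 / 2} \<inter>
      ({\<zeta> \<in> topspace beta_top. bext (\<lambda>q. relinf S2 (\<pi> q)) \<zeta> < \<epsilon> / (2 * R)} \<inter>
      (\<Inter>s\<in>S2. {\<zeta> \<in> topspace beta_top. \<epsilon> / 2 < bext (\<lambda>q. min 1 (dist (\<pi> q) s)) \<zeta>}))"
  have "openin beta_top W"
    unfolding W_def using S1 S2
    by (intro openin_Int openin_INT2 openin_beta_lt openin_beta_gt bcont_bext mem mem_d) auto
  moreover have "\<epsilon> / 2 < bext (\<lambda>q. min 1 (dist (\<pi> q) s)) \<zeta>" for s using far[of s] \<epsilon> by simp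
  then have "\<zeta> \<in> W" unfolding W_def using S1 S2 \<zeta> by auto
  ultimately obtain q where q: "q \<in> Mtilde" "beta_emb q \<in> W" using beta_dense by metis
  define x where "x = \<pi> q"
  have x: "relinf S1 x < 1 / 2" "relinf S2 x < \<epsilon> / (2 * R)" "\<And>s. s \<in> S2 \<Longrightarrow> \<epsilon> / 2 < min 1 (dist x s)"
    using q(2) S1 S2 unfolding W_def x_def by (auto simp: bext_emb mem mem_d q(1))
  have "infdist x S1 < wt x / 2" using x(1) wt_pos[of x] by (simp add: relinf_def field_simps)
  then have "wt x < R" using m(2)[of x] by (simp add: R_def)
  then have "\<epsilon> / (2 * R) * wt x \<le> \<epsilon> / (2 * R) * R" using R \<epsilon> by (intro mult_left_mono) auto
  moreover have "infdist x S2 < \<epsilon> / (2 * R) * wt x" using x(2) wt_pos[of x] by (simp add: relinf_def divide_less_eq)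
  ultimately have "infdist x S2 < \<epsilon> / 2" using R by simp
  moreover have "\<epsilon> / 2 \<le> infdist x S2"
  proof -
    have "infdist x S2 = (INF s\<in>S2. dist x s)" using S2 by (auto simp: infdist_def)
    moreover have "\<epsilon> / 2 \<le> (INF s\<in>S2. dist x s)" using S2 x(3) by (intro cINF_greatest) (auto intro: less_imp_le)
    ultimately show ?thesis by simp
  qed
  ultimately show False by simp
qed

end

text \<open>The points s n that approximate the projection of \<zeta> form a Cauchy sequence, since
  some pair near \<zeta> projects close to both s n and s m. Completeness provides the limit x, and
  uniform continuity shows that the extension of f takes the value f x at \<zeta>. The map \<pi>
  stands for either projection.\<close>

lemma bounded_projection_limit:
  fixes z :: "'a::complete_space" and \<pi> :: "'a \<times> 'a \<Rightarrow> 'a"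
  assumes \<pi>: "\<And>f :: 'a \<Rightarrow> real. continuous_on UNIV f \<Longrightarrow> continuous_on Mtilde (\<lambda>q. f (\<pi> q))"
    and \<zeta>: "\<zeta> \<in> topspace beta_top"
    and near: "\<And>\<delta>. 0 < \<delta> \<Longrightarrow> \<exists>S. finite S \<and> z \<in> S \<and> bext (\<lambda>q. pointed.relinf z S (\<pi> q)) \<zeta> < \<delta>"
  obtains x where "\<And>f. f \<in> Cu \<Longrightarrow> bext (\<lambda>q. f (\<pi> q)) \<zeta> = f x"
proof -
  interpret pointed z .
  have mem_d: "tilde (\<lambda>q. min 1 (dist (\<pi> q) s)) \<in> Cb_tilde" for s
    by (intro tilde_mem[of _ 1] \<pi>[of "\<lambda>x. min 1 (dist x s)"] continuous_intros) auto
  let ?u = "\<lambda>s. bext (\<lambda>q. min 1 (dist (\<pi> q) s))"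
  have "\<exists>s. ?u s \<zeta> < 1 / real (Suc n)" for n
    by (rule bounded_projection_near[OF \<pi> \<zeta> near]) auto
  then obtain s where s: "\<And>n. ?u (s n) \<zeta> < 1 / real (Suc n)" by metis
  have open_u: "openin beta_top {\<zeta> \<in> topspace beta_top. ?u t \<zeta> < a}" for t a
    by (intro openin_beta_lt bcont_bext mem_d)
  have small: "dist (\<pi> q) (s n) < 1 / real (Suc n)"
    if "q \<in> Mtilde" "?u (s n) (beta_emb q) < 1 / real (Suc n)" for q n
  proof -
    have "min 1 (dist (\<pi> q) (s n)) < 1 / real (Suc n)" using that by (simp add: bext_emb mem_d)
    moreover have "1 / real (Suc n) \<le> 1" by (simp add: divide_le_eq)
    ultimately show ?thesis by (simp add: min_less_iff_disj)
  qed
  have dist_s: "dist (s n) (s m) < 1 / real (Suc n) + 1 / real (Suc m)" for n m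
  proof -
    let ?W = "{\<zeta> \<in> topspace beta_top. ?u (s n) \<zeta> < 1 / real (Suc n)} \<inter>
        {\<zeta> \<in> topspace beta_top. ?u (s m) \<zeta> < 1 / real (Suc m)}"
    have "openin beta_top ?W" by (intro openin_Int open_u)
    moreover have "\<zeta> \<in> ?W" using s \<zeta> by simp
    ultimately obtain q where q: "q \<in> Mtilde" "beta_emb q \<in> ?W" by (rule beta_dense)
    then have "dist (\<pi> q) (s n) < 1 / real (Suc n)" "dist (\<pi> q) (s m) < 1 / real (Suc m)"
      using small[OF q(1), of n] small[OF q(1), of m] by auto
    then show ?thesis using dist_triangle3[of "s n" "s m" "\<pi> q"] by simp
  qed
  have "Cauchy s"
  proof (rule metric_CauchyI)
    fix e :: real assume e: "0 < e"
    obtain N where N: "1 / real (Suc N) < e / 2" using nat_approx_posE[of "e / 2"] e by auto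
    have le: "1 / real (Suc n) \<le> 1 / real (Suc N)" if "n \<ge> N" for n
      using that by (intro divide_left_mono) auto
    show "\<exists>N. \<forall>m\<ge>N. \<forall>n\<ge>N. dist (s m) (s n) < e"
    proof (intro exI[of _ N] allI impI)
      fix m n assume "N \<le> m" "N \<le> n"
      then show "dist (s m) (s n) < e" using dist_s[of m n] le[of m] le[of n] N by linarith
    qed
  qed
  then obtain x where x: "s \<longlonglongrightarrow> x" using Cauchy_convergent convergent_def by blast
  show ?thesis
  proof (rule that)
    fix f :: "'a \<Rightarrow> real" assume "f \<in> Cu"
    then have f: "uniformly_continuous_on UNIV f" "bounded (range f)" by (auto simp: Cu_def)
    obtain b where b: "\<And>x. \<bar>f x\<bar> \<le> b" using f(2) by (auto simp: bounded_iff)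
    have mem: "tilde (\<lambda>q. f (\<pi> q)) \<in> Cb_tilde"
      using b f(1) by (intro tilde_mem[of _ b] \<pi> uniformly_continuous_imp_continuous) auto
    have "\<bar>bext (\<lambda>q. f (\<pi> q)) \<zeta> - f x\<bar> \<le> 0 + e" if e: "0 < e" for e
    proof -
      obtain d where d: "0 < d" "\<And>a b. dist a b < d \<Longrightarrow> dist (f a) (f b) < e"
        using f(1) e unfolding uniformly_continuous_on_def by (metis UNIV_I dist_commute)
      have "\<forall>\<^sub>F n in sequentially. dist (s n) x < d / 2" using x d(1) by (intro tendstoD) auto
      moreover have "\<forall>\<^sub>F n in sequentially. 1 / real (Suc n) < d / 2"
        using d(1) LIMSEQ_inverse_real_of_nat by (intro order_tendstoD(2)) (auto simp: inverse_eq_divide)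
      ultimately have "\<forall>\<^sub>F n in sequentially. dist (s n) x < d / 2 \<and> 1 / real (Suc n) < d / 2"
        by (rule eventually_conj)
      then obtain n where n: "dist (s n) x < d / 2" "1 / real (Suc n) < d / 2"
        by (auto simp: eventually_sequentially)
      have "0 \<le> e - \<bar>bext (\<lambda>q. f (\<pi> q)) \<zeta> - f x\<bar>"
      proof (rule beta_nonneg[where W = "{\<zeta> \<in> topspace beta_top. ?u (s n) \<zeta> < 1 / real (Suc n)}" and \<zeta> = \<zeta>
            and f = "\<lambda>\<zeta>. e - \<bar>bext (\<lambda>q. f (\<pi> q)) \<zeta> - f x\<bar>", OF open_u])
        show "bcont (\<lambda>\<zeta>. e - \<bar>bext (\<lambda>q. f (\<pi> q)) \<zeta> - f x\<bar>)"
          by (intro continuous_map_diff continuous_map_real_abs bcont_bext mem) auto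
        show "\<zeta> \<in> {\<zeta> \<in> topspace beta_top. ?u (s n) \<zeta> < 1 / real (Suc n)}" using s \<zeta> by simp
        fix q :: "'a \<times> 'a"
        assume q: "q \<in> Mtilde" "beta_emb q \<in> {\<zeta> \<in> topspace beta_top. ?u (s n) \<zeta> < 1 / real (Suc n)}"
        then have "dist (\<pi> q) (s n) < 1 / real (Suc n)" using small[OF q(1), of n] by auto
        then have "dist (\<pi> q) x < d" using n dist_triangle[of "\<pi> q" x "s n"] by simp
        then show "0 \<le> e - \<bar>bext (\<lambda>q. f (\<pi> q)) (beta_emb q) - f x\<bar>"
          using d(2)[of "\<pi> q" x] by (simp add: bext_emb[OF mem q(1)] dist_real_def)
      qed
      then show ?thesis by simp
    qed
    then have "\<bar>bext (\<lambda>q. f (\<pi> q)) \<zeta> - f x\<bar> \<le> 0" by (rule field_le_epsilon)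
    then show "bext (\<lambda>q. f (\<pi> q)) \<zeta> = f x" by simp
  qed
qed

lemma good_subset_p_preimage:
  fixes z :: "'a::complete_space"
  shows "topspace beta_top - pointed.bad z \<subseteq> p_preimage_MM"
proof
  interpret pointed z .
  fix \<zeta> assume "\<zeta> \<in> topspace beta_top - bad"
  then have \<zeta>: "\<zeta> \<in> topspace beta_top" "\<zeta> \<notin> bad" by auto
  note near = good_near[OF \<zeta>]
  obtain x where x: "\<And>f. f \<in> Cu \<Longrightarrow> bext (\<lambda>q. f (fst q)) \<zeta> = f x"
  proof (rule bounded_projection_limit[where \<pi> = fst and z = z, OF _ \<zeta>(1)])
    show "\<exists>S. finite S \<and> z \<in> S \<and> bext (\<lambda>q. relinf S (fst q)) \<zeta> < \<delta>" if "0 < \<delta>" for \<delta>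
      using near[OF that] by metis
  qed (auto intro: cont_fst_snd)
  obtain y where y: "\<And>f. f \<in> Cu \<Longrightarrow> bext (\<lambda>q. f (snd q)) \<zeta> = f y"
  proof (rule bounded_projection_limit[where \<pi> = snd and z = z, OF _ \<zeta>(1)])
    show "\<exists>S. finite S \<and> z \<in> S \<and> bext (\<lambda>q. relinf S (snd q)) \<zeta> < \<delta>" if "0 < \<delta>" for \<delta>
      using near[OF that] by metis
  qed (auto intro: cont_fst_snd)
  have "p1 \<zeta> = samuel_emb x" "p2 \<zeta> = samuel_emb y"
    using x y by (auto simp: p1_def p2_def samuel_emb_def bext_def tilde_def fun_eq_iff restrict_def)
  then show "\<zeta> \<in> p_preimage_MM" using \<zeta> by (auto simp: p_preimage_MM_def)
qed

theorem theorem5p2: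
  fixes z :: "'a::complete_space"
    and \<mu> :: "((('a \<times> 'a) \<Rightarrow> real) \<Rightarrow> real) measure"
  assumes three_points: "\<exists>a b c :: 'a. a \<noteq> b \<and> b \<noteq> c \<and> a \<noteq> c"
    and radon: "radon_on beta_top \<mu>"
    and optimal: "measure \<mu> (space \<mu>) = dual_norm z (Phi_star \<mu>)"
    and minimal: "preceq_minimal \<mu>"
    and free: "in_free_space z (Phi_star \<mu>)"
  shows "concentrated_on \<mu> p_preimage_MM"
proof -
  interpret pointed z .
  have null: "bad \<in> null_sets \<mu>" using bad_null[OF three_points radon minimal free] .
  have "space \<mu> - bad \<in> sets \<mu>" using null by auto
  moreover have "space \<mu> - bad \<subseteq> p_preimage_MM"
    using good_subset_p_preimage[of z] radon by (simp add: radon_on_def)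
  moreover have "space \<mu> - (space \<mu> - bad) = bad"
    using sets.sets_into_space[OF null_setsD2[OF null]] by auto
  ultimately show ?thesis
    unfolding concentrated_on_def using null_setsD1[OF null] by metis
qed

end
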